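(* Let $\eta:\mathrm{Met}\to\mathrm{PMet}$ be a metric homotopy pairing, i.e. a right adjoint to the forgetful functor $\mathrm{PMet}\to\mathrm{Met}$, $(X,E)\mapsto X$. Then the functor $\mathrm{B}_*\circ\eta:\mathrm{Met}\to\mathrm{hTop}_*$ is naturally isomorphic to the functor $\mathrm{VR}_{2*}:\mathrm{Met}\to\mathrm{hTop}_*$, $X\mapsto(\mathrm{VR}_{2r}(X))_{r>0}$.
   Context: $\mathrm{Met}$ is the category of metric spaces with $1$-Lipschitz maps as morphisms. A metric pair is an ordered pair $(X,E)$ of metric spaces such that $X$ is a metric subspace of $E$. A $1$-Lipschitz map $(X,E)\to(Y,F)$ is a $1$-Lipschitz map $E\to F$ mapping $X$ into $Y$. Two such maps $f,g$ are equivalent if there exist a continuous family $(h_t)_{t\in[0,1]}$ of $1$-Lipschitz maps $E\to F$ and a $1$-Lipschitz map $\phi:X\to Y$ such that $h_0=f$, $h_1=g$ and $h_t|_X=\phi$ for every $t$. $\mathrm{PMet}$ is the category whose objects are metric pairs and whose morphisms $(X,E)\to(Y,F)$ are equivalence classes of $1$-Lipschitz maps $(X,E)\to(Y,F)$. The forgetful functor $\mathrm{PMet}\to\mathrm{Met}$ sends $(X,E)$ to $X$ and a morphism to its restriction to $X$. A persistence family (indexed by $T\subseteq\mathbb{R}$) is a collection $(U_r,f_{r,s})_{r\le s\in T}$ of topological spaces $U_r$ and continuous maps $f_{r,s}:U_r\to U_s$ with $f_{r,r}=\mathrm{id}$ and $f_{s,t}\circ f_{r,s}=f_{r,t}$.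 A morphism from $(U_*,f_{*,*})$ to $(V_*,g_{*,*})$ (same index set) is a collection $(\phi_r)_{r\in T}$, where $\phi_r$ is a homotopy class of maps $U_r\to V_r$, such that $\phi_s\circ f_{r,s}$ is homotopic to $g_{r,s}\circ\phi_r$ for all $r\le s$. $\mathrm{hTop}_*$ is the category of persistence families; here the index set is $(0,\infty)$. For a metric pair $(X,E)$ and $r>0$, $B_r(X,E)=\{z\in E:\exists x\in X,\ d_E(z,x)<r\}$. The functor $\mathrm{B}_*:\mathrm{PMet}\to\mathrm{hTop}_*$ sends $(X,E)$ to $(B_r(X,E))_{r>0}$ with inclusions, and a morphism to the homotopy classes of the maps it induces between the neighborhoods. For a metric space $X$ and $r>0$, $\mathrm{VR}_r(X)$ is (the geometric realization of) the simplicial complex whose vertices are the points of $X$ and whose simplices are the nonempty finite subsets of $X$ of diameter strictly less than $r$; a $1$-Lipschitz map $X\to Y$ induces simplicial maps $\mathrm{VR}_r(X)\to\mathrm{VR}_r(Y)$. *)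

theory Defs
  imports "HOL-Analysis.Analysis" "HOL-Library.Equipollence"
begin

section \<open>Categories, functors, adjunctions\<close>

text \<open>Hom-sets are indexed by their source and target, and composition (which takes source,
  middle object and target as arguments) is written in the order of function composition.  Hom-sets
  of different pairs of objects need not be disjoint.\<close>

record ('o, 'm) cat =
  objs :: "'o set"
  arrs :: "'o \<Rightarrow> 'o \<Rightarrow> 'm set"
  idt :: "'o \<Rightarrow> 'm"
  cmp :: "'o \<Rightarrow> 'o \<Rightarrow> 'o \<Rightarrow> 'm \<Rightarrow> 'm \<Rightarrow> 'm"

locale is_category =
  fixes C :: "('o, 'm) cat"
  assumes idt_in: "A \<in> objs C \<Longrightarrow> idt C A \<in> arrs C A A"
    and cmp_in: "\<lbrakk>A \<in> objs C; B \<in> objs C; D \<in> objs C; f \<in> arrs C A B; g \<in> arrs C B D\<rbrakk>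
      \<Longrightarrow> cmp C A B D g f \<in> arrs C A D"
    and idt_right: "\<lbrakk>A \<in> objs C; B \<in> objs C; f \<in> arrs C A B\<rbrakk> \<Longrightarrow> cmp C A A B f (idt C A) = f"
    and idt_left: "\<lbrakk>A \<in> objs C; B \<in> objs C; f \<in> arrs C A B\<rbrakk> \<Longrightarrow> cmp C A B B (idt C B) f = f"
    and cmp_assoc: "\<lbrakk>A \<in> objs C; B \<in> objs C; D \<in> objs C; E \<in> objs C;
        f \<in> arrs C A B; g \<in> arrs C B D; h \<in> arrs C D E\<rbrakk>
      \<Longrightarrow> cmp C A D E h (cmp C A B D g f) = cmp C A B E (cmp C B D E h g) f"

record ('o, 'm, 'p, 'n) func =
  fob :: "'o \<Rightarrow> 'p"
  far :: "'o \<Rightarrow> 'o \<Rightarrow> 'm \<Rightarrow> 'n"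

locale is_functor =
  fixes C :: "('o, 'm) cat" and D :: "('p, 'n) cat" and F :: "('o, 'm, 'p, 'n) func"
  assumes fob_in: "A \<in> objs C \<Longrightarrow> fob F A \<in> objs D"
    and far_in: "\<lbrakk>A \<in> objs C; B \<in> objs C; f \<in> arrs C A B\<rbrakk>
      \<Longrightarrow> far F A B f \<in> arrs D (fob F A) (fob F B)"
    and far_idt: "A \<in> objs C \<Longrightarrow> far F A A (idt C A) = idt D (fob F A)"
    and far_cmp: "\<lbrakk>A \<in> objs C; B \<in> objs C; E \<in> objs C; f \<in> arrs C A B; g \<in> arrs C B E\<rbrakk>
      \<Longrightarrow> far F A E (cmp C A B E g f)
          = cmp D (fob F A) (fob F B) (fob F E) (far F B E g) (far F A B f)"

definition fcomp ::
    "('p, 'n, 'q, 'k) func \<Rightarrow> ('o, 'm, 'p, 'n) func \<Rightarrow> ('o, 'm, 'q, 'k) func" (infixl \<open>\<circ>\<^sub>F\<close> 55)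
  where "G \<circ>\<^sub>F F = \<lparr>fob = \<lambda>A. fob G (fob F A),
                  far = \<lambda>A B f. far G (fob F A) (fob F B) (far F A B f)\<rparr>"

definition is_iso :: "('o, 'm) cat \<Rightarrow> 'o \<Rightarrow> 'o \<Rightarrow> 'm \<Rightarrow> bool" where
  "is_iso C A B f \<longleftrightarrow> f \<in> arrs C A B \<and>
     (\<exists>g \<in> arrs C B A. cmp C A B A g f = idt C A \<and> cmp C B A B f g = idt C B)"

definition naturally_isomorphic ::
    "('o, 'm) cat \<Rightarrow> ('p, 'n) cat \<Rightarrow> ('o, 'm, 'p, 'n) func \<Rightarrow> ('o, 'm, 'p, 'n) func \<Rightarrow> bool" where
  "naturally_isomorphic C D F G \<longleftrightarrow> is_functor C D F \<and> is_functor C D G \<and>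
     (\<exists>\<tau>. (\<forall>A \<in> objs C. is_iso D (fob F A) (fob G A) (\<tau> A)) \<and>
        (\<forall>A \<in> objs C. \<forall>B \<in> objs C. \<forall>f \<in> arrs C A B.
           cmp D (fob F A) (fob F B) (fob G B) (\<tau> B) (far F A B f)
           = cmp D (fob F A) (fob G A) (fob G B) (far G A B f) (\<tau> A)))"

text \<open>\<open>R : D \<rightarrow> C\<close> is right adjoint to \<open>L : C \<rightarrow> D\<close>: there is a bijection
  \<open>D(L A, X) \<cong> C(A, R X)\<close>, natural in \<open>A\<close> and \<open>X\<close>.\<close>

definition right_adjoint ::
    "('o, 'm) cat \<Rightarrow> ('p, 'n) cat \<Rightarrow> ('o, 'm, 'p, 'n) func \<Rightarrow> ('p, 'n, 'o, 'm) func \<Rightarrow> bool" where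
  "right_adjoint C D L R \<longleftrightarrow> is_functor C D L \<and> is_functor D C R \<and>
     (\<exists>\<Phi>. (\<forall>A \<in> objs C. \<forall>X \<in> objs D.
            bij_betw (\<Phi> A X) (arrs D (fob L A) X) (arrs C A (fob R X))) \<and>
        (\<forall>A' \<in> objs C. \<forall>A \<in> objs C. \<forall>X \<in> objs D. \<forall>X' \<in> objs D.
           \<forall>a \<in> arrs C A' A. \<forall>f \<in> arrs D (fob L A) X. \<forall>x \<in> arrs D X X'.
             \<Phi> A' X' (cmp D (fob L A') X X' x (cmp D (fob L A') (fob L A) X f (far L A' A a)))
             = cmp C A' (fob R X) (fob R X') (far R X X' x)
                 (cmp C A' A (fob R X) (\<Phi> A X f) a)))"


section \<open>Size of the spaces\<close>

text \<open>HOL has no type containing all metric spaces.  All spaces therefore have their points in a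
  type \<open>'u\<close>; the spaces of \<open>Met\<close>, and the subspaces \<open>X\<close> of the metric pairs \<open>(X,E)\<close>, have underlying
  sets in \<open>\<S>\<close>, the ambient spaces \<open>E\<close> have underlying sets in \<open>\<L>\<close>, where \<open>\<S> \<subseteq> \<L>\<close> are collections of
  sets that depend on cardinality only, and \<open>\<L>\<close> has room for the real-valued functions on the sets
  of \<open>\<S>\<close>.  If \<open>\<S> = \<L>\<close> is the collection of small sets of a Grothendieck universe, the categories
  below are those of all small metric spaces and of all small metric pairs.  As this would presuppose
  a type larger than any that HOL can define, \<open>\<S> = \<L>\<close> is allowed but not required: for instance, the
  countable subsets and all subsets of \<open>nat \<Rightarrow> real\<close> are an admissible choice of \<open>\<S>\<close> and \<open>\<L>\<close>.\<close>

definition size_classes :: "'u set set \<Rightarrow> 'u set set \<Rightarrow> bool" where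
  "size_classes \<S> \<L> \<longleftrightarrow>
     (\<forall>A \<in> \<S>. \<forall>B. B \<lesssim> A \<longrightarrow> B \<in> \<S>) \<and> (\<forall>A \<in> \<L>. \<forall>B. B \<lesssim> A \<longrightarrow> B \<in> \<L>) \<and> \<S> \<subseteq> \<L> \<and>
     (\<forall>A \<in> \<S>. \<exists>B \<in> \<L>. (A \<rightarrow>\<^sub>E (UNIV :: real set)) \<lesssim> B)"


section \<open>The categories of metric spaces and of metric pairs\<close>

definition short_map :: "'a metric \<Rightarrow> 'b metric \<Rightarrow> ('a \<Rightarrow> 'b) \<Rightarrow> bool" where
  "short_map X Y f \<longleftrightarrow> f \<in> mspace X \<rightarrow> mspace Y \<and>
     (\<forall>x \<in> mspace X. \<forall>y \<in> mspace X. mdist Y (f x) (f y) \<le> mdist X x y)"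

definition Met :: "'u set set \<Rightarrow> ('u metric, 'u \<Rightarrow> 'u) cat" where
  "Met \<S> = \<lparr>objs = {X. mspace X \<in> \<S>},
            arrs = \<lambda>X Y. {f \<in> extensional (mspace X). short_map X Y f},
            idt = \<lambda>X. restrict id (mspace X),
            cmp = \<lambda>X Y Z g f. compose (mspace X) g f\<rparr>"

text \<open>The distance function of a metric space has irrelevant values off the underlying set,
  so that the subspace condition is stated on points.\<close>

definition metric_pair :: "'u metric \<times> 'u metric \<Rightarrow> bool" where
  "metric_pair P \<longleftrightarrow> mspace (fst P) \<subseteq> mspace (snd P) \<and>
     (\<forall>x \<in> mspace (fst P). \<forall>y \<in> mspace (fst P). mdist (fst P) x y = mdist (snd P) x y)"

definition pair_map :: "'u metric \<times> 'u metric \<Rightarrow> 'u metric \<times> 'u metric \<Rightarrow> ('u \<Rightarrow> 'u) \<Rightarrow> bool" where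
  "pair_map P Q f \<longleftrightarrow> short_map (snd P) (snd Q) f \<and> f ` mspace (fst P) \<subseteq> mspace (fst Q)"

definition pair_homotopic ::
    "'u metric \<times> 'u metric \<Rightarrow> 'u metric \<times> 'u metric \<Rightarrow> ('u \<Rightarrow> 'u) \<Rightarrow> ('u \<Rightarrow> 'u) \<Rightarrow> bool" where
  "pair_homotopic P Q f g \<longleftrightarrow> (\<exists>\<phi>. short_map (fst P) (fst Q) \<phi> \<and>
     homotopic_with (\<lambda>h. short_map (snd P) (snd Q) h \<and> (\<forall>x \<in> mspace (fst P). h x = \<phi> x))
       (mtopology_of (snd P)) (mtopology_of (snd Q)) f g)"

text \<open>Morphisms are represented by functions on the whole type \<open>'u\<close>, and an equivalence class
  contains every function that agrees with one of its members on the ambient space.\<close>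

definition pair_class ::
    "'u metric \<times> 'u metric \<Rightarrow> 'u metric \<times> 'u metric \<Rightarrow> ('u \<Rightarrow> 'u) set \<Rightarrow> ('u \<Rightarrow> 'u) set" where
  "pair_class P Q S = {g. \<exists>f \<in> S. pair_homotopic P Q f g}"

definition PMet :: "'u set set \<Rightarrow> 'u set set \<Rightarrow> ('u metric \<times> 'u metric, ('u \<Rightarrow> 'u) set) cat" where
  "PMet \<S> \<L> = \<lparr>objs = {P. metric_pair P \<and> mspace (fst P) \<in> \<S> \<and> mspace (snd P) \<in> \<L>},
     arrs = \<lambda>P Q. {pair_class P Q {f} | f. pair_map P Q f},
     idt = \<lambda>P. pair_class P P {id},
     cmp = \<lambda>P Q R \<beta> \<alpha>. pair_class P R {g \<circ> f | f g. f \<in> \<alpha> \<and> g \<in> \<beta>}\<rparr>"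

definition forget :: "('u metric \<times> 'u metric, ('u \<Rightarrow> 'u) set, 'u metric, 'u \<Rightarrow> 'u) func" where
  "forget = \<lparr>fob = fst, far = \<lambda>P Q \<alpha>. restrict (SOME f. f \<in> \<alpha>) (mspace (fst P))\<rparr>"

definition metric_homotopy_pairing ::
    "'u set set \<Rightarrow> 'u set set \<Rightarrow>
     ('u metric, 'u \<Rightarrow> 'u, 'u metric \<times> 'u metric, ('u \<Rightarrow> 'u) set) func \<Rightarrow> bool" where
  "metric_homotopy_pairing \<S> \<L> \<eta> \<longleftrightarrow> right_adjoint (PMet \<S> \<L>) (Met \<S>) forget \<eta>"


section \<open>Persistence families\<close>

record 'p family =
  stage :: "real \<Rightarrow> 'p topology"
  step :: "real \<Rightarrow> real \<Rightarrow> 'p \<Rightarrow> 'p"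

definition persistence_family :: "real set \<Rightarrow> 'p family \<Rightarrow> bool" where
  "persistence_family T U \<longleftrightarrow>
     (\<forall>r \<in> T. \<forall>s \<in> T. r \<le> s \<longrightarrow> continuous_map (stage U r) (stage U s) (step U r s)) \<and>
     (\<forall>r \<in> T. \<forall>x \<in> topspace (stage U r). step U r r x = x) \<and>
     (\<forall>r \<in> T. \<forall>s \<in> T. \<forall>t \<in> T. r \<le> s \<longrightarrow> s \<le> t \<longrightarrow>
        (\<forall>x \<in> topspace (stage U r). step U s t (step U r s x) = step U r t x))"

abbreviation homotopic :: "'p topology \<Rightarrow> 'q topology \<Rightarrow> ('p \<Rightarrow> 'q) \<Rightarrow> ('p \<Rightarrow> 'q) \<Rightarrow> bool" where
  "homotopic \<equiv> homotopic_with (\<lambda>_. True)"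

definition homotopy_class :: "'p topology \<Rightarrow> 'q topology \<Rightarrow> ('p \<Rightarrow> 'q) set \<Rightarrow> ('p \<Rightarrow> 'q) set" where
  "homotopy_class X Y S = {g. \<exists>f \<in> S. homotopic X Y f g}"

definition family_maps :: "real set \<Rightarrow> 'p family \<Rightarrow> 'p family \<Rightarrow> (real \<Rightarrow> ('p \<Rightarrow> 'p) set) set" where
  "family_maps T U V = {\<phi> \<in> extensional T.
     (\<forall>r \<in> T. \<exists>f. continuous_map (stage U r) (stage V r) f \<and>
                  \<phi> r = homotopy_class (stage U r) (stage V r) {f}) \<and>
     (\<forall>r \<in> T. \<forall>s \<in> T. r \<le> s \<longrightarrow> (\<forall>f \<in> \<phi> r. \<forall>g \<in> \<phi> s.
        homotopic (stage U r) (stage V s) (g \<circ> step U r s) (step V r s \<circ> f)))}"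

definition hTop :: "real set \<Rightarrow> ('p family, real \<Rightarrow> ('p \<Rightarrow> 'p) set) cat" where
  "hTop T = \<lparr>objs = {U. persistence_family T U},
     arrs = family_maps T,
     idt = \<lambda>U. \<lambda>r\<in>T. homotopy_class (stage U r) (stage U r) {id},
     cmp = \<lambda>U V W \<psi> \<phi>. \<lambda>r\<in>T. homotopy_class (stage U r) (stage W r)
             {g \<circ> f | f g. f \<in> \<phi> r \<and> g \<in> \<psi> r}\<rparr>"

text \<open>Renaming of points along an injection \<open>j\<close>, as a functor.  It is needed because all objects
  of \<open>hTop\<close> have their points in one type.\<close>

definition relabel_stage :: "('p \<Rightarrow> 'q) \<Rightarrow> 'p topology \<Rightarrow> 'q topology" where
  "relabel_stage j X = pullback_topology (range j) (inv j) X"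

definition relabel ::
    "real set \<Rightarrow> ('p \<Rightarrow> 'q) \<Rightarrow>
     ('p family, real \<Rightarrow> ('p \<Rightarrow> 'p) set, 'q family, real \<Rightarrow> ('q \<Rightarrow> 'q) set) func" where
  "relabel T j = \<lparr>fob = \<lambda>U. \<lparr>stage = \<lambda>r. relabel_stage j (stage U r),
                             step = \<lambda>r s. j \<circ> step U r s \<circ> inv j\<rparr>,
     far = \<lambda>U V \<phi>. \<lambda>r\<in>T. homotopy_class (relabel_stage j (stage U r)) (relabel_stage j (stage V r))
             {j \<circ> f \<circ> inv j | f. f \<in> \<phi> r}\<rparr>"


section \<open>Neighborhoods\<close>

definition nbhd :: "real \<Rightarrow> 'u metric \<times> 'u metric \<Rightarrow> 'u set" where
  "nbhd r P = {z \<in> mspace (snd P). \<exists>x \<in> mspace (fst P). mdist (snd P) z x < r}"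

definition nbhd_space :: "real \<Rightarrow> 'u metric \<times> 'u metric \<Rightarrow> 'u topology" where
  "nbhd_space r P = subtopology (mtopology_of (snd P)) (nbhd r P)"

definition B_star ::
    "('u metric \<times> 'u metric, ('u \<Rightarrow> 'u) set, 'u family, real \<Rightarrow> ('u \<Rightarrow> 'u) set) func" where
  "B_star = \<lparr>fob = \<lambda>P. \<lparr>stage = \<lambda>r. nbhd_space r P, step = \<lambda>r s. id\<rparr>,
     far = \<lambda>P Q \<alpha>. \<lambda>r\<in>{0<..}. homotopy_class (nbhd_space r P) (nbhd_space r Q) \<alpha>\<rparr>"


section \<open>Vietoris--Rips complexes\<close>

text \<open>A point of the geometric realization is given by its barycentric coordinates, extended by
  zero to all of \<open>'v\<close>.  A set is open if its intersection with every closed simplex is open in the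
  Euclidean topology of that simplex, which is the topology of pointwise convergence.\<close>

definition closed_simplex :: "'v set \<Rightarrow> ('v \<Rightarrow> real) set" where
  "closed_simplex \<sigma> = {a. (\<forall>v. 0 \<le> a v) \<and> (\<forall>v. v \<notin> \<sigma> \<longrightarrow> a v = 0) \<and> (\<Sum>v\<in>\<sigma>. a v) = 1}"

definition realization :: "'v set set \<Rightarrow> ('v \<Rightarrow> real) topology" where
  "realization K = topology (\<lambda>U. U \<subseteq> (\<Union>\<sigma>\<in>K. closed_simplex \<sigma>) \<and>
     (\<forall>\<sigma>\<in>K. openin (top_of_set (closed_simplex \<sigma>)) (U \<inter> closed_simplex \<sigma>)))"

definition simplicial_extension :: "('v \<Rightarrow> 'w) \<Rightarrow> ('v \<Rightarrow> real) \<Rightarrow> 'w \<Rightarrow> real" where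
  "simplicial_extension f a = (\<lambda>w. \<Sum>v | a v \<noteq> 0 \<and> f v = w. a v)"

definition diam :: "'u metric \<Rightarrow> 'u set \<Rightarrow> real" where
  "diam X \<sigma> = (SUP p \<in> \<sigma> \<times> \<sigma>. mdist X (fst p) (snd p))"

definition VR :: "real \<Rightarrow> 'u metric \<Rightarrow> 'u set set" where
  "VR r X = {\<sigma>. \<sigma> \<noteq> {} \<and> finite \<sigma> \<and> \<sigma> \<subseteq> mspace X \<and> diam X \<sigma> < r}"

definition VR_2star ::
    "('u metric, 'u \<Rightarrow> 'u, ('u \<Rightarrow> real) family, real \<Rightarrow> (('u \<Rightarrow> real) \<Rightarrow> 'u \<Rightarrow> real) set) func" where
  "VR_2star = \<lparr>fob = \<lambda>X. \<lparr>stage = \<lambda>r. realization (VR (2 * r) X), step = \<lambda>r s. id\<rparr>,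
     far = \<lambda>X Y f. \<lambda>r\<in>{0<..}. homotopy_class (realization (VR (2 * r) X))
             (realization (VR (2 * r) Y)) {simplicial_extension f}\<rparr>"

end

theory Submission
  imports Defs "HOL-Probability.Discrete_Topology"
begin

text \<open>For any metric pair \<open>(X,E)\<close>, a partition of unity subordinate to the balls of radius \<open>r\<close>
  about the points of \<open>X\<close> gives a map \<open>p : B\<^sub>r(X,E) \<rightarrow> VR\<^sub>2\<^sub>r(X)\<close>.  Two maps that are close to each
  other in the sense that their values at a point are carried by a common simplex are homotopic, so that
  \<open>p\<close> is unique up to homotopy, and natural in \<open>r\<close> and in the pair.

  It is a homotopy equivalence for \<open>(X,E)\<close> with \<open>E\<close> the space of bounded functions on \<open>X\<close>, which
  contains \<open>X\<close> by the Kuratowski embedding:  the barycentric coordinates of a point determine a function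
  that has distance less than \<open>r\<close> from all vertices with a large coordinate, and this gives a homotopy
  inverse.  Of the pair \<open>\<eta> X\<close> one only needs that, by the universal property of the adjunction and the
  injectivity of the space of bounded functions, its identity factors through this pair up to
  homotopy.\<close>

section \<open>Maps into and out of geometric realizations\<close>

text \<open>The inverse of \<open>p\<close> is therefore built in the normed space of bounded
  functions, where balls are convex, and pushed to \<open>E\<close> by a 1-Lipschitz map
  \<open>\<Theta>\<close>. Only \<open>\<Theta> \<circ> \<Theta>'\<close> has to be homotopic to the
  identity; the composite \<open>p \<circ> n\<close> is controlled by nearness to vertices alone.
  Two things shape the formulas. A vertex with a tiny coordinate must not influence the centre, or
  continuity is lost at faces; but then the centre need not be near that vertex. Hence the map
  \<open>sharpen\<close>, which is homotopic to the identity and discards such vertices before the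
  comparison with \<open>p \<circ> n\<close>. The thresholds 1/4 and 1/2 of the sum of squares leave
  a gap: a vertex above 1/2 at nearby points is at least 1/4 at the point itself, so one fixed
  simplex carries a whole neighbourhood. Secondly, simplices have diameter strictly less than
  \<open>2 * r\<close>, which makes half of it strictly less than \<open>r\<close>, as open
  neighbourhoods require.\<close>

lemma openin_realization:
  "openin (realization K) U \<longleftrightarrow> U \<subseteq> (\<Union>\<sigma>\<in>K. closed_simplex \<sigma>) \<and>
     (\<forall>\<sigma>\<in>K. openin (top_of_set (closed_simplex \<sigma>)) (U \<inter> closed_simplex \<sigma>))"
proof -
  have "istopology (\<lambda>U. U \<subseteq> (\<Union>\<sigma>\<in>K. closed_simplex \<sigma>) \<and>
     (\<forall>\<sigma>\<in>K. openin (top_of_set (closed_simplex \<sigma>)) (U \<inter> closed_simplex \<sigma>)))"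
    unfolding istopology_def
  proof (intro conjI allI impI; (elim conjE)?)
    fix S T assume S: "\<forall>\<sigma>\<in>K. openin (top_of_set (closed_simplex \<sigma>)) (S \<inter> closed_simplex \<sigma>)"
      and T: "\<forall>\<sigma>\<in>K. openin (top_of_set (closed_simplex \<sigma>)) (T \<inter> closed_simplex \<sigma>)"
    show "\<forall>\<sigma>\<in>K. openin (top_of_set (closed_simplex \<sigma>)) (S \<inter> T \<inter> closed_simplex \<sigma>)"
    proof
      fix \<sigma> assume "\<sigma> \<in> K"
      with S T have "openin (top_of_set (closed_simplex \<sigma>))
          ((S \<inter> closed_simplex \<sigma>) \<inter> (T \<inter> closed_simplex \<sigma>))" by blast
      then show "openin (top_of_set (closed_simplex \<sigma>)) (S \<inter> T \<inter> closed_simplex \<sigma>)"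
        by (simp add: Int_ac)
    qed
  next
    fix \<K> assume *: "\<forall>U\<in>\<K>. U \<subseteq> (\<Union>\<sigma>\<in>K. closed_simplex \<sigma>) \<and>
     (\<forall>\<sigma>\<in>K. openin (top_of_set (closed_simplex \<sigma>)) (U \<inter> closed_simplex \<sigma>))"
    show "\<forall>\<sigma>\<in>K. openin (top_of_set (closed_simplex \<sigma>)) (\<Union>\<K> \<inter> closed_simplex \<sigma>)"
    proof
      fix \<sigma> assume "\<sigma> \<in> K"
      with * have "openin (top_of_set (closed_simplex \<sigma>)) (\<Union>U\<in>\<K>. U \<inter> closed_simplex \<sigma>)" by blast
      then show "openin (top_of_set (closed_simplex \<sigma>)) (\<Union>\<K> \<inter> closed_simplex \<sigma>)"
        by (simp only: Int_Union2)
    qed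
  qed auto
  then show ?thesis
    by (simp add: realization_def)
qed

lemma topspace_realization: "topspace (realization K) = (\<Union>\<sigma>\<in>K. closed_simplex \<sigma>)"
proof -
  have "openin (realization K) (\<Union>\<sigma>\<in>K. closed_simplex \<sigma>)"
    by (auto simp: openin_realization Int_absorb1 SUP_upper)
  then show ?thesis
    by (meson openin_realization openin_subset openin_topspace subset_antisym)
qed

lemma continuous_map_simplex_realization:
  "\<sigma> \<in> K \<Longrightarrow> continuous_map (top_of_set (closed_simplex \<sigma>)) (realization K) id"
  unfolding continuous_map_def topspace_realization openin_realization
  by (auto simp: Int_def conj_commute)

text \<open>The weak topology is final for the inclusions of the closed simplices, so every map out
  of a realization can be treated simplex by simplex.\<close>

lemma continuous_map_from_realization:
  "continuous_map (realization K) Z f \<longleftrightarrow>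
     (\<forall>\<sigma>\<in>K. continuous_map (top_of_set (closed_simplex \<sigma>)) Z f)"
proof (intro iffI ballI)
  fix \<sigma> assume "continuous_map (realization K) Z f" "\<sigma> \<in> K"
  then show "continuous_map (top_of_set (closed_simplex \<sigma>)) Z f"
    using continuous_map_compose[OF continuous_map_simplex_realization] by fastforce
next
  assume *: "\<forall>\<sigma>\<in>K. continuous_map (top_of_set (closed_simplex \<sigma>)) Z f"
  show "continuous_map (realization K) Z f"
    unfolding continuous_map_def
  proof (intro conjI allI impI)
    show "f \<in> topspace (realization K) \<rightarrow> topspace Z"
      using * by (fastforce simp: topspace_realization dest: continuous_map_funspace)
    fix U assume U: "openin Z U"
    have "{x \<in> topspace (realization K). f x \<in> U} \<inter> closed_simplex \<sigma> =
        {x \<in> topspace (top_of_set (closed_simplex \<sigma>)). f x \<in> U}" if "\<sigma> \<in> K" for \<sigma>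
      using that by (auto simp: topspace_realization)
    then show "openin (realization K) {x \<in> topspace (realization K). f x \<in> U}"
      using * U unfolding openin_realization
      by (auto simp: topspace_realization continuous_map_def)
  qed
qed

text \<open>Since the interval is locally compact, its product with a realization again has the weak
  topology.\<close>

lemma continuous_map_from_cylinder:
  assumes h: "\<And>\<sigma>. \<sigma> \<in> K \<Longrightarrow>
    continuous_map (prod_topology (top_of_set {0..1::real}) (top_of_set (closed_simplex \<sigma>))) Z h"
  shows "continuous_map (prod_topology (top_of_set {0..1}) (realization K)) Z h"
  unfolding continuous_map_def
proof (intro conjI allI impI)
  show "h \<in> topspace (prod_topology (top_of_set {0..1}) (realization K)) \<rightarrow> topspace Z"
    using h[THEN continuous_map_funspace] by (fastforce simp: topspace_realization)
  fix U assume U: "openin Z U"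
  let ?P = "{x \<in> topspace (prod_topology (top_of_set {0..1::real}) (realization K)). h x \<in> U}"
  show "openin (prod_topology (top_of_set {0..1}) (realization K)) ?P"
  proof (subst openin_subopen, intro ballI)
    fix p assume p: "p \<in> ?P"
    obtain t a where ta: "p = (t,a)" by fastforce
    then have t: "t \<in> {0..1}" and a: "a \<in> topspace (realization K)" and hU: "h (t,a) \<in> U"
      using p by auto
    obtain \<sigma> where \<sigma>: "\<sigma> \<in> K" "a \<in> closed_simplex \<sigma>"
      using a by (auto simp: topspace_realization)
    have "continuous_map (top_of_set {0..1::real}) Z (h \<circ> (\<lambda>t. (t,a)))"
      by (rule continuous_map_compose[OF _ h[OF \<sigma>(1)]]) (use \<sigma> in \<open>auto intro!: continuous_intros\<close>)
    then have "openin (top_of_set {0..1::real}) {s \<in> {0..1}. h (s,a) \<in> U}"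
      using U by (auto simp: continuous_map_def)
    then obtain e where e: "e > 0" "\<And>s. s \<in> {0..1} \<Longrightarrow> dist s t < e \<Longrightarrow> h (s,a) \<in> U"
      using t hU by (auto simp: openin_euclidean_subtopology_iff)
    \<comment> \<open>Half of \<open>e\<close> keeps the closed interval inside the open one on
      which \<open>h (s,a)\<close> stays in \<open>U\<close>; compactness of \<open>J\<close> is
      what the tube lemma needs.\<close>
    define J where "J = {0..1} \<inter> cball t (e/2)"
    have J: "compact J" "J \<subseteq> {0..1}" "\<And>s. s \<in> J \<Longrightarrow> h (s,a) \<in> U"
      using e by (auto simp: J_def dist_commute intro!: compact_Int)
    have JI: "compactin (top_of_set {0..1::real}) J"
      using J by (simp add: compactin_subtopology)
    \<comment> \<open>All \<open>b\<close> for which the whole of \<open>J\<close> goes to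
      \<open>U\<close>, in all simplices at once: openness can be tested on each closed simplex by
      the tube lemma, and a single product neighbourhood results.\<close>
    define V where "V = {b \<in> topspace (realization K). \<forall>s\<in>J. h (s,b) \<in> U}"
    have "openin (realization K) V"
      unfolding openin_realization
    proof (intro conjI ballI)
      show "V \<subseteq> (\<Union>\<sigma>\<in>K. closed_simplex \<sigma>)"
        by (auto simp: V_def topspace_realization)
      fix \<tau> assume \<tau>: "\<tau> \<in> K"
      let ?W = "{x \<in> {0..1} \<times> closed_simplex \<tau>. h x \<in> U}"
      have W: "openin (prod_topology (top_of_set {0..1::real}) (top_of_set (closed_simplex \<tau>))) ?W"
        using h[OF \<tau>] U by (simp add: continuous_map_def)
      show "openin (top_of_set (closed_simplex \<tau>)) (V \<inter> closed_simplex \<tau>)"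
      proof (subst openin_subopen, intro ballI)
        fix b assume b: "b \<in> V \<inter> closed_simplex \<tau>"
        then have "J \<times> {b} \<subseteq> ?W"
          using J(2) by (auto simp: V_def)
        from tube_lemma_left[OF W JI _ this] b obtain A B where
          AB: "openin (top_of_set (closed_simplex \<tau>)) B" "J \<subseteq> A" "b \<in> B" "A \<times> B \<subseteq> ?W"
          by auto
        then have "B \<subseteq> V \<inter> closed_simplex \<tau>"
          using \<tau> J(2) by (auto simp: V_def topspace_realization dest!: openin_imp_subset)
        with AB show "\<exists>T. openin (top_of_set (closed_simplex \<tau>)) T \<and> b \<in> T \<and> T \<subseteq> V \<inter> closed_simplex \<tau>"
          by blast
      qed
    qed
    moreover have "openin (top_of_set {0..1::real}) ({0..1} \<inter> ball t (e/2))"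
      by (simp add: openin_open_Int)
    ultimately have "openin (prod_topology (top_of_set {0..1}) (realization K))
        (({0..1} \<inter> ball t (e/2)) \<times> V)"
      by (simp add: openin_prod_Times_iff)
    moreover have "p \<in> ({0..1} \<inter> ball t (e/2)) \<times> V"
      using ta t a J e by (auto simp: V_def)
    moreover have "({0..1} \<inter> ball t (e/2)) \<times> V \<subseteq> ?P"
      by (auto simp: V_def J_def)
    ultimately show "\<exists>T. openin (prod_topology (top_of_set {0..1}) (realization K)) T \<and> p \<in> T \<and> T \<subseteq> ?P"
      by blast
  qed
qed

lemma continuous_map_euclidean_fun_iff:
  "continuous_map X euclidean f \<longleftrightarrow> (\<forall>v. continuous_map X euclideanreal (\<lambda>x. f x v))"
  for f :: "'a \<Rightarrow> 'v \<Rightarrow> real"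
  using continuous_map_componentwise_UNIV[of X "\<lambda>_. euclideanreal" f]
  by (simp add: euclidean_product_topology)

text \<open>A map into a realization, given in barycentric coordinates, need not be continuous if its
  coordinates are; it is if, in addition, it is locally carried by single simplices.  The definition
  for two maps at once expresses that they are contiguous, locally uniformly.\<close>

definition carried :: "'a topology \<Rightarrow> 'v set set \<Rightarrow> ('a \<Rightarrow> 'v \<Rightarrow> real) \<Rightarrow> ('a \<Rightarrow> 'v \<Rightarrow> real) \<Rightarrow> bool"
  where "carried X K p q \<longleftrightarrow> (\<forall>x \<in> topspace X. \<exists>N \<sigma>. openin X N \<and> x \<in> N \<and> \<sigma> \<in> K \<and>
     p ` N \<subseteq> closed_simplex \<sigma> \<and> q ` N \<subseteq> closed_simplex \<sigma>)"

lemma carriedE: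
  assumes "carried X K p q" "x \<in> topspace X"
  obtains N \<sigma> where "openin X N" "x \<in> N" "\<sigma> \<in> K" "p ` N \<subseteq> closed_simplex \<sigma>"
    "q ` N \<subseteq> closed_simplex \<sigma>"
  using assms unfolding carried_def by blast

text \<open>On a neighbourhood carried by one simplex, the weak topology may be replaced by the
  topology of that simplex, which is pointwise convergence of coordinates.\<close>

lemma continuous_map_into_realization:
  assumes "carried X K p p" "\<And>v. continuous_map X euclideanreal (\<lambda>x. p x v)"
  shows "continuous_map X (realization K) p"
proof -
  have *: "continuous_map X euclidean p"
    using assms(2) by (simp add: continuous_map_euclidean_fun_iff)
  show ?thesis
    unfolding continuous_map_def
  proof (intro conjI allI impI)
    show "p \<in> topspace X \<rightarrow> topspace (realization K)"
      using assms(1) unfolding carried_def topspace_realization by fast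
    fix U assume U: "openin (realization K) U"
    show "openin X {x \<in> topspace X. p x \<in> U}"
    proof (subst openin_subopen, intro ballI)
      fix x assume x: "x \<in> {x \<in> topspace X. p x \<in> U}"
      then obtain N \<sigma> where N: "openin X N" "x \<in> N" "\<sigma> \<in> K" "p ` N \<subseteq> closed_simplex \<sigma>"
        using carriedE[OF assms(1)] by (metis (no_types, lifting) mem_Collect_eq)
      have "openin (top_of_set (closed_simplex \<sigma>)) (U \<inter> closed_simplex \<sigma>)"
        using U N(3) by (simp add: openin_realization)
      then obtain O' where O': "open O'" "U \<inter> closed_simplex \<sigma> = closed_simplex \<sigma> \<inter> O'"
        by (auto simp: openin_open)
      have "openin X {x \<in> topspace X. p x \<in> O'}"
        using * O'(1) by (simp add: continuous_map_def)
      then have "openin X (N \<inter> {x \<in> topspace X. p x \<in> O'})"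
        using N(1) by blast
      moreover have "x \<in> N \<inter> {x \<in> topspace X. p x \<in> O'}"
        using N x O'(2) by blast
      moreover have "N \<inter> {x \<in> topspace X. p x \<in> O'} \<subseteq> {x \<in> topspace X. p x \<in> U}"
        using N O'(2) by blast
      ultimately show "\<exists>T. openin X T \<and> x \<in> T \<and> T \<subseteq> {x \<in> topspace X. p x \<in> U}"
        by blast
    qed
  qed
qed

lemma convex_closed_simplex:
  assumes "a \<in> closed_simplex \<sigma>" "b \<in> closed_simplex \<sigma>" "t \<in> {0..1}"
  shows "(\<lambda>v. (1 - t) * a v + t * b v) \<in> closed_simplex \<sigma>"
  using assms by (auto simp: closed_simplex_def sum.distrib simp flip: sum_distrib_left)

definition linear_path :: "('a \<Rightarrow> 'v \<Rightarrow> real) \<Rightarrow> ('a \<Rightarrow> 'v \<Rightarrow> real) \<Rightarrow> real \<times> 'a \<Rightarrow> 'v \<Rightarrow> real"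
  where "linear_path p q = (\<lambda>(t,x) v. (1 - t) * p x v + t * q x v)"

text \<open>A closed simplex is convex, so the path between two points of a common simplex stays in
  it and is carried by the simplices that carry its ends.\<close>

lemma continuous_map_linear_path:
  assumes c: "carried X K p q" and p: "\<And>v. continuous_map X euclideanreal (\<lambda>x. p x v)"
    and q: "\<And>v. continuous_map X euclideanreal (\<lambda>x. q x v)"
  shows "continuous_map (prod_topology (top_of_set {0..1}) X) (realization K) (linear_path p q)"
proof (rule continuous_map_into_realization)
  let ?Y = "prod_topology (top_of_set {0..1::real}) X"
  show "carried ?Y K (linear_path p q) (linear_path p q)"
    unfolding carried_def
  proof
    fix y assume "y \<in> topspace ?Y"
    then obtain t x where y: "y = (t,x)" "t \<in> {0..1}" "x \<in> topspace X" by auto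
    obtain N \<sigma> where N: "openin X N" "x \<in> N" "\<sigma> \<in> K" "p ` N \<subseteq> closed_simplex \<sigma>"
        "q ` N \<subseteq> closed_simplex \<sigma>"
      using carriedE[OF c y(3)] .
    have "linear_path p q ` ({0..1} \<times> N) \<subseteq> closed_simplex \<sigma>"
      using N(4,5) by (auto simp: linear_path_def intro!: convex_closed_simplex)
    moreover have "openin ?Y ({0..1} \<times> N)"
      using N by (simp add: openin_prod_Times_iff)
    ultimately show "\<exists>N \<sigma>. openin ?Y N \<and> y \<in> N \<and> \<sigma> \<in> K \<and>
        linear_path p q ` N \<subseteq> closed_simplex \<sigma> \<and> linear_path p q ` N \<subseteq> closed_simplex \<sigma>"
      using N y by (metis SigmaI)
  qed
  fix v
  have t: "continuous_map ?Y euclideanreal fst"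
    by (metis continuous_map_fst continuous_map_in_subtopology)
  have "continuous_map ?Y euclideanreal (\<lambda>y. p (snd y) v)" "continuous_map ?Y euclideanreal (\<lambda>y. q (snd y) v)"
    using continuous_map_compose[OF continuous_map_snd p] continuous_map_compose[OF continuous_map_snd q]
    by (auto simp: o_def)
  then show "continuous_map ?Y euclideanreal (\<lambda>y. linear_path p q y v)"
    using t unfolding linear_path_def case_prod_beta by (intro continuous_intros)
qed

lemma carried_homotopic:
  assumes "carried X K p q" "\<And>v. continuous_map X euclideanreal (\<lambda>x. p x v)"
    "\<And>v. continuous_map X euclideanreal (\<lambda>x. q x v)"
  shows "homotopic X (realization K) p q"
  unfolding homotopic_with_def
  by (rule exI[of _ "linear_path p q"])
    (use continuous_map_linear_path[OF assms] in \<open>auto simp: linear_path_def\<close>)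

text \<open>The condition is required on each closed simplex only. On the whole realization it would
  be too strong, since a neighbourhood of a vertex can meet several simplices that lie in no common
  one; the homotopies are glued by the weak topology of the cylinder.\<close>

lemma carried_homotopic_realization:
  assumes "\<And>\<sigma>. \<sigma> \<in> L \<Longrightarrow> carried (top_of_set (closed_simplex \<sigma>)) K p q"
    "\<And>\<sigma> v. \<sigma> \<in> L \<Longrightarrow> continuous_on (closed_simplex \<sigma>) (\<lambda>x. p x v)"
    "\<And>\<sigma> v. \<sigma> \<in> L \<Longrightarrow> continuous_on (closed_simplex \<sigma>) (\<lambda>x. q x v)"
  shows "homotopic (realization L) (realization K) p q"
proof -
  have "continuous_map (prod_topology (top_of_set {0..1}) (realization L)) (realization K) (linear_path p q)"
    using assms by (intro continuous_map_from_cylinder continuous_map_linear_path) auto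
  then show ?thesis
    unfolding homotopic_with_def
    by (intro exI[of _ "linear_path p q"]) (auto simp: linear_path_def)
qed

section \<open>Partitions of unity on metric spaces\<close>

lemma continuous_map_if_locally_eq:
  assumes "\<And>x. x \<in> topspace X \<Longrightarrow> \<exists>N g. openin X N \<and> x \<in> N \<and> continuous_map X Y g \<and> (\<forall>y\<in>N. f y = g y)"
  shows "continuous_map X Y f"
  unfolding continuous_map_def
proof (intro conjI allI impI)
  show "f \<in> topspace X \<rightarrow> topspace Y"
  proof
    fix x assume "x \<in> topspace X"
    then obtain N g where "x \<in> N" "continuous_map X Y g" "\<forall>y\<in>N. f y = g y"
      using assms by blast
    then show "f x \<in> topspace Y"
      using \<open>x \<in> topspace X\<close> by (auto dest: continuous_map_funspace)
  qed
  fix U assume U: "openin Y U"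
  show "openin X {x \<in> topspace X. f x \<in> U}"
  proof (subst openin_subopen, intro ballI)
    fix x assume x: "x \<in> {x \<in> topspace X. f x \<in> U}"
    then obtain N g where N: "openin X N" "x \<in> N" "continuous_map X Y g" "\<forall>y\<in>N. f y = g y"
      using assms by blast
    have "openin X (N \<inter> {x \<in> topspace X. g x \<in> U})"
      using N U by (auto simp: continuous_map_def)
    moreover have "x \<in> N \<inter> {x \<in> topspace X. g x \<in> U}"
      "N \<inter> {x \<in> topspace X. g x \<in> U} \<subseteq> {x \<in> topspace X. f x \<in> U}"
      using N x by auto
    ultimately show "\<exists>T. openin X T \<and> x \<in> T \<and> T \<subseteq> {x \<in> topspace X. f x \<in> U}"
      by blast
  qed
qed

lemma mdist_self [simp]: "x \<in> mspace E \<Longrightarrow> mdist E x x = 0"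
  by simp

lemma continuous_map_real_Lipschitz:
  assumes "\<And>x y. x \<in> mspace E \<Longrightarrow> y \<in> mspace E \<Longrightarrow> \<bar>f x - f y\<bar> \<le> c * mdist E x y"
  shows "continuous_map (mtopology_of E) euclideanreal f"
proof -
  have "Lipschitz_continuous_map E euclidean_metric f"
    using assms by (auto simp: Lipschitz_continuous_map_def dist_real_def)
  then show ?thesis
    using Lipschitz_continuous_imp_continuous_map by fastforce
qed

text \<open>The element 0 is inserted because the index set may be empty, as it is for the
  predecessors of the first element of a well-order.\<close>

lemma abs_Sup_diff_le:
  fixes f g :: "'a \<Rightarrow> real"
  assumes "\<And>i. i \<in> A \<Longrightarrow> \<bar>f i - g i\<bar> \<le> d" "\<And>i. i \<in> A \<Longrightarrow> f i \<le> b" "\<And>i. i \<in> A \<Longrightarrow> g i \<le> b" "0 \<le> d"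
  shows "\<bar>Sup (insert 0 (f ` A)) - Sup (insert 0 (g ` A))\<bar> \<le> d"
proof -
  have *: "Sup (insert 0 (f ` A)) \<le> Sup (insert 0 (g ` A)) + d"
    if fg: "\<And>i. i \<in> A \<Longrightarrow> \<bar>f i - g i\<bar> \<le> d" and g: "\<And>i. i \<in> A \<Longrightarrow> g i \<le> b" for f g
  proof (rule cSup_least)
    have bdd: "bdd_above (insert 0 (g ` A))"
      using g by (auto intro!: bdd_aboveI2)
    fix y assume "y \<in> insert 0 (f ` A)"
    then consider "y = 0" | i where "i \<in> A" "y = f i" by blast
    then show "y \<le> Sup (insert 0 (g ` A)) + d"
    proof cases
      case 1
      have "0 \<le> Sup (insert 0 (g ` A))" using bdd by (intro cSup_upper) auto
      with 1 show ?thesis using \<open>0 \<le> d\<close> by simp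
    next
      case 2
      have "g i \<le> Sup (insert 0 (g ` A))" using bdd 2 by (intro cSup_upper) auto
      with 2 fg[of i] show ?thesis by simp
    qed
  qed simp
  have "Sup (insert 0 (f ` A)) \<le> Sup (insert 0 (g ` A)) + d" by (rule *) (use assms in auto)
  moreover have "Sup (insert 0 (g ` A)) \<le> Sup (insert 0 (f ` A)) + d"
    by (rule *) (use assms in \<open>auto simp: abs_minus_commute\<close>)
  ultimately show ?thesis by linarith
qed

text \<open>Along the indices that exceed all their predecessors by at least \<open>\<delta>\<close>, the values of a
  bounded function climb in steps of \<open>\<delta>\<close>.\<close>

lemma finite_if_well_separated:
  fixes f :: "'a \<Rightarrow> real"
  assumes R: "total R" and \<delta>: "\<delta> > 0" and f: "\<And>x. x \<in> A \<Longrightarrow> 0 \<le> f x \<and> f x \<le> b"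
    and sep: "\<And>x y. x \<in> A \<Longrightarrow> y \<in> A \<Longrightarrow> (y,x) \<in> R \<Longrightarrow> f y + \<delta> \<le> f x"
  shows "finite A"
proof (rule inj_on_finite[where f = "\<lambda>x. \<lfloor>f x / \<delta>\<rfloor>" and B = "{0..\<lfloor>b / \<delta>\<rfloor>}"])
  \<comment> \<open>Values that differ by at least \<open>\<delta>\<close> have different integer
    parts after division by \<open>\<delta>\<close>, and the bound leaves only finitely many
    integers.\<close>
  have step: "\<lfloor>f y / \<delta>\<rfloor> < \<lfloor>f x / \<delta>\<rfloor>" if "x \<in> A" "y \<in> A" "(y,x) \<in> R" for x y
  proof -
    have "f y / \<delta> + 1 \<le> f x / \<delta>"
      using divide_right_mono[OF sep[OF that], of \<delta>] \<delta> by (simp add: add_divide_distrib)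
    then show ?thesis by linarith
  qed
  show "inj_on (\<lambda>x. \<lfloor>f x / \<delta>\<rfloor>) A"
  proof (rule inj_onI, rule ccontr)
    fix x y assume xy: "x \<in> A" "y \<in> A" "\<lfloor>f x / \<delta>\<rfloor> = \<lfloor>f y / \<delta>\<rfloor>" "x \<noteq> y"
    then have "(x,y) \<in> R \<or> (y,x) \<in> R"
      using R by (auto simp: total_on_def)
    with step[of x y] step[of y x] xy show False by auto
  qed
  show "(\<lambda>x. \<lfloor>f x / \<delta>\<rfloor>) ` A \<subseteq> {0..\<lfloor>b / \<delta>\<rfloor>}"
    using f \<delta> by (auto intro!: floor_mono divide_right_mono)
qed simp

text \<open>Well-order the index set and let \<open>w x\<close> be the amount by which \<open>u x\<close> exceeds the supremum of
  all its predecessors.  By the previous lemma, near any point only finitely many \<open>w x\<close> exceed a given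
  positive number, so that cutting off at half of their supremum gives a locally finite family.\<close>

lemma partition_of_unity:
  fixes u :: "'v \<Rightarrow> 'e \<Rightarrow> real" and E :: "'e metric" and I :: "'v set"
  defines "B \<equiv> {z \<in> mspace E. \<exists>x\<in>I. u x z > 0}"
  assumes lip: "\<And>x y z. x \<in> I \<Longrightarrow> y \<in> mspace E \<Longrightarrow> z \<in> mspace E \<Longrightarrow> \<bar>u x y - u x z\<bar> \<le> mdist E y z"
    and bd: "\<And>x z. x \<in> I \<Longrightarrow> z \<in> mspace E \<Longrightarrow> 0 \<le> u x z \<and> u x z \<le> b"
  obtains p where "\<And>v. continuous_map (subtopology (mtopology_of E) B) euclideanreal (\<lambda>z. p z v)"
    "\<And>z. z \<in> B \<Longrightarrow> \<exists>N \<sigma>. openin (subtopology (mtopology_of E) B) N \<and> z \<in> N \<and>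
        \<sigma> \<noteq> {} \<and> finite \<sigma> \<and> \<sigma> \<subseteq> {x\<in>I. u x z > 0} \<and> p ` N \<subseteq> closed_simplex \<sigma>"
proof -
  obtain W :: "'v rel" where W: "well_order_on UNIV W"
    using well_order_on by blast
  define R where "R = W - Id"
  have wf: "wf R" and tot: "total R"
    using W by (auto simp: R_def well_order_on_def linear_order_on_def total_on_def)
  define S where "S x z = Sup (insert 0 ((\<lambda>y. u y z) ` {y\<in>I. (y,x) \<in> R}))" for x z
  define w where "w x z = max 0 (u x z - S x z)" for x z
  define M where "M z = Sup (insert 0 ((\<lambda>x. w x z) ` I))" for z
  define v where "v x z = (if x \<in> I then max 0 (w x z - M z / 2) else 0)" for x z

  have Slip: "\<bar>S x y - S x z\<bar> \<le> mdist E y z" if "y \<in> mspace E" "z \<in> mspace E" for x y z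
    unfolding S_def by (rule abs_Sup_diff_le[where b = b]) (use that lip bd in auto)
  have bddS: "bdd_above (insert 0 ((\<lambda>y. u y z) ` {y\<in>I. (y,x) \<in> R}))" if "z \<in> mspace E" for x z
    using bd that by (auto intro!: bdd_aboveI2[where M = b])
  have S0: "0 \<le> S x z" if "z \<in> mspace E" for x z
    unfolding S_def by (rule cSup_upper[OF _ bddS]) (use that in auto)
  have Su: "u y z \<le> S x z" if "z \<in> mspace E" "y \<in> I" "(y,x) \<in> R" for x y z
    unfolding S_def by (rule cSup_upper[OF _ bddS]) (use that in auto)
  have wlip: "\<bar>w x y - w x z\<bar> \<le> 2 * mdist E y z" if "x \<in> I" "y \<in> mspace E" "z \<in> mspace E" for x y z
    using Slip[OF that(2,3), of x] lip[OF that] unfolding w_def by linarith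
  have w0: "0 \<le> w x z" for x z
    by (simp add: w_def)
  have wu: "w x z \<le> u x z" if "x \<in> I" "z \<in> mspace E" for x z
    using S0[OF that(2), of x] bd[OF that] by (simp add: w_def)
  have wb: "w x z \<le> b" if "x \<in> I" "z \<in> mspace E" for x z
    using wu[OF that] bd[OF that] by linarith
  have bddM: "bdd_above (insert 0 ((\<lambda>x. w x z) ` I))" if "z \<in> mspace E" for z
    using wb that by (auto intro!: bdd_aboveI2[where M = b])
  have Mlip: "\<bar>M y - M z\<bar> \<le> 2 * mdist E y z" if "y \<in> mspace E" "z \<in> mspace E" for y z
    unfolding M_def by (rule abs_Sup_diff_le[where b = b]) (use that wlip wb in auto)
  have Mw: "w x z \<le> M z" if "x \<in> I" "z \<in> mspace E" for x z
    unfolding M_def by (rule cSup_upper[OF _ bddM]) (use that in auto)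
  have vlip: "\<bar>v x y - v x z\<bar> \<le> 3 * mdist E y z" if "y \<in> mspace E" "z \<in> mspace E" for x y z
  proof (cases "x \<in> I")
    case True
    then show ?thesis
      using Mlip[OF that] wlip[OF True that] mdist_nonneg[of E y z] unfolding v_def if_P[OF True] by linarith
  qed (simp add: v_def)
  have v0: "0 \<le> v x z" for x z
    by (simp add: v_def)
  \<comment> \<open>At the first index with positive \<open>u\<close>, all predecessors have value
    0, so that the excess \<open>w\<close> is all of \<open>u\<close> there.\<close>
  have Mpos: "M z > 0" if zB: "z \<in> B" for z
  proof -
    have z: "z \<in> mspace E" using that by (simp add: B_def)
    obtain x0 where "x0 \<in> {x\<in>I. u x z > 0}"
      using zB unfolding B_def by blast
    then obtain x where "x \<in> {x\<in>I. u x z > 0}" "\<And>y. (y,x) \<in> R \<Longrightarrow> y \<notin> {x\<in>I. u x z > 0}"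
      by (rule wfE_min[OF wf]) blast
    then have x: "x \<in> I" "u x z > 0" "\<And>y. (y,x) \<in> R \<Longrightarrow> \<not> (y \<in> I \<and> u y z > 0)"
      by auto
    have "S x z \<le> 0"
      unfolding S_def by (rule cSup_least) (use x(3) in force)+
    then have "w x z > 0" using x(2) by (simp add: w_def)
    with Mw[OF x(1) z] show ?thesis by linarith
  qed
  have vex: "\<exists>x\<in>I. v x z > 0" if "z \<in> B" for z
  proof -
    have "M z / 2 < M z" using Mpos[OF that] by simp
    then obtain y where "y \<in> insert 0 ((\<lambda>x. w x z) ` I)" "M z / 2 < y"
      using less_cSupD[of "insert 0 ((\<lambda>x. w x z) ` I)" "M z / 2"] unfolding M_def by blast
    then show ?thesis using Mpos[OF that] by (force simp: v_def less_max_iff_disj)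
  qed
  define \<sigma> where "\<sigma> z = {x\<in>I. u x z \<ge> M z / 4 + S x z}" for z
  \<comment> \<open>Each member of \<open>\<sigma> z\<close> exceeds all its predecessors at
    \<open>z\<close> by at least \<open>M z / 4\<close>, which is the separation needed for
    finiteness.\<close>
  have fin: "finite (\<sigma> z)" if "z \<in> B" for z
  proof (rule finite_if_well_separated[OF tot, where f = "\<lambda>x. u x z" and \<delta> = "M z / 4" and b = b])
    show "u y z + M z / 4 \<le> u x z" if "x \<in> \<sigma> z" "y \<in> \<sigma> z" "(y,x) \<in> R" for x y
      using that Su[of z y x] \<open>z \<in> B\<close> by (auto simp: \<sigma>_def B_def)
  qed (use that bd Mpos in \<open>auto simp: \<sigma>_def B_def\<close>)
  \<comment> \<open>The radius fits the threshold in \<open>\<sigma>\<close>: within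
    \<open>M z / 16\<close> of \<open>z\<close> the value of \<open>M\<close> drops by at most
    \<open>M z / 8\<close>, so \<open>v x y \<noteq> 0\<close> makes \<open>u x y - S x y\<close>
    exceed \<open>7/16\<close> of \<open>M z\<close>; moving \<open>u\<close> and \<open>S\<close>
    back to \<open>z\<close> costs at most \<open>1/16\<close> each, and the remaining
    \<open>5/16\<close> exceeds \<open>1/4\<close>.\<close>
  define N where "N z = B \<inter> mball_of E z (M z / 16)" for z
  have opN: "openin (subtopology (mtopology_of E) B) (N z)" for z
    by (simp add: N_def openin_subtopology_Int2 mtopology_of_def mball_of_def Metric_space.openin_mball)
  have zN: "z \<in> N z" if "z \<in> B" for z
    using that Mpos[OF that] by (auto simp: N_def B_def)
  have supp: "x \<in> \<sigma> z" if "z \<in> B" "y \<in> N z" "v x y \<noteq> 0" for x y z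
  proof -
    have yz: "z \<in> mspace E" "y \<in> mspace E" "mdist E z y < M z / 16" and x: "x \<in> I" "w x y > M y / 2"
      using that by (auto simp: N_def B_def v_def max_def split: if_splits)
    have "M z / 4 + S x z \<le> u x z"
      using Mlip[OF yz(1,2)] Slip[OF yz(1,2), of x] lip[OF x(1) yz(1,2)] yz(3) x(2) Mpos[OF that(1)]
      unfolding w_def by linarith
    with x(1) show ?thesis
      by (simp add: \<sigma>_def)
  qed
  define T where "T z = (\<Sum>x | v x z \<noteq> 0. v x z)" for z
  have Teq: "T y = (\<Sum>x\<in>\<sigma> z. v x y)" if "z \<in> B" "y \<in> N z" for y z
    unfolding T_def by (rule sum.mono_neutral_left) (use fin supp that in auto)
  have vcont: "continuous_map (subtopology (mtopology_of E) B) euclideanreal (v x)" for x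
    by (rule continuous_map_from_subtopology, rule continuous_map_real_Lipschitz, rule vlip)
  have Tcont: "continuous_map (subtopology (mtopology_of E) B) euclideanreal T"
  proof (rule continuous_map_if_locally_eq)
    fix z assume "z \<in> topspace (subtopology (mtopology_of E) B)"
    then have z: "z \<in> B" by simp
    have "continuous_map (subtopology (mtopology_of E) B) euclideanreal (\<lambda>y. \<Sum>x\<in>\<sigma> z. v x y)"
      by (intro continuous_map_sum fin[OF z] vcont)
    with opN zN[OF z] Teq[OF z] show "\<exists>N g. openin (subtopology (mtopology_of E) B) N \<and> z \<in> N \<and>
        continuous_map (subtopology (mtopology_of E) B) euclideanreal g \<and> (\<forall>y\<in>N. T y = g y)" by blast
  qed
  have Tpos: "T z > 0" if zB: "z \<in> B" for z
  proof -
    obtain x where x: "x \<in> I" "v x z > 0" using vex[OF zB] by blast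
    then have "0 < (\<Sum>x\<in>\<sigma> z. v x z)"
      using supp[OF that zN[OF that]] fin[OF that] v0 by (intro sum_pos2[of _ x]) auto
    then show ?thesis using Teq[OF that zN[OF that]] by simp
  qed
  show ?thesis
  proof
    show "continuous_map (subtopology (mtopology_of E) B) euclideanreal (\<lambda>z. v x z / T z)" for x
      using Tpos by (intro continuous_map_real_divide vcont Tcont) force
    show "\<exists>N \<tau>. openin (subtopology (mtopology_of E) B) N \<and> z \<in> N \<and> \<tau> \<noteq> {} \<and> finite \<tau> \<and>
        \<tau> \<subseteq> {x\<in>I. u x z > 0} \<and> (\<lambda>z x. v x z / T z) ` N \<subseteq> closed_simplex \<tau>" if z: "z \<in> B" for z
    proof (intro exI conjI)
      show "openin (subtopology (mtopology_of E) B) (N z)" "z \<in> N z" "finite (\<sigma> z)"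
        using opN zN fin z by auto
      show "\<sigma> z \<noteq> {}" using supp[OF z zN[OF z]] vex[OF z] by force
      \<comment> \<open>Positivity is obtained at the centre \<open>z\<close>, for all indices used
        anywhere on \<open>N z\<close>.\<close>
      show "\<sigma> z \<subseteq> {x\<in>I. u x z > 0}"
      proof
        fix x assume "x \<in> \<sigma> z"
        moreover have "z \<in> mspace E" using z by (simp add: B_def)
        ultimately show "x \<in> {x\<in>I. u x z > 0}"
          using Mpos[OF z] S0[of z x] by (simp add: \<sigma>_def)
      qed
      show "(\<lambda>z x. v x z / T z) ` N z \<subseteq> closed_simplex (\<sigma> z)"
      proof safe
        fix y assume y: "y \<in> N z"
        then have "T y > 0" using Tpos by (simp add: N_def)
        then show "(\<lambda>x. v x y / T y) \<in> closed_simplex (\<sigma> z)"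
          using v0 supp[OF z y] Teq[OF z y] by (auto simp: closed_simplex_def simp flip: sum_divide_distrib)
      qed
    qed
  qed
qed

section \<open>Functors into the homotopy category of persistence families\<close>

lemma is_functor_fcomp:
  assumes "is_functor C D F" "is_functor D E G"
  shows "is_functor C E (G \<circ>\<^sub>F F)"
  using assms unfolding is_functor_def fcomp_def by auto

section \<open>Representatives of homotopy classes and of morphisms of families\<close>

lemma mem_homotopy_class: "g \<in> homotopy_class X Y {f} \<longleftrightarrow> homotopic X Y f g"
  by (simp add: homotopy_class_def)

lemma homotopy_class_eqI: "homotopic X Y f g \<Longrightarrow> homotopy_class X Y {f} = homotopy_class X Y {g}"
  unfolding homotopy_class_def by (auto intro: homotopic_with_trans homotopic_with_symD)

text \<open>Morphisms are composed and transported on sets of representatives; such a set is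
  collapsed here to one of its members.\<close>

lemma homotopy_class_union:
  assumes "\<And>g. g \<in> S \<Longrightarrow> homotopic X Y f g" "f \<in> S"
  shows "homotopy_class X Y S = homotopy_class X Y {f}"
  unfolding homotopy_class_def using assms by (auto intro: homotopic_with_trans)

lemma homotopy_class_comp:
  assumes f: "continuous_map X Y f" and g: "continuous_map Y Z g"
  shows "homotopy_class X Z {k \<circ> h | h k. h \<in> homotopy_class X Y {f} \<and> k \<in> homotopy_class Y Z {g}}
    = homotopy_class X Z {g \<circ> f}"
proof (rule homotopy_class_union)
  show "g \<circ> f \<in> {k \<circ> h | h k. h \<in> homotopy_class X Y {f} \<and> k \<in> homotopy_class Y Z {g}}"
    using f g by (intro CollectI exI[of _ f] exI[of _ g]) (simp add: mem_homotopy_class)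
qed (auto simp: mem_homotopy_class intro: homotopic_compose)

text \<open>Morphisms on the level of representatives. The two families may have points in different
  types, so that maps from neighbourhoods to realizations can be discussed before any
  relabelling.\<close>

definition family_hom :: "real set \<Rightarrow> 'p family \<Rightarrow> 'q family \<Rightarrow> (real \<Rightarrow> 'p \<Rightarrow> 'q) \<Rightarrow> bool" where
  "family_hom T U V F \<longleftrightarrow> (\<forall>r\<in>T. continuous_map (stage U r) (stage V r) (F r)) \<and>
     (\<forall>r\<in>T. \<forall>s\<in>T. r \<le> s \<longrightarrow> homotopic (stage U r) (stage V s) (F s \<circ> step U r s) (step V r s \<circ> F r))"

definition family_class :: "real set \<Rightarrow> 'p family \<Rightarrow> 'q family \<Rightarrow> (real \<Rightarrow> 'p \<Rightarrow> 'q) \<Rightarrow> real \<Rightarrow> ('p \<Rightarrow> 'q) set"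
  where "family_class T U V F = (\<lambda>r\<in>T. homotopy_class (stage U r) (stage V r) {F r})"

lemma family_class_eqI:
  assumes "\<And>r. r \<in> T \<Longrightarrow> homotopic (stage U r) (stage V r) (F r) (G r)"
  shows "family_class T U V F = family_class T U V G"
  unfolding family_class_def using assms by (intro restrict_ext homotopy_class_eqI)

lemma continuous_map_step:
  "\<lbrakk>persistence_family T U; r \<in> T; s \<in> T; r \<le> s\<rbrakk> \<Longrightarrow> continuous_map (stage U r) (stage U s) (step U r s)"
  by (simp add: persistence_family_def)

lemma family_class_in:
  assumes U: "persistence_family T U" and V: "persistence_family T V" and F: "family_hom T U V F"
  shows "family_class T U V F \<in> family_maps T U V"
  unfolding family_maps_def
proof (intro CollectI conjI ballI impI)
  show "family_class T U V F \<in> extensional T"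
    by (simp add: family_class_def)
  show "\<exists>f. continuous_map (stage U r) (stage V r) f \<and>
      family_class T U V F r = homotopy_class (stage U r) (stage V r) {f}" if "r \<in> T" for r
    using F that by (auto simp: family_class_def family_hom_def)
  fix r s f g assume rs: "r \<in> T" "s \<in> T" "r \<le> s"
    and f: "f \<in> family_class T U V F r" and g: "g \<in> family_class T U V F s"
  have "homotopic (stage U r) (stage V s) (F s \<circ> step U r s) (step V r s \<circ> F r)"
    using F rs by (simp add: family_hom_def)
  moreover have "homotopic (stage U r) (stage V s) (step V r s \<circ> F r) (step V r s \<circ> f)"
    using f rs continuous_map_step[OF V rs]
    by (intro homotopic_compose) (auto simp: family_class_def mem_homotopy_class)
  moreover have "homotopic (stage U r) (stage V s) (F s \<circ> step U r s) (g \<circ> step U r s)"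
    using g rs continuous_map_step[OF U rs]
    by (intro homotopic_compose) (auto simp: family_class_def mem_homotopy_class)
  ultimately show "homotopic (stage U r) (stage V s) (g \<circ> step U r s) (step V r s \<circ> f)"
    by (meson homotopic_with_symD homotopic_with_trans)
qed

text \<open>A representative can be chosen in each degree separately: compatibility in
  \<open>family_maps\<close> is demanded of all representatives, hence holds for the chosen
  ones.\<close>

lemma family_mapsE:
  assumes "\<phi> \<in> family_maps T U V"
  obtains F where "family_hom T U V F" "\<phi> = family_class T U V F"
proof -
  have "\<forall>r\<in>T. \<exists>f. continuous_map (stage U r) (stage V r) f \<and>
      \<phi> r = homotopy_class (stage U r) (stage V r) {f}"
    using assms by (simp add: family_maps_def)
  then obtain F where F: "\<And>r. r \<in> T \<Longrightarrow> continuous_map (stage U r) (stage V r) (F r)"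
    "\<And>r. r \<in> T \<Longrightarrow> \<phi> r = homotopy_class (stage U r) (stage V r) {F r}"
    by metis
  then have "F r \<in> \<phi> r" if "r \<in> T" for r
    using that by (simp add: mem_homotopy_class)
  then have "family_hom T U V F"
    using assms F(1) unfolding family_hom_def family_maps_def by blast
  moreover have "\<phi> = family_class T U V F"
  proof
    show "\<phi> r = family_class T U V F r" for r
      using assms F(2)[of r] by (cases "r \<in> T") (auto simp: family_class_def family_maps_def extensional_def)
  qed
  ultimately show ?thesis
    using that by blast
qed

lemma hTop_simps [simp]:
  "objs (hTop T) = {U. persistence_family T U}"
  "arrs (hTop T) = family_maps T"
  by (simp_all add: hTop_def)

lemma hTop_idt: "idt (hTop T) U = family_class T U U (\<lambda>_. id)"
  by (simp add: hTop_def family_class_def)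

lemma hTop_cmp:
  assumes "family_hom T U V F" "family_hom T V W G"
  shows "cmp (hTop T) U V W (family_class T V W G) (family_class T U V F)
    = family_class T U W (\<lambda>r. G r \<circ> F r)"
  unfolding hTop_def family_class_def
  by (simp, rule restrict_ext)
    (use assms in \<open>auto simp: family_hom_def intro!: homotopy_class_comp\<close>)

lemma family_hom_comp:
  assumes F: "family_hom T U V F" and G: "family_hom T V W G"
    and U: "persistence_family T U" and W: "persistence_family T W"
  shows "family_hom T U W (\<lambda>r. G r \<circ> F r)"
  unfolding family_hom_def
proof (intro conjI ballI impI)
  show "continuous_map (stage U r) (stage W r) (G r \<circ> F r)" if "r \<in> T" for r
    using F G that unfolding family_hom_def by (meson continuous_map_compose)
  fix r s assume rs: "r \<in> T" "s \<in> T" "r \<le> s"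
  have "homotopic (stage U r) (stage W s) (G s \<circ> (F s \<circ> step U r s)) (G s \<circ> (step V r s \<circ> F r))"
    by (rule homotopic_compose) (use F G rs in \<open>auto simp: family_hom_def\<close>)
  moreover have "homotopic (stage U r) (stage W s) ((G s \<circ> step V r s) \<circ> F r) ((step W r s \<circ> G r) \<circ> F r)"
    by (rule homotopic_compose) (use F G rs in \<open>auto simp: family_hom_def\<close>)
  ultimately show "homotopic (stage U r) (stage W s) (G s \<circ> F s \<circ> step U r s) (step W r s \<circ> (G r \<circ> F r))"
    by (metis (no_types, lifting) comp_assoc homotopic_with_trans)
qed

text \<open>Inverses chosen degree by degree are automatically compatible with the steps:
  \<open>G s \<circ> step\<close> is homotopic to
  \<open>G s \<circ> step \<circ> F r \<circ> G r\<close>, hence to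
  \<open>G s \<circ> F s \<circ> step \<circ> G r\<close>, hence to
  \<open>step \<circ> G r\<close>.\<close>

lemma family_hom_inverse:
  assumes F: "family_hom T U V F" and U: "persistence_family T U" and V: "persistence_family T V"
    and G: "\<And>r. r \<in> T \<Longrightarrow> continuous_map (stage V r) (stage U r) (G r)"
    and GF: "\<And>r. r \<in> T \<Longrightarrow> homotopic (stage U r) (stage U r) (G r \<circ> F r) id"
    and FG: "\<And>r. r \<in> T \<Longrightarrow> homotopic (stage V r) (stage V r) (F r \<circ> G r) id"
  shows "family_hom T V U G"
  unfolding family_hom_def
proof (intro conjI ballI impI G)
  fix r s assume rs: "r \<in> T" "s \<in> T" "r \<le> s"
  note stepU = continuous_map_step[OF U rs] and stepV = continuous_map_step[OF V rs]
  have "homotopic (stage V r) (stage U s) ((G s \<circ> step V r s) \<circ> (F r \<circ> G r)) ((G s \<circ> step V r s) \<circ> id)"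
    using stepV G[OF rs(2)] by (intro homotopic_compose[OF FG[OF rs(1)]]) (auto intro: continuous_map_compose)
  moreover have "homotopic (stage V r) (stage U s) (G s \<circ> (F s \<circ> step U r s) \<circ> G r) (G s \<circ> (step V r s \<circ> F r) \<circ> G r)"
    using F rs G by (intro homotopic_compose) (auto simp: family_hom_def)
  moreover have "homotopic (stage V r) (stage U s) ((G s \<circ> F s) \<circ> (step U r s \<circ> G r)) (id \<circ> (step U r s \<circ> G r))"
    using stepU G[OF rs(1)] by (intro homotopic_compose[OF _ GF[OF rs(2)]]) (auto intro: continuous_map_compose)
  ultimately show "homotopic (stage V r) (stage U s) (G s \<circ> step V r s) (step U r s \<circ> G r)"
    by (metis (no_types, lifting) comp_assoc comp_id id_comp homotopic_with_trans homotopic_with_symD)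
qed

lemma is_iso_hTop:
  assumes F: "family_hom T U V F" and U: "persistence_family T U" and V: "persistence_family T V"
    and G: "\<And>r. r \<in> T \<Longrightarrow> \<exists>g. continuous_map (stage V r) (stage U r) g \<and>
      homotopic (stage U r) (stage U r) (g \<circ> F r) id \<and> homotopic (stage V r) (stage V r) (F r \<circ> g) id"
  shows "is_iso (hTop T) U V (family_class T U V F)"
proof -
  obtain G where G: "\<And>r. r \<in> T \<Longrightarrow> continuous_map (stage V r) (stage U r) (G r)"
    "\<And>r. r \<in> T \<Longrightarrow> homotopic (stage U r) (stage U r) (G r \<circ> F r) id"
    "\<And>r. r \<in> T \<Longrightarrow> homotopic (stage V r) (stage V r) (F r \<circ> G r) id"
    using G by metis
  have hom: "family_hom T V U G"
    using family_hom_inverse[OF F U V G] .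
  show ?thesis
    unfolding is_iso_def
    using hom F U V G
    by (auto simp: hTop_idt hTop_cmp intro!: family_class_in bexI[of _ "family_class T V U G"] family_class_eqI)
qed

subsection \<open>Relabelling\<close>

lemma continuous_map_relabel_in:
  assumes "inj j" shows "continuous_map X (relabel_stage j X) j"
  unfolding relabel_stage_def
  by (rule continuous_map_pullback') (use assms in \<open>auto simp: o_def\<close>)

lemma continuous_map_relabel_out: "continuous_map (relabel_stage j X) X (inv j)"
  unfolding relabel_stage_def using continuous_map_pullback[OF continuous_map_id, of "range j" "inv j" X]
  by simp

lemma topspace_relabel_stage: "inj j \<Longrightarrow> topspace (relabel_stage j X) = j ` topspace X"
  by (auto simp: relabel_stage_def topspace_pullback_topology)

lemma relabel_comp: "inj k \<Longrightarrow> (l \<circ> g \<circ> inv k) \<circ> (k \<circ> f \<circ> inv j) = l \<circ> (g \<circ> f) \<circ> inv j"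
  by (simp add: fun_eq_iff)

lemma continuous_map_relabel:
  assumes "inj j" "inj k" "continuous_map X Y f"
  shows "continuous_map (relabel_stage j X) (relabel_stage k Y) (k \<circ> f \<circ> inv j)"
  using assms by (metis continuous_map_compose continuous_map_relabel_in continuous_map_relabel_out)

lemma homotopic_relabel:
  assumes "inj j" "inj k" "homotopic X Y f g"
  shows "homotopic (relabel_stage j X) (relabel_stage k Y) (k \<circ> f \<circ> inv j) (k \<circ> g \<circ> inv j)"
  using assms continuous_map_relabel_in[of k Y] continuous_map_relabel_out[of j X]
  by (intro homotopic_compose) auto

text \<open>\<open>j \<circ> inv j\<close> is the identity only on the points of the relabelled
  space, so equality of functions is replaced by homotopy.\<close>

lemma homotopic_relabel_id:
  assumes "inj j" shows "homotopic (relabel_stage j X) (relabel_stage j X) (j \<circ> id \<circ> inv j) id"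
  by (rule homotopic_with_equal)
    (use assms continuous_map_relabel[OF assms assms continuous_map_id] in \<open>auto simp: topspace_relabel_stage\<close>)

lemma relabel_simps [simp]:
  "stage (fob (relabel T j) U) r = relabel_stage j (stage U r)"
  "step (fob (relabel T j) U) r s = j \<circ> step U r s \<circ> inv j"
  by (simp_all add: relabel_def)

lemma persistence_family_relabel:
  assumes j: "inj j" and U: "persistence_family T U"
  shows "persistence_family T (fob (relabel T j) U)"
  using U j continuous_map_relabel[OF j j]
  by (auto simp: persistence_family_def topspace_relabel_stage)

lemma family_hom_relabel:
  assumes jk: "inj j" "inj k" and F: "family_hom T U V F"
  shows "family_hom T (fob (relabel T j) U) (fob (relabel T k) V) (\<lambda>r. k \<circ> F r \<circ> inv j)"
  unfolding family_hom_def
proof (intro conjI ballI impI)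
  fix r s assume "r \<in> T" "s \<in> T" "r \<le> s"
  then have "homotopic (stage U r) (stage V s) (F s \<circ> step U r s) (step V r s \<circ> F r)"
    using F by (simp add: family_hom_def)
  from homotopic_relabel[OF jk this]
  show "homotopic (stage (fob (relabel T j) U) r) (stage (fob (relabel T k) V) s)
      (k \<circ> F s \<circ> inv j \<circ> step (fob (relabel T j) U) r s) (step (fob (relabel T k) V) r s \<circ> (k \<circ> F r \<circ> inv j))"
    using jk by (simp add: relabel_comp)
qed (use F jk in \<open>auto simp: family_hom_def intro!: continuous_map_relabel\<close>)

lemma far_relabel:
  assumes j: "inj j" and F: "family_hom T U V F"
  shows "far (relabel T j) U V (family_class T U V F)
    = family_class T (fob (relabel T j) U) (fob (relabel T j) V) (\<lambda>r. j \<circ> F r \<circ> inv j)"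
  unfolding family_class_def relabel_def
  by (simp, rule restrict_ext, rule homotopy_class_union)
    (use F homotopic_relabel[OF j j] in \<open>auto simp: mem_homotopy_class family_hom_def\<close>)

lemma is_functor_relabel:
  assumes j: "inj j" shows "is_functor (hTop T) (hTop T) (relabel T j)"
proof
  show "fob (relabel T j) U \<in> objs (hTop T)" if "U \<in> objs (hTop T)" for U
    using that persistence_family_relabel[OF j] by simp
  show "far (relabel T j) U V \<phi> \<in> arrs (hTop T) (fob (relabel T j) U) (fob (relabel T j) V)"
    if "U \<in> objs (hTop T)" "V \<in> objs (hTop T)" and \<phi>: "\<phi> \<in> arrs (hTop T) U V" for U V \<phi>
  proof -
    obtain F where "family_hom T U V F" "\<phi> = family_class T U V F"
      using \<phi> by (auto elim: family_mapsE)
    then show ?thesis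
      using that j persistence_family_relabel[OF j]
      by (auto simp: far_relabel intro!: family_class_in family_hom_relabel)
  qed
  show "far (relabel T j) U U (idt (hTop T) U) = idt (hTop T) (fob (relabel T j) U)"
    if "U \<in> objs (hTop T)" for U
  proof -
    have "family_hom T U U (\<lambda>_. id)"
      using that by (auto simp: family_hom_def intro: continuous_map_step)
    then show ?thesis
      using homotopic_relabel_id[OF j] by (simp add: hTop_idt far_relabel[OF j] family_class_eqI)
  qed
  show "far (relabel T j) U W (cmp (hTop T) U V W \<psi> \<phi>) =
       cmp (hTop T) (fob (relabel T j) U) (fob (relabel T j) V) (fob (relabel T j) W)
        (far (relabel T j) V W \<psi>) (far (relabel T j) U V \<phi>)"
    if "U \<in> objs (hTop T)" "V \<in> objs (hTop T)" "W \<in> objs (hTop T)"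
      and \<phi>: "\<phi> \<in> arrs (hTop T) U V" and \<psi>: "\<psi> \<in> arrs (hTop T) V W" for U V W \<phi> \<psi>
  proof -
    obtain F where F: "family_hom T U V F" "\<phi> = family_class T U V F"
      using \<phi> by (auto elim: family_mapsE)
    obtain G where G: "family_hom T V W G" "\<psi> = family_class T V W G"
      using \<psi> by (auto elim: family_mapsE)
    have GF: "family_hom T U W (\<lambda>r. G r \<circ> F r)"
      using family_hom_comp[OF F(1) G(1)] that by simp
    show ?thesis
      using F G GF j
      by (simp add: hTop_cmp far_relabel family_hom_relabel relabel_comp)
  qed
qed

text \<open>Relabelling is a homeomorphism onto a tagged copy, so a natural isomorphism may be
  constructed between the original families, whose points can have different types. Naturality is
  asked for one pair of representatives only; the rest of each class follows by homotopy.\<close>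

lemma natural_iso_relabel:
  assumes j: "inj j" and k: "inj k"
    and F: "is_functor C (hTop T) F" and G: "is_functor C (hTop T) G"
    and m: "\<And>A. A \<in> objs C \<Longrightarrow> family_hom T (fob F A) (fob G A) (m A)"
    and inv: "\<And>A r. A \<in> objs C \<Longrightarrow> r \<in> T \<Longrightarrow>
      \<exists>n. continuous_map (stage (fob G A) r) (stage (fob F A) r) n \<and>
        homotopic (stage (fob F A) r) (stage (fob F A) r) (n \<circ> m A r) id \<and>
        homotopic (stage (fob G A) r) (stage (fob G A) r) (m A r \<circ> n) id"
    and nat: "\<And>A B f r. A \<in> objs C \<Longrightarrow> B \<in> objs C \<Longrightarrow> f \<in> arrs C A B \<Longrightarrow> r \<in> T \<Longrightarrow>
      \<exists>a \<in> far F A B f r. \<exists>b \<in> far G A B f r.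
        homotopic (stage (fob F A) r) (stage (fob G B) r) (m B r \<circ> a) (b \<circ> m A r)"
  shows "naturally_isomorphic C (hTop T) (relabel T j \<circ>\<^sub>F F) (relabel T k \<circ>\<^sub>F G)"
  unfolding naturally_isomorphic_def
proof (intro conjI exI ballI)
  show "is_functor C (hTop T) (relabel T j \<circ>\<^sub>F F)" "is_functor C (hTop T) (relabel T k \<circ>\<^sub>F G)"
    using is_functor_fcomp[OF F is_functor_relabel[OF j]] is_functor_fcomp[OF G is_functor_relabel[OF k]]
    by auto
  let ?F = "\<lambda>A. fob (relabel T j) (fob F A)" and ?G = "\<lambda>A. fob (relabel T k) (fob G A)"
  let ?\<tau> = "\<lambda>A. family_class T (?F A) (?G A) (\<lambda>r. k \<circ> m A r \<circ> inv j)"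
  have pF: "persistence_family T (fob F A)" "persistence_family T (fob G A)" if "A \<in> objs C" for A
    using that is_functor.fob_in[OF F] is_functor.fob_in[OF G] by auto
  note hom = family_hom_relabel[OF j k m]
  show "is_iso (hTop T) (fob (relabel T j \<circ>\<^sub>F F) A) (fob (relabel T k \<circ>\<^sub>F G) A) (?\<tau> A)"
    if A: "A \<in> objs C" for A
  proof -
    have "\<exists>g. continuous_map (stage (?G A) r) (stage (?F A) r) g \<and>
       homotopic (stage (?F A) r) (stage (?F A) r) (g \<circ> (k \<circ> m A r \<circ> inv j)) id \<and>
       homotopic (stage (?G A) r) (stage (?G A) r) ((k \<circ> m A r \<circ> inv j) \<circ> g) id"
      if r: "r \<in> T" for r
    proof -
      obtain n where n: "continuous_map (stage (fob G A) r) (stage (fob F A) r) n"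
        "homotopic (stage (fob F A) r) (stage (fob F A) r) (n \<circ> m A r) id"
        "homotopic (stage (fob G A) r) (stage (fob G A) r) (m A r \<circ> n) id"
        using inv[OF A r] by blast
      show ?thesis
        by (rule exI[of _ "j \<circ> n \<circ> inv k"])
          (use n j k homotopic_with_trans[OF homotopic_relabel[OF j j n(2)] homotopic_relabel_id[OF j]]
            homotopic_with_trans[OF homotopic_relabel[OF k k n(3)] homotopic_relabel_id[OF k]]
           in \<open>simp add: relabel_comp continuous_map_relabel\<close>)
    qed
    then show ?thesis
      using is_iso_hTop[OF hom[OF A] persistence_family_relabel[OF j] persistence_family_relabel[OF k]] pF[OF A]
      by (simp add: fcomp_def)
  qed
  fix A B f assume A: "A \<in> objs C" and B: "B \<in> objs C" and f: "f \<in> arrs C A B"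
  obtain a where a: "family_hom T (fob F A) (fob F B) a" "far F A B f = family_class T (fob F A) (fob F B) a"
    using is_functor.far_in[OF F A B f] by (auto elim: family_mapsE)
  obtain b where b: "family_hom T (fob G A) (fob G B) b" "far G A B f = family_class T (fob G A) (fob G B) b"
    using is_functor.far_in[OF G A B f] by (auto elim: family_mapsE)
  have "homotopic (stage (fob F A) r) (stage (fob G B) r) (m B r \<circ> a r) (b r \<circ> m A r)" if r: "r \<in> T" for r
  proof -
    obtain a' b' where ab: "homotopic (stage (fob F A) r) (stage (fob F B) r) (a r) a'"
      "homotopic (stage (fob G A) r) (stage (fob G B) r) (b r) b'"
      "homotopic (stage (fob F A) r) (stage (fob G B) r) (m B r \<circ> a') (b' \<circ> m A r)"
      using nat[OF A B f r] a(2) b(2) r by (auto simp: family_class_def mem_homotopy_class)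
    have "homotopic (stage (fob F A) r) (stage (fob G B) r) (m B r \<circ> a r) (m B r \<circ> a')"
      by (rule homotopic_compose[OF ab(1)]) (use m[OF B] r in \<open>simp add: family_hom_def\<close>)
    moreover have "homotopic (stage (fob F A) r) (stage (fob G B) r) (b r \<circ> m A r) (b' \<circ> m A r)"
      by (rule homotopic_compose[OF _ ab(2)]) (use m[OF A] r in \<open>simp add: family_hom_def\<close>)
    ultimately show ?thesis
      using ab(3) by (meson homotopic_with_symD homotopic_with_trans)
  qed
  then have "family_class T (?F A) (?G B) (\<lambda>r. k \<circ> (m B r \<circ> a r) \<circ> inv j)
      = family_class T (?F A) (?G B) (\<lambda>r. k \<circ> (b r \<circ> m A r) \<circ> inv j)"
    by (intro family_class_eqI) (simp add: homotopic_relabel j k)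
  then show "cmp (hTop T) (fob (relabel T j \<circ>\<^sub>F F) A) (fob (relabel T j \<circ>\<^sub>F F) B) (fob (relabel T k \<circ>\<^sub>F G) B)
       (?\<tau> B) (far (relabel T j \<circ>\<^sub>F F) A B f) =
     cmp (hTop T) (fob (relabel T j \<circ>\<^sub>F F) A) (fob (relabel T k \<circ>\<^sub>F G) A) (fob (relabel T k \<circ>\<^sub>F G) B)
       (far (relabel T k \<circ>\<^sub>F G) A B f) (?\<tau> A)"
    using a b hom[OF A] hom[OF B] j k
    by (simp add: fcomp_def far_relabel hTop_cmp family_hom_relabel relabel_comp)
qed

section \<open>Vietoris--Rips complexes\<close>

lemma closed_simplex_mono:
  assumes "finite \<tau>" "\<sigma> \<subseteq> \<tau>" shows "closed_simplex \<sigma> \<subseteq> closed_simplex \<tau>"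
proof
  fix a assume a: "a \<in> closed_simplex \<sigma>"
  have "sum a \<tau> = sum a \<sigma>"
    by (rule sum.mono_neutral_right) (use assms a in \<open>auto simp: closed_simplex_def\<close>)
  then show "a \<in> closed_simplex \<tau>"
    using a assms by (auto simp: closed_simplex_def)
qed

text \<open>A simplex is finite, so the supremum in \<open>diam\<close> is a maximum and the strict
  bound can be tested on pairs.\<close>

lemma VR_iff: "\<sigma> \<in> VR r X \<longleftrightarrow>
    \<sigma> \<noteq> {} \<and> finite \<sigma> \<and> \<sigma> \<subseteq> mspace X \<and> (\<forall>x\<in>\<sigma>. \<forall>y\<in>\<sigma>. mdist X x y < r)"
proof -
  have "diam X \<sigma> < r \<longleftrightarrow> (\<forall>x\<in>\<sigma>. \<forall>y\<in>\<sigma>. mdist X x y < r)" if "\<sigma> \<noteq> {}" "finite \<sigma>"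
    using that by (auto simp: diam_def cSup_eq_Max)
  then show ?thesis
    by (auto simp: VR_def)
qed

lemma VR_mono: "r \<le> s \<Longrightarrow> VR r X \<subseteq> VR s X"
  by (auto simp: VR_def)

lemma VR_image:
  assumes "short_map X Y f" "\<sigma> \<in> VR r X" shows "f ` \<sigma> \<in> VR r Y"
  unfolding VR_iff
proof (intro conjI ballI)
  fix y z assume "y \<in> f ` \<sigma>" "z \<in> f ` \<sigma>"
  then obtain u v where uv: "y = f u" "z = f v" "u \<in> \<sigma>" "v \<in> \<sigma>" by blast
  then have "mdist X u v < r" "u \<in> mspace X" "v \<in> mspace X"
    using assms(2) by (auto simp: VR_iff)
  with assms(1) uv show "mdist Y y z < r"
    by (auto simp: short_map_def intro: le_less_trans)
qed (use assms in \<open>auto simp: VR_iff short_map_def\<close>)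

text \<open>The definition sums over the support and so refers to no simplex. On a fixed closed
  simplex it becomes a fixed finite sum of coordinates, from which continuity is read off.\<close>

lemma simplicial_extension_eq:
  assumes "a \<in> closed_simplex \<sigma>" "finite \<sigma>"
  shows "simplicial_extension f a w = (\<Sum>v\<in>{v\<in>\<sigma>. f v = w}. a v)"
  unfolding simplicial_extension_def
  by (rule sum.mono_neutral_left) (use assms in \<open>auto simp: closed_simplex_def\<close>)

lemma simplicial_extension_closed_simplex:
  assumes "a \<in> closed_simplex \<sigma>" "finite \<sigma>"
  shows "simplicial_extension f a \<in> closed_simplex (f ` \<sigma>)"
  using assms sum.image_gen[OF assms(2), of a f]
  by (auto simp: closed_simplex_def simplicial_extension_eq[OF assms] intro!: sum_nonneg sum.neutral)

lemma simplicial_extension_cong: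
  assumes "a \<in> closed_simplex \<sigma>" "\<And>v. v \<in> \<sigma> \<Longrightarrow> f v = g v"
  shows "simplicial_extension f a = simplicial_extension g a"
proof -
  have "f v = g v" if "a v \<noteq> 0" for v
    using assms that by (auto simp: closed_simplex_def)
  then show ?thesis
    unfolding simplicial_extension_def by (intro ext sum.cong) auto
qed

lemma simplicial_extension_id: "simplicial_extension id a = a"
proof
  have "{v. a v \<noteq> 0 \<and> id v = w} = (if a w = 0 then {} else {w})" for w by auto
  then show "simplicial_extension id a w = a w" for w
    by (simp add: simplicial_extension_def)
qed

lemma simplicial_extension_comp:
  assumes "a \<in> closed_simplex \<sigma>" "finite \<sigma>"
  shows "simplicial_extension g (simplicial_extension f a) = simplicial_extension (g \<circ> f) a"
proof
  fix w
  have "simplicial_extension g (simplicial_extension f a) w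
      = (\<Sum>u\<in>{u\<in>f ` \<sigma>. g u = w}. \<Sum>v\<in>{v\<in>\<sigma>. f v = u}. a v)"
    using simplicial_extension_eq[OF simplicial_extension_closed_simplex[OF assms(1,2)], of f g w] assms
    by (simp add: simplicial_extension_eq[OF assms])
  also have "\<dots> = (\<Sum>u\<in>f ` {v\<in>\<sigma>. g (f v) = w}. \<Sum>v\<in>{v\<in>{v\<in>\<sigma>. g (f v) = w}. f v = u}. a v)"
    by (intro sum.cong) auto
  also have "\<dots> = (\<Sum>v\<in>{v\<in>\<sigma>. g (f v) = w}. a v)"
    by (rule sum.image_gen[symmetric]) (use assms in auto)
  also have "\<dots> = simplicial_extension (g \<circ> f) a w"
    by (simp add: simplicial_extension_eq[OF assms])
  finally show "simplicial_extension g (simplicial_extension f a) w = simplicial_extension (g \<circ> f) a w" .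
qed

lemma continuous_on_coordinate: "continuous_on S (\<lambda>a::'v \<Rightarrow> real. a v)"
  by (rule continuous_on_product_then_coordinatewise) (rule continuous_on_id)

lemma continuous_map_coordinate:
  "continuous_map X (realization K) p \<Longrightarrow> continuous_map X euclideanreal (\<lambda>x. p x v)"
  using continuous_map_compose[of X "realization K" p euclideanreal "\<lambda>a. a v"]
  by (simp add: continuous_map_from_realization continuous_on_coordinate o_def)

lemma continuous_map_simplicial_extension:
  assumes "\<And>\<sigma>. \<sigma> \<in> K \<Longrightarrow> finite \<sigma> \<and> f ` \<sigma> \<in> L"
  shows "continuous_map (realization K) (realization L) (simplicial_extension f)"
  unfolding continuous_map_from_realization
proof
  fix \<sigma> assume \<sigma>: "\<sigma> \<in> K"
  show "continuous_map (top_of_set (closed_simplex \<sigma>)) (realization L) (simplicial_extension f)"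
  proof (rule continuous_map_into_realization)
    have "simplicial_extension f ` closed_simplex \<sigma> \<subseteq> closed_simplex (f ` \<sigma>)"
      using assms[OF \<sigma>] by (auto intro: simplicial_extension_closed_simplex)
    then show "carried (top_of_set (closed_simplex \<sigma>)) L (simplicial_extension f) (simplicial_extension f)"
      using assms[OF \<sigma>] unfolding carried_def by (metis openin_topspace topspace_euclidean_subtopology)
    have "continuous_on (closed_simplex \<sigma>) (\<lambda>a. \<Sum>v\<in>{v\<in>\<sigma>. f v = w}. a v)" for w
      by (intro continuous_on_sum continuous_on_coordinate)
    then have "continuous_on (closed_simplex \<sigma>) (\<lambda>a. simplicial_extension f a w)" for w
      by (rule continuous_on_eq) (use assms[OF \<sigma>] in \<open>auto simp: simplicial_extension_eq\<close>)
    then show "continuous_map (top_of_set (closed_simplex \<sigma>)) euclideanreal (\<lambda>a. simplicial_extension f a w)" for w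
      by simp
  qed
qed

lemma continuous_map_VR:
  "short_map X Y f \<Longrightarrow> continuous_map (realization (VR r X)) (realization (VR r Y)) (simplicial_extension f)"
  by (rule continuous_map_simplicial_extension) (auto simp: VR_image, auto simp: VR_iff)

lemma continuous_map_realization_mono:
  "K \<subseteq> L \<Longrightarrow> continuous_map (realization K) (realization L) id"
  unfolding continuous_map_from_realization by (intro ballI continuous_map_simplex_realization) (rule subsetD)

lemma in_realization_VR:
  assumes "a \<in> topspace (realization (VR r X))"
  obtains \<sigma> where "\<sigma> \<in> VR r X" "finite \<sigma>" "\<sigma> \<subseteq> mspace X" "a \<in> closed_simplex \<sigma>"
proof -
  obtain \<sigma> where "\<sigma> \<in> VR r X" "a \<in> closed_simplex \<sigma>"
    using assms by (auto simp: topspace_realization)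
  with that[of \<sigma>] show ?thesis by (simp add: VR_iff)
qed

section \<open>The functor of Vietoris--Rips complexes\<close>

lemma Met_simps [simp]:
  "objs (Met \<S>) = {X. mspace X \<in> \<S>}"
  "arrs (Met \<S>) X Y = {f \<in> extensional (mspace X). short_map X Y f}"
  "idt (Met \<S>) X = restrict id (mspace X)"
  "cmp (Met \<S>) X Y Z g f = compose (mspace X) g f"
  by (simp_all add: Met_def)

lemma VR_2star_simps [simp]:
  "stage (fob VR_2star X) r = realization (VR (2 * r) X)"
  "step (fob VR_2star X) r s = id"
  by (simp_all add: VR_2star_def)

lemma far_VR_2star:
  "far VR_2star X Y f = family_class {0<..} (fob VR_2star X) (fob VR_2star Y) (\<lambda>_. simplicial_extension f)"
  by (simp add: VR_2star_def family_class_def)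

lemma family_hom_VR_2star:
  "short_map X Y f \<Longrightarrow> family_hom {0<..} (fob VR_2star X) (fob VR_2star Y) (\<lambda>_. simplicial_extension f)"
  unfolding family_hom_def
proof (intro conjI ballI impI)
  fix r s :: real assume f: "short_map X Y f" and rs: "r \<le> s"
  have "continuous_map (realization (VR (2 * r) X)) (realization (VR (2 * s) Y)) (simplicial_extension f \<circ> id)"
    by (rule continuous_map_compose[OF continuous_map_realization_mono[OF VR_mono] continuous_map_VR[OF f]])
      (use rs in simp)
  then show "homotopic (stage (fob VR_2star X) r) (stage (fob VR_2star Y) s)
      (simplicial_extension f \<circ> step (fob VR_2star X) r s) (step (fob VR_2star Y) r s \<circ> simplicial_extension f)"
    by simp
qed (simp add: continuous_map_VR)

lemma short_map_compose:
  assumes "short_map X Y f" "short_map Y Z g" shows "short_map X Z (g \<circ> f)"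
  unfolding short_map_def
proof (intro conjI ballI)
  show "g \<circ> f \<in> mspace X \<rightarrow> mspace Z"
    using assms by (auto simp: short_map_def)
  fix x y assume "x \<in> mspace X" "y \<in> mspace X"
  then have "mdist Z (g (f x)) (g (f y)) \<le> mdist Y (f x) (f y)" "mdist Y (f x) (f y) \<le> mdist X x y"
    using assms by (auto simp: short_map_def Pi_iff)
  then show "mdist Z ((g \<circ> f) x) ((g \<circ> f) y) \<le> mdist X x y" by simp
qed

lemma short_map_cong: "short_map X Y f \<Longrightarrow> (\<And>x. x \<in> mspace X \<Longrightarrow> f x = g x) \<Longrightarrow> short_map X Y g"
  by (simp add: short_map_def Pi_iff)

lemma is_functor_VR_2star: "is_functor (Met \<S>) (hTop {0<..}) VR_2star"
proof
  have pers: "persistence_family {0<..} (fob VR_2star X)" for X :: "'a metric"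
    by (auto simp: persistence_family_def intro!: continuous_map_realization_mono VR_mono)
  then show "fob VR_2star X \<in> objs (hTop {0<..})" for X :: "'a metric"
    by simp
  show "far VR_2star X Y f \<in> arrs (hTop {0<..}) (fob VR_2star X) (fob VR_2star Y)"
    if "f \<in> arrs (Met \<S>) X Y" for X Y f
    using that pers by (simp add: far_VR_2star family_class_in family_hom_VR_2star)
  show "far VR_2star X X (idt (Met \<S>) X) = idt (hTop {0<..}) (fob VR_2star X)" for X
    unfolding far_VR_2star hTop_idt
  proof (intro family_class_eqI homotopic_with_equal)
    fix r
    have "short_map X X (restrict id (mspace X))"
      by (auto simp: short_map_def)
    then show "continuous_map (stage (fob VR_2star X) r) (stage (fob VR_2star X) r)
        (simplicial_extension (idt (Met \<S>) X))"
      by (simp add: continuous_map_VR)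
    fix a assume "a \<in> topspace (stage (fob VR_2star X) r)"
    then obtain \<sigma> where "a \<in> closed_simplex \<sigma>" "\<sigma> \<subseteq> mspace X"
      by (auto elim: in_realization_VR)
    \<comment> \<open>The identity of \<open>Met\<close> is \<open>undefined\<close> off
      \<open>mspace X\<close>, so agreement with \<open>id\<close> is checked on points carried by
      simplices of \<open>X\<close>.\<close>
    then have "simplicial_extension (restrict id (mspace X)) a = simplicial_extension id a"
      by (intro simplicial_extension_cong) auto
    then show "simplicial_extension (idt (Met \<S>) X) a = id a"
      by (simp add: simplicial_extension_id)
  qed auto
  show "far VR_2star X Z (cmp (Met \<S>) X Y Z g f) =
       cmp (hTop {0<..}) (fob VR_2star X) (fob VR_2star Y) (fob VR_2star Z)
        (far VR_2star Y Z g) (far VR_2star X Y f)"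
    if "f \<in> arrs (Met \<S>) X Y" "g \<in> arrs (Met \<S>) Y Z" for X Y Z f g
  proof -
    have fg: "short_map X Y f" "short_map Y Z g" using that by auto
    have gf: "short_map X Z (compose (mspace X) g f)"
      by (rule short_map_cong[OF short_map_compose[OF fg]]) (simp add: compose_def)
    have "family_class {0<..} (fob VR_2star X) (fob VR_2star Z) (\<lambda>_. simplicial_extension (compose (mspace X) g f))
      = family_class {0<..} (fob VR_2star X) (fob VR_2star Z) (\<lambda>_. simplicial_extension g \<circ> simplicial_extension f)"
    proof (intro family_class_eqI homotopic_with_equal)
      fix r
      show "continuous_map (stage (fob VR_2star X) r) (stage (fob VR_2star Z) r)
        (simplicial_extension (compose (mspace X) g f))"
        using continuous_map_VR[OF gf] by simp
      fix a assume "a \<in> topspace (stage (fob VR_2star X) r)"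
      then obtain \<sigma> where \<sigma>: "a \<in> closed_simplex \<sigma>" "\<sigma> \<subseteq> mspace X" "finite \<sigma>"
        by (auto elim: in_realization_VR)
      then have "simplicial_extension (compose (mspace X) g f) a = simplicial_extension (g \<circ> f) a"
        by (intro simplicial_extension_cong) (auto simp: compose_def)
      then show "simplicial_extension (compose (mspace X) g f) a = (simplicial_extension g \<circ> simplicial_extension f) a"
        by (simp only: o_apply simplicial_extension_comp[OF \<sigma>(1,3)])
    qed auto
    then show ?thesis
      using fg by (simp add: far_VR_2star hTop_cmp[OF family_hom_VR_2star family_hom_VR_2star])
  qed
qed

section \<open>Maps from neighbourhoods to Vietoris--Rips complexes\<close>

text \<open>The first space of \<open>\<eta> X\<close> need not be \<open>X\<close> itself. The map
  \<open>s\<close> identifies \<open>X\<close> isometrically with it, so that vertices can still be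
  labelled by points of \<open>X\<close>.\<close>

definition marking :: "'u metric \<times> 'u metric \<Rightarrow> 'u metric \<Rightarrow> ('u \<Rightarrow> 'u) \<Rightarrow> bool" where
  "marking P X s \<longleftrightarrow> metric_pair P \<and> s ` mspace X = mspace (fst P) \<and>
     (\<forall>x\<in>mspace X. \<forall>y\<in>mspace X. mdist (snd P) (s x) (s y) = mdist X x y)"

definition close_points :: "'u metric \<times> 'u metric \<Rightarrow> 'u metric \<Rightarrow> ('u \<Rightarrow> 'u) \<Rightarrow> real \<Rightarrow> 'u \<Rightarrow> 'u set" where
  "close_points P X s r z = {x \<in> mspace X. mdist (snd P) z (s x) < r}"

lemma markingD:
  assumes "marking P X s" "x \<in> mspace X"
  shows "s x \<in> mspace (fst P)" "s x \<in> mspace (snd P)"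
  using assms by (auto simp: marking_def metric_pair_def)

lemma nbhd_marking:
  "marking P X s \<Longrightarrow> nbhd r P = {z \<in> mspace (snd P). close_points P X s r z \<noteq> {}}"
proof -
  assume "marking P X s"
  then have "mspace (fst P) = s ` mspace X" by (simp add: marking_def)
  then show ?thesis by (auto simp: nbhd_def close_points_def)
qed

text \<open>This is where the scale doubles: two points closer than \<open>r\<close> to the same
  \<open>z\<close> are closer than \<open>2 * r\<close> to each other.\<close>

lemma close_points_VR:
  assumes "marking P X s" "z \<in> mspace (snd P)" "\<sigma> \<noteq> {}" "finite \<sigma>" "\<sigma> \<subseteq> close_points P X s r z"
  shows "\<sigma> \<in> VR (2 * r) X"
  unfolding VR_iff
proof (intro conjI ballI)
  fix x y assume "x \<in> \<sigma>" "y \<in> \<sigma>"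
  then have xy: "x \<in> mspace X" "mdist (snd P) z (s x) < r" "y \<in> mspace X" "mdist (snd P) z (s y) < r"
    using assms by (auto simp: close_points_def)
  have "mdist X x y = mdist (snd P) (s x) (s y)"
    using xy assms by (simp add: marking_def)
  also have "\<dots> \<le> mdist (snd P) (s x) z + mdist (snd P) z (s y)"
    using mdist_triangle markingD(2)[OF assms(1)] xy assms by metis
  finally show "mdist X x y < 2 * r"
    using xy by (simp add: mdist_commute)
qed (use assms in \<open>auto simp: close_points_def\<close>)

text \<open>The properties of a partition of unity subordinate to the balls, without reference to
  its construction. The vertices are close to the centre \<open>z\<close> itself, and not just each
  of them to some point of \<open>N\<close>; this makes different such maps comparable.\<close>

definition nerve_map ::
    "'u metric \<times> 'u metric \<Rightarrow> 'u metric \<Rightarrow> ('u \<Rightarrow> 'u) \<Rightarrow> real \<Rightarrow> ('u \<Rightarrow> 'u \<Rightarrow> real) \<Rightarrow> bool" where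
  "nerve_map P X s r p \<longleftrightarrow> (\<forall>v. continuous_map (nbhd_space r P) euclideanreal (\<lambda>z. p z v)) \<and>
     (\<forall>z \<in> nbhd r P. \<exists>N \<sigma>. openin (nbhd_space r P) N \<and> z \<in> N \<and> \<sigma> \<noteq> {} \<and> finite \<sigma> \<and>
        \<sigma> \<subseteq> close_points P X s r z \<and> p ` N \<subseteq> closed_simplex \<sigma>)"

lemma nbhd_mspace: "nbhd r P \<subseteq> mspace (snd P)"
  by (auto simp: nbhd_def)

lemma topspace_nbhd_space [simp]: "topspace (nbhd_space r P) = nbhd r P"
  using nbhd_mspace[of r P] by (auto simp: nbhd_space_def)

lemma nerve_mapE:
  assumes "nerve_map P X s r p" "z \<in> nbhd r P"
  obtains N \<sigma> where "openin (nbhd_space r P) N" "z \<in> N" "\<sigma> \<noteq> {}" "finite \<sigma>"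
    "\<sigma> \<subseteq> close_points P X s r z" "p ` N \<subseteq> closed_simplex \<sigma>"
proof -
  have "\<exists>N \<sigma>. openin (nbhd_space r P) N \<and> z \<in> N \<and> \<sigma> \<noteq> {} \<and> finite \<sigma> \<and>
      \<sigma> \<subseteq> close_points P X s r z \<and> p ` N \<subseteq> closed_simplex \<sigma>"
    using assms unfolding nerve_map_def by simp
  then show ?thesis
    using that by (elim exE conjE)
qed

text \<open>The function \<open>max 0 (r - d(z, s x))\<close> is 1-Lipschitz in \<open>z\<close>,
  bounded by \<open>\<bar>r\<bar>\<close>, and positive exactly on the ball of radius
  \<open>r\<close> about \<open>s x\<close>.\<close>

lemma nerve_map_exists:
  assumes s: "marking P X s"
  shows "\<exists>p. nerve_map P X s r p"
proof -
  let ?u = "\<lambda>x z. max 0 (r - mdist (snd P) z (s x))"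
  have eq: "{z \<in> mspace (snd P). \<exists>x\<in>mspace X. ?u x z > 0} = nbhd r P"
    using nbhd_marking[OF s, of r] by (auto simp: close_points_def less_max_iff_disj)
  have eq2: "{x \<in> mspace X. ?u x z > 0} = close_points P X s r z" for z
    by (auto simp: close_points_def less_max_iff_disj)
  obtain p where "\<And>v. continuous_map (nbhd_space r P) euclideanreal (\<lambda>z. p z v)"
    "\<And>z. z \<in> nbhd r P \<Longrightarrow> \<exists>N \<sigma>. openin (nbhd_space r P) N \<and> z \<in> N \<and>
        \<sigma> \<noteq> {} \<and> finite \<sigma> \<and> \<sigma> \<subseteq> close_points P X s r z \<and> p ` N \<subseteq> closed_simplex \<sigma>"
  proof (rule partition_of_unity[where u = ?u and I = "mspace X" and E = "snd P" and b = "\<bar>r\<bar>", unfolded eq eq2, folded nbhd_space_def])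
    fix x y z assume xyz: "x \<in> mspace X" "y \<in> mspace (snd P)" "z \<in> mspace (snd P)"
    have "\<bar>mdist (snd P) y (s x) - mdist (snd P) z (s x)\<bar> \<le> mdist (snd P) y z"
      using mdist_triangle[OF xyz(2,3), of "s x"] mdist_triangle[OF xyz(3,2), of "s x"]
        markingD(2)[OF s xyz(1)] by (simp add: mdist_commute abs_le_iff)
    then show "\<bar>?u x y - ?u x z\<bar> \<le> mdist (snd P) y z" by linarith
  next
    show "0 \<le> ?u x z \<and> ?u x z \<le> \<bar>r\<bar>" for x z
      using mdist_nonneg[of "snd P" z "s x"] by linarith
  qed blast
  then show ?thesis
    unfolding nerve_map_def by blast
qed

text \<open>Two maps are homotopic if, near each point, the simplices that carry them consist of points
  close to a common centre.\<close>

definition centred :: "'a topology \<Rightarrow> 'u metric \<times> 'u metric \<Rightarrow> 'u metric \<Rightarrow> ('u \<Rightarrow> 'u) \<Rightarrow> real \<Rightarrow>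
    ('a \<Rightarrow> 'u) \<Rightarrow> ('a \<Rightarrow> 'u \<Rightarrow> real) \<Rightarrow> bool" where
  "centred W P X s r \<zeta> p \<longleftrightarrow> (\<forall>w \<in> topspace W. \<zeta> w \<in> mspace (snd P) \<and>
     (\<exists>N \<sigma>. openin W N \<and> w \<in> N \<and> \<sigma> \<noteq> {} \<and> finite \<sigma> \<and>
        \<sigma> \<subseteq> close_points P X s r (\<zeta> w) \<and> p ` N \<subseteq> closed_simplex \<sigma>))"

lemma centredE:
  assumes "centred W P X s r \<zeta> p" "w \<in> topspace W"
  obtains N \<sigma> where "openin W N" "w \<in> N" "\<sigma> \<noteq> {}" "finite \<sigma>"
    "\<sigma> \<subseteq> close_points P X s r (\<zeta> w)" "p ` N \<subseteq> closed_simplex \<sigma>"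
proof -
  have "\<exists>N \<sigma>. openin W N \<and> w \<in> N \<and> \<sigma> \<noteq> {} \<and> finite \<sigma> \<and>
      \<sigma> \<subseteq> close_points P X s r (\<zeta> w) \<and> p ` N \<subseteq> closed_simplex \<sigma>"
    using assms unfolding centred_def by simp
  then show ?thesis
    using that by (elim exE conjE)
qed

text \<open>Two simplices of points close to the same centre have a union of the same kind, and that
  union is a simplex as well.\<close>

lemma centred_carried:
  assumes s: "marking P X s" and p: "centred W P X s r \<zeta> p" and q: "centred W P X s r \<zeta> q"
  shows "carried W (VR (2 * r) X) p q"
  unfolding carried_def
proof
  fix w assume w: "w \<in> topspace W"
  obtain N \<sigma> where N: "openin W N" "w \<in> N" "\<sigma> \<noteq> {}" "finite \<sigma>"
        "\<sigma> \<subseteq> close_points P X s r (\<zeta> w)" "p ` N \<subseteq> closed_simplex \<sigma>"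
    using centredE[OF p w] .
  obtain M \<tau> where M: "openin W M" "w \<in> M" "\<tau> \<noteq> {}" "finite \<tau>"
        "\<tau> \<subseteq> close_points P X s r (\<zeta> w)" "q ` M \<subseteq> closed_simplex \<tau>"
    using centredE[OF q w] .
  have z: "\<zeta> w \<in> mspace (snd P)"
    using p w by (simp add: centred_def)
  have "\<sigma> \<union> \<tau> \<in> VR (2 * r) X"
    by (rule close_points_VR[OF s z]) (use N M in auto)
  moreover have "openin W (N \<inter> M)" "w \<in> N \<inter> M"
    using N M by auto
  moreover have "p ` (N \<inter> M) \<subseteq> closed_simplex (\<sigma> \<union> \<tau>)" "q ` (N \<inter> M) \<subseteq> closed_simplex (\<sigma> \<union> \<tau>)"
    using N(4,6) M(4,6) closed_simplex_mono[of "\<sigma> \<union> \<tau>" \<sigma>] closed_simplex_mono[of "\<sigma> \<union> \<tau>" \<tau>] by auto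
  ultimately show "\<exists>N \<sigma>. openin W N \<and> w \<in> N \<and> \<sigma> \<in> VR (2 * r) X \<and>
      p ` N \<subseteq> closed_simplex \<sigma> \<and> q ` N \<subseteq> closed_simplex \<sigma>" by blast
qed

section \<open>Comparison of maps with a common centre\<close>

lemma nerve_map_centred:
  assumes "nerve_map P X s r p" shows "centred (nbhd_space r P) P X s r id p"
  unfolding centred_def
proof
  fix z assume "z \<in> topspace (nbhd_space r P)"
  then have z: "z \<in> nbhd r P" by simp
  with assms have "\<exists>N \<sigma>. openin (nbhd_space r P) N \<and> z \<in> N \<and> \<sigma> \<noteq> {} \<and> finite \<sigma> \<and>
        \<sigma> \<subseteq> close_points P X s r z \<and> p ` N \<subseteq> closed_simplex \<sigma>"
    unfolding nerve_map_def by simp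
  then show "id z \<in> mspace (snd P) \<and> (\<exists>N \<sigma>. openin (nbhd_space r P) N \<and> z \<in> N \<and> \<sigma> \<noteq> {} \<and>
      finite \<sigma> \<and> \<sigma> \<subseteq> close_points P X s r (id z) \<and> p ` N \<subseteq> closed_simplex \<sigma>)"
    by (simp only: id_apply subsetD[OF nbhd_mspace z] simp_thms)
qed

lemma centred_compose:
  assumes p: "centred Y P X s r \<zeta> p" and f: "continuous_map W Y f"
  shows "centred W P X s r (\<zeta> \<circ> f) (p \<circ> f)"
  unfolding centred_def
proof
  fix w assume w: "w \<in> topspace W"
  then have fw: "f w \<in> topspace Y"
    using f by (auto dest: continuous_map_funspace)
  obtain N \<sigma> where N: "openin Y N" "f w \<in> N" "\<sigma> \<noteq> {}" "finite \<sigma>"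
        "\<sigma> \<subseteq> close_points P X s r (\<zeta> (f w))" "p ` N \<subseteq> closed_simplex \<sigma>"
    using centredE[OF p fw] .
  have "openin W {x \<in> topspace W. f x \<in> N}"
    using f N by (simp add: continuous_map_def)
  moreover have "(p \<circ> f) ` {x \<in> topspace W. f x \<in> N} \<subseteq> closed_simplex \<sigma>"
    using N by auto
  ultimately show "(\<zeta> \<circ> f) w \<in> mspace (snd P) \<and> (\<exists>N \<sigma>. openin W N \<and> w \<in> N \<and> \<sigma> \<noteq> {} \<and> finite \<sigma> \<and>
        \<sigma> \<subseteq> close_points P X s r ((\<zeta> \<circ> f) w) \<and> (p \<circ> f) ` N \<subseteq> closed_simplex \<sigma>)"
    using N w fw p by (intro conjI exI[of _ "{x \<in> topspace W. f x \<in> N}"] exI[of _ \<sigma>]) (auto simp: centred_def)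
qed

lemma centred_homotopic:
  assumes "marking P X s" "centred W P X s r \<zeta> p" "centred W P X s r \<zeta> q"
    "continuous_map W (realization (VR (2 * r) X)) p" "continuous_map W (realization (VR (2 * r) X)) q"
  shows "homotopic W (realization (VR (2 * r) X)) p q"
  by (rule carried_homotopic[OF centred_carried[OF assms(1-3)]
        continuous_map_coordinate[OF assms(4)] continuous_map_coordinate[OF assms(5)]])

lemma continuous_map_nerve_map:
  assumes "marking P X s" "nerve_map P X s r p"
  shows "continuous_map (nbhd_space r P) (realization (VR (2 * r) X)) p"
proof (rule continuous_map_into_realization)
  show "carried (nbhd_space r P) (VR (2 * r) X) p p"
    using centred_carried[OF assms(1)] nerve_map_centred[OF assms(2)] by blast
qed (use assms(2) in \<open>simp add: nerve_map_def\<close>)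

lemma continuous_map_nbhd_space_id:
  assumes "r \<le> s" shows "continuous_map (nbhd_space r P) (nbhd_space s P) id"
proof -
  have "nbhd r P \<subseteq> nbhd s P" using assms by (auto simp: nbhd_def) (meson less_le_trans)
  then show ?thesis by (auto simp: nbhd_space_def continuous_map_in_subtopology)
qed

text \<open>Both maps are centred at \<open>z\<close> for the larger radius.\<close>

lemma nerve_map_step:
  assumes m: "marking P X s" and p: "nerve_map P X s r p" and q: "nerve_map P X s t q" and rt: "r \<le> t"
  shows "homotopic (nbhd_space r P) (realization (VR (2 * t) X)) (q \<circ> id) (id \<circ> p)"
proof (rule centred_homotopic[OF m])
  show "centred (nbhd_space r P) P X s t (id \<circ> id) (q \<circ> id)"
    by (rule centred_compose[OF nerve_map_centred[OF q] continuous_map_nbhd_space_id[OF rt]])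
  have "close_points P X s r z \<subseteq> close_points P X s t z" for z
    using rt by (auto simp: close_points_def)
  then show "centred (nbhd_space r P) P X s t (id \<circ> id) (id \<circ> p)"
    using nerve_map_centred[OF p] unfolding centred_def by simp (meson subset_trans)
  show "continuous_map (nbhd_space r P) (realization (VR (2 * t) X)) (q \<circ> id)"
    using continuous_map_compose[OF continuous_map_nbhd_space_id[OF rt] continuous_map_nerve_map[OF m q]] .
  show "continuous_map (nbhd_space r P) (realization (VR (2 * t) X)) (id \<circ> p)"
    using continuous_map_compose[OF continuous_map_nerve_map[OF m p] continuous_map_realization_mono] rt
    by (simp add: VR_mono)
qed

section \<open>Naturality with respect to maps of pairs\<close>

lemma short_map_continuous: "short_map X Y f \<Longrightarrow> continuous_map (mtopology_of X) (mtopology_of Y) f"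
proof (rule Lipschitz_continuous_imp_continuous_map)
  assume f: "short_map X Y f"
  then have "\<forall>x\<in>mspace X. \<forall>y\<in>mspace X. mdist Y (f x) (f y) \<le> 1 * mdist X x y"
    by (simp add: short_map_def)
  with f show "Lipschitz_continuous_map X Y f"
    unfolding Lipschitz_continuous_map_def short_map_def by blast
qed

lemma short_mapD:
  assumes "short_map X Y f" "x \<in> mspace X"
  shows "f x \<in> mspace Y" "y \<in> mspace X \<Longrightarrow> mdist Y (f x) (f y) \<le> mdist X x y"
  using assms by (auto simp: short_map_def)

lemma pair_map_nbhd:
  assumes "pair_map P Q F" "metric_pair P" shows "F ` nbhd r P \<subseteq> nbhd r Q"
proof safe
  fix z assume "z \<in> nbhd r P"
  then obtain x where x: "z \<in> mspace (snd P)" "x \<in> mspace (fst P)" "mdist (snd P) z x < r"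
    by (auto simp: nbhd_def)
  have F: "short_map (snd P) (snd Q) F" "F x \<in> mspace (fst Q)"
    using assms x by (auto simp: pair_map_def)
  have "x \<in> mspace (snd P)"
    using assms x by (auto simp: metric_pair_def)
  then have "mdist (snd Q) (F z) (F x) < r" "F z \<in> mspace (snd Q)"
    using short_mapD[OF F(1) x(1)] x(3) by (auto intro: le_less_trans)
  with F(2) show "F z \<in> nbhd r Q"
    by (auto simp: nbhd_def)
qed

lemma continuous_map_nbhd_space:
  assumes "pair_map P Q F" "metric_pair P"
  shows "continuous_map (nbhd_space r P) (nbhd_space r Q) F"
  using pair_map_nbhd[OF assms, of r] assms nbhd_mspace[of r P]
  by (auto simp: nbhd_space_def continuous_map_in_subtopology pair_map_def
      intro!: continuous_map_from_subtopology short_map_continuous)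

text \<open>Both composites are centred at \<open>F z\<close>: a 1-Lipschitz \<open>F\<close>
  carries points close to \<open>z\<close> to points close to \<open>F z\<close>, and on marked
  points it is \<open>f\<close>.\<close>

lemma nerve_map_natural:
  assumes m: "marking P X s" and m': "marking Q Y t" and p: "nerve_map P X s r p" and q: "nerve_map Q Y t r q"
    and F: "pair_map P Q F" and f: "short_map X Y f" and Ff: "\<And>x. x \<in> mspace X \<Longrightarrow> F (s x) = t (f x)"
  shows "homotopic (nbhd_space r P) (realization (VR (2 * r) Y)) (q \<circ> F) (simplicial_extension f \<circ> p)"
proof (rule centred_homotopic[OF m'])
  have P: "metric_pair P" using m by (simp add: marking_def)
  note Fc = continuous_map_nbhd_space[OF F P, of r]
  show "centred (nbhd_space r P) Q Y t r (id \<circ> F) (q \<circ> F)"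
    by (rule centred_compose[OF nerve_map_centred[OF q] Fc])
  show "centred (nbhd_space r P) Q Y t r (id \<circ> F) (simplicial_extension f \<circ> p)"
    unfolding centred_def
  proof
    fix z assume z: "z \<in> topspace (nbhd_space r P)"
    then have z': "z \<in> mspace (snd P)" using subsetD[OF nbhd_mspace] by simp
    obtain N \<sigma> where N: "openin (nbhd_space r P) N" "z \<in> N" "\<sigma> \<noteq> {}" "finite \<sigma>"
       "\<sigma> \<subseteq> close_points P X s r z" "p ` N \<subseteq> closed_simplex \<sigma>"
      using nerve_mapE[OF p] z by (metis topspace_nbhd_space)
    have "f ` \<sigma> \<subseteq> close_points Q Y t r (F z)"
    proof safe
      fix x assume "x \<in> \<sigma>"
      then have x: "x \<in> mspace X" "mdist (snd P) z (s x) < r"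
        using N(5) by (auto simp: close_points_def)
      then have "mdist (snd Q) (F z) (F (s x)) < r"
        using short_mapD(2)[OF _ z' markingD(2)[OF m x(1)]] F
        unfolding pair_map_def by (meson le_less_trans)
      then show "f x \<in> close_points Q Y t r (F z)"
        using x(1) Ff f by (auto simp: close_points_def short_map_def)
    qed
    moreover have "(simplicial_extension f \<circ> p) ` N \<subseteq> closed_simplex (f ` \<sigma>)"
      using N(4,6) by (auto intro!: simplicial_extension_closed_simplex)
    moreover have "F z \<in> mspace (snd Q)"
      using F z' by (auto simp: pair_map_def short_map_def)
    ultimately show "(id \<circ> F) z \<in> mspace (snd Q) \<and> (\<exists>N \<sigma>. openin (nbhd_space r P) N \<and> z \<in> N \<and> \<sigma> \<noteq> {} \<and>
       finite \<sigma> \<and> \<sigma> \<subseteq> close_points Q Y t r ((id \<circ> F) z) \<and> (simplicial_extension f \<circ> p) ` N \<subseteq> closed_simplex \<sigma>)"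
      using N by (intro conjI exI[of _ N] exI[of _ "f ` \<sigma>"]) auto
  qed
  show "continuous_map (nbhd_space r P) (realization (VR (2 * r) Y)) (q \<circ> F)"
    using continuous_map_compose[OF Fc continuous_map_nerve_map[OF m' q]] .
  show "continuous_map (nbhd_space r P) (realization (VR (2 * r) Y)) (simplicial_extension f \<circ> p)"
    using continuous_map_compose[OF continuous_map_nerve_map[OF m p] continuous_map_VR[OF f]] .
qed

section \<open>Metric pairs\<close>

lemma pair_map_fst:
  assumes "pair_map P Q f" "metric_pair P" "metric_pair Q"
  shows "short_map (fst P) (fst Q) f"
  using assms unfolding pair_map_def short_map_def metric_pair_def
  by (auto simp: image_subset_iff subset_iff Pi_iff)

lemma pair_map_compose: "pair_map P Q f \<Longrightarrow> pair_map Q R g \<Longrightarrow> pair_map P R (g \<circ> f)"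
  by (auto simp: pair_map_def intro: short_map_compose)

lemma pair_map_id: "pair_map P P id"
  by (simp add: pair_map_def short_map_def)

lemma pair_homotopic_agree: "pair_homotopic P Q f g \<Longrightarrow> x \<in> mspace (fst P) \<Longrightarrow> f x = g x"
  by (auto simp: pair_homotopic_def dest: homotopic_with_imp_property)

lemma pair_homotopic_sym: "pair_homotopic P Q f g \<Longrightarrow> pair_homotopic P Q g f"
  unfolding pair_homotopic_def using homotopic_with_symD by blast

lemma pair_homotopic_pair_map:
  assumes "pair_homotopic P Q f g" shows "pair_map P Q f"
proof -
  obtain \<phi> where \<phi>: "short_map (fst P) (fst Q) \<phi>"
    "short_map (snd P) (snd Q) f \<and> (\<forall>x \<in> mspace (fst P). f x = \<phi> x)"
    using assms by (auto simp: pair_homotopic_def dest: homotopic_with_imp_property)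
  then show ?thesis
    by (auto simp: pair_map_def short_map_def)
qed

text \<open>The constant homotopy suffices. With \<open>g = f\<close> this is reflexivity, and for
  other \<open>g\<close> it accounts for representatives that differ off the ambient space
  only.\<close>

lemma pair_homotopic_cong:
  assumes "pair_map P Q f" "metric_pair P" "metric_pair Q" "\<And>x. x \<in> mspace (snd P) \<Longrightarrow> f x = g x"
  shows "pair_homotopic P Q f g"
  unfolding pair_homotopic_def
proof (intro exI conjI)
  show "short_map (fst P) (fst Q) f"
    using pair_map_fst assms by blast
  have f: "short_map (snd P) (snd Q) f" using assms by (simp add: pair_map_def)
  show "homotopic_with (\<lambda>h. short_map (snd P) (snd Q) h \<and> (\<forall>x\<in>mspace (fst P). h x = f x))
     (mtopology_of (snd P)) (mtopology_of (snd Q)) f g"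
    by (rule homotopic_with_equal)
      (use assms f short_map_cong[OF f] short_map_continuous[OF f] in \<open>auto simp: metric_pair_def subset_iff\<close>)
qed

lemma pair_homotopic_trans:
  assumes fg: "pair_homotopic P Q f g" and gh: "pair_homotopic P Q g h"
  shows "pair_homotopic P Q f h"
proof -
  obtain \<phi> where \<phi>: "short_map (fst P) (fst Q) \<phi>"
    "homotopic_with (\<lambda>h. short_map (snd P) (snd Q) h \<and> (\<forall>x \<in> mspace (fst P). h x = \<phi> x))
       (mtopology_of (snd P)) (mtopology_of (snd Q)) f g"
    using fg by (auto simp: pair_homotopic_def)
  obtain \<psi> where \<psi>:
    "homotopic_with (\<lambda>h. short_map (snd P) (snd Q) h \<and> (\<forall>x \<in> mspace (fst P). h x = \<psi> x))
       (mtopology_of (snd P)) (mtopology_of (snd Q)) g h"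
    using gh by (auto simp: pair_homotopic_def)
  \<comment> \<open>The maps prescribed by the two homotopies need not coincide as functions, but
    both equal \<open>g\<close> on the subspace.\<close>
  have "\<forall>x\<in>mspace (fst P). \<psi> x = \<phi> x"
    using homotopic_with_imp_property[OF \<phi>(2)] homotopic_with_imp_property[OF \<psi>] by auto
  then have "homotopic_with (\<lambda>h. short_map (snd P) (snd Q) h \<and> (\<forall>x \<in> mspace (fst P). h x = \<phi> x))
       (mtopology_of (snd P)) (mtopology_of (snd Q)) g h"
    by (intro homotopic_with_mono[OF \<psi>]) auto
  from homotopic_with_trans[OF \<phi>(2) this] \<phi>(1) show ?thesis
    by (auto simp: pair_homotopic_def)
qed

lemma pair_homotopic_compose:
  assumes f: "pair_homotopic P Q f f'" and g: "pair_homotopic Q R g g'"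
  shows "pair_homotopic P R (g \<circ> f) (g' \<circ> f')"
proof -
  obtain \<phi> where \<phi>: "short_map (fst P) (fst Q) \<phi>"
    "homotopic_with (\<lambda>h. short_map (snd P) (snd Q) h \<and> (\<forall>x \<in> mspace (fst P). h x = \<phi> x))
       (mtopology_of (snd P)) (mtopology_of (snd Q)) f f'"
    using f by (auto simp: pair_homotopic_def)
  obtain \<psi> where \<psi>: "short_map (fst Q) (fst R) \<psi>"
    "homotopic_with (\<lambda>h. short_map (snd Q) (snd R) h \<and> (\<forall>x \<in> mspace (fst Q). h x = \<psi> x))
       (mtopology_of (snd Q)) (mtopology_of (snd R)) g g'"
    using g by (auto simp: pair_homotopic_def)
  let ?P = "\<lambda>h. short_map (snd P) (snd R) h \<and> (\<forall>x \<in> mspace (fst P). h x = (\<psi> \<circ> \<phi>) x)"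
  have \<phi>Q: "\<phi> x \<in> mspace (fst Q)" if "x \<in> mspace (fst P)" for x
    using \<phi>(1) that by (auto simp: short_map_def)
  note f' = homotopic_with_imp_property[OF \<phi>(2)] and g' = homotopic_with_imp_property[OF \<psi>(2)]
  have "homotopic_with ?P (mtopology_of (snd P)) (mtopology_of (snd R)) (g \<circ> f) (g \<circ> f')"
    by (rule homotopic_with_compose_continuous_map_left[OF \<phi>(2) short_map_continuous])
      (use g' \<phi>Q in \<open>auto intro: short_map_compose\<close>)
  moreover have "homotopic_with ?P (mtopology_of (snd P)) (mtopology_of (snd R)) (g \<circ> f') (g' \<circ> f')"
    by (rule homotopic_with_compose_continuous_map_right[OF \<psi>(2) short_map_continuous])
      (use f' \<phi>Q in \<open>auto intro: short_map_compose\<close>)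
  ultimately have "homotopic_with ?P (mtopology_of (snd P)) (mtopology_of (snd R)) (g \<circ> f) (g' \<circ> f')"
    by (rule homotopic_with_trans)
  then show ?thesis
    using short_map_compose[OF \<phi>(1) \<psi>(1)] unfolding pair_homotopic_def by blast
qed

section \<open>The category of pairs and its forgetful functor\<close>

lemma mem_pair_class: "g \<in> pair_class P Q {f} \<longleftrightarrow> pair_homotopic P Q f g"
  by (simp add: pair_class_def)

lemma pair_class_eq_iff:
  assumes "pair_map P Q f" "pair_map P Q g" "metric_pair P" "metric_pair Q"
  shows "pair_class P Q {f} = pair_class P Q {g} \<longleftrightarrow> pair_homotopic P Q f g"
proof -
  have "pair_homotopic P Q g g" using pair_homotopic_cong assms by blast
  then show ?thesis
    unfolding pair_class_def set_eq_iff by simp (meson pair_homotopic_sym pair_homotopic_trans)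
qed

lemma PMet_simps [simp]:
  "objs (PMet \<S> \<L>) = {P. metric_pair P \<and> mspace (fst P) \<in> \<S> \<and> mspace (snd P) \<in> \<L>}"
  "arrs (PMet \<S> \<L>) P Q = {pair_class P Q {f} | f. pair_map P Q f}"
  "idt (PMet \<S> \<L>) P = pair_class P P {id}"
  by (simp_all add: PMet_def)

lemma PMet_cmp:
  assumes f: "pair_map P Q f" and g: "pair_map Q R g"
    and "metric_pair P" "metric_pair Q" "metric_pair R"
  shows "cmp (PMet \<S> \<L>) P Q R (pair_class Q R {g}) (pair_class P Q {f}) = pair_class P R {g \<circ> f}"
proof -
  have ff: "pair_homotopic P Q f f" and gg: "pair_homotopic Q R g g"
    using pair_homotopic_cong assms by blast+
  show ?thesis
    unfolding PMet_def pair_class_def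
  proof (simp, intro set_eqI iffI; clarsimp)
    fix x f' g' assume f': "pair_homotopic P Q f f'" and g': "pair_homotopic Q R g g'"
      and x: "pair_homotopic P R (g' \<circ> f') x"
    from pair_homotopic_trans[OF pair_homotopic_compose[OF f' g'] x]
    show "pair_homotopic P R (g \<circ> f) x" .
  next
    fix x assume "pair_homotopic P R (g \<circ> f) x"
    with ff gg show "\<exists>h. (\<exists>f' g'. h = g' \<circ> f' \<and> pair_homotopic P Q f f' \<and> pair_homotopic Q R g g') \<and>
        pair_homotopic P R h x"
      by blast
  qed
qed

text \<open>The choice made by \<open>SOME\<close> does not matter, because homotopies of pairs are
  constant on the subspace.\<close>

lemma far_forget:
  assumes "pair_map P Q f" "metric_pair P" "metric_pair Q"
  shows "far forget P Q (pair_class P Q {f}) = restrict f (mspace (fst P))"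
proof -
  have "f \<in> pair_class P Q {f}"
    using pair_homotopic_cong[OF assms] by (simp add: mem_pair_class)
  then have "(SOME g. g \<in> pair_class P Q {f}) \<in> pair_class P Q {f}"
    by (rule someI[of "\<lambda>g. g \<in> pair_class P Q {f}"])
  then have "\<forall>x\<in>mspace (fst P). (SOME g. g \<in> pair_class P Q {f}) x = f x"
    by (simp add: mem_pair_class pair_homotopic_agree)
  then show ?thesis
    by (simp add: forget_def cong: restrict_cong)
qed

lemma fob_forget [simp]: "fob forget = fst"
  by (simp add: forget_def)

text \<open>The counit \<open>\<epsilon> X\<close> is the map that the bijection sends to the
  identity of \<open>\<eta> X\<close>. The bijection then sends
  \<open>\<epsilon> X \<circ> \<theta>\<close> to the class of \<open>\<theta>\<close>, so that its
  surjectivity gives lifts and its injectivity gives their uniqueness up to homotopy.\<close>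

lemma metric_homotopy_pairing_counit:
  assumes "metric_homotopy_pairing \<S> \<L> \<eta>"
  obtains \<epsilon> where
    "\<And>X. mspace X \<in> \<S> \<Longrightarrow> short_map (fst (fob \<eta> X)) X (\<epsilon> X)"
    "\<And>X Y f F y. \<lbrakk>mspace X \<in> \<S>; mspace Y \<in> \<S>; f \<in> arrs (Met \<S>) X Y; F \<in> far \<eta> X Y f;
       y \<in> mspace (fst (fob \<eta> X))\<rbrakk> \<Longrightarrow> \<epsilon> Y (F y) = f (\<epsilon> X y)"
    "\<And>X P j. \<lbrakk>mspace X \<in> \<S>; P \<in> objs (PMet \<S> \<L>); short_map (fst P) X j\<rbrakk> \<Longrightarrow>
       \<exists>\<theta>. pair_map P (fob \<eta> X) \<theta> \<and> (\<forall>x\<in>mspace (fst P). \<epsilon> X (\<theta> x) = j x)"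
    "\<And>X P f g. \<lbrakk>mspace X \<in> \<S>; P \<in> objs (PMet \<S> \<L>); pair_map P (fob \<eta> X) f; pair_map P (fob \<eta> X) g;
       \<And>x. x \<in> mspace (fst P) \<Longrightarrow> \<epsilon> X (f x) = \<epsilon> X (g x)\<rbrakk> \<Longrightarrow> pair_homotopic P (fob \<eta> X) f g"
proof -
  let ?P = "PMet \<S> \<L>" and ?M = "Met \<S>"
  obtain \<Phi> where \<eta>: "is_functor ?M ?P \<eta>"
    and bij: "\<And>A X. A \<in> objs ?P \<Longrightarrow> X \<in> objs ?M \<Longrightarrow>
        bij_betw (\<Phi> A X) (arrs ?M (fst A) X) (arrs ?P A (fob \<eta> X))"
    and nat: "\<And>A' A X X' a f x. \<lbrakk>A' \<in> objs ?P; A \<in> objs ?P; X \<in> objs ?M; X' \<in> objs ?M;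
        a \<in> arrs ?P A' A; f \<in> arrs ?M (fst A) X; x \<in> arrs ?M X X'\<rbrakk> \<Longrightarrow>
        \<Phi> A' X' (cmp ?M (fst A') X X' x (cmp ?M (fst A') (fst A) X f (far forget A' A a)))
        = cmp ?P A' (fob \<eta> X) (fob \<eta> X') (far \<eta> X X' x) (cmp ?P A' A (fob \<eta> X) (\<Phi> A X f) a)"
    using assms unfolding metric_homotopy_pairing_def right_adjoint_def fob_forget by (elim conjE exE) blast
  have \<eta>P: "metric_pair (fob \<eta> X)" "fob \<eta> X \<in> objs ?P" if "mspace X \<in> \<S>" for X
    using is_functor.fob_in[OF \<eta>] that by auto
  have idP: "pair_class Q Q {id} \<in> arrs ?P Q Q" for Q
    using pair_map_id[of Q] by auto
  have "\<exists>e. e \<in> arrs ?M (fst (fob \<eta> X)) X \<and> \<Phi> (fob \<eta> X) X e = pair_class (fob \<eta> X) (fob \<eta> X) {id}"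
    if "mspace X \<in> \<S>" for X
    using bij_betw_imp_surj_on[OF bij[of "fob \<eta> X" X]] \<eta>P(2)[OF that] idP[of "fob \<eta> X"] that
    by (metis (no_types, lifting) Met_simps(1) imageE mem_Collect_eq)
  then obtain \<epsilon> where \<epsilon>: "\<And>X. mspace X \<in> \<S> \<Longrightarrow> \<epsilon> X \<in> arrs ?M (fst (fob \<eta> X)) X"
    "\<And>X. mspace X \<in> \<S> \<Longrightarrow> \<Phi> (fob \<eta> X) X (\<epsilon> X) = pair_class (fob \<eta> X) (fob \<eta> X) {id}"
    by metis
  have idX: "restrict id (mspace X) \<in> arrs ?M X X" for X
    by (auto simp: short_map_def)
  \<comment> \<open>Naturality in the pair along \<open>\<theta>\<close>, with the identity in the
    other variable, as in the Yoneda lemma.\<close>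
  have \<Phi>\<epsilon>: "\<Phi> P X (restrict (\<epsilon> X \<circ> \<theta>) (mspace (fst P))) = pair_class P (fob \<eta> X) {\<theta>}"
    if X: "mspace X \<in> \<S>" and P: "P \<in> objs ?P" and \<theta>: "pair_map P (fob \<eta> X) \<theta>" for X P \<theta>
  proof -
    have mp: "metric_pair P" using P by simp
    have \<theta>X: "\<theta> x \<in> mspace (fst (fob \<eta> X))" if "x \<in> mspace (fst P)" for x
      using \<theta> that by (auto simp: pair_map_def)
    have \<epsilon>X: "\<epsilon> X (\<theta> x) \<in> mspace X" if "x \<in> mspace (fst P)" for x
      using \<epsilon>(1)[OF X] \<theta>X[OF that] by (auto simp: short_map_def)
    have "cmp ?M (fst P) X X (restrict id (mspace X)) (cmp ?M (fst P) (fst (fob \<eta> X)) X (\<epsilon> X)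
        (far forget P (fob \<eta> X) (pair_class P (fob \<eta> X) {\<theta>}))) = restrict (\<epsilon> X \<circ> \<theta>) (mspace (fst P))"
      using \<epsilon>X by (auto simp: far_forget[OF \<theta> mp \<eta>P(1)[OF X]] compose_def restrict_def)
    moreover have "far \<eta> X X (restrict id (mspace X)) = pair_class (fob \<eta> X) (fob \<eta> X) {id}"
      using is_functor.far_idt[OF \<eta>, of X] X by simp
    ultimately show ?thesis
      using nat[OF P \<eta>P(2)[OF X], of X X "pair_class P (fob \<eta> X) {\<theta>}" "\<epsilon> X" "restrict id (mspace X)"] \<epsilon>[OF X] idX[of X] X \<theta>
      by (simp add: PMet_cmp[OF _ pair_map_id mp] PMet_cmp[OF \<theta> pair_map_id mp] \<eta>P(1) mp) blast
  qed
  have rest: "restrict (\<epsilon> X \<circ> \<theta>) (mspace (fst P)) \<in> arrs ?M (fst P) X"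
    if X: "mspace X \<in> \<S>" and P: "P \<in> objs ?P" and \<theta>: "pair_map P (fob \<eta> X) \<theta>" for X P \<theta>
  proof -
    have "short_map (fst P) X (\<epsilon> X \<circ> \<theta>)"
      by (rule short_map_compose[OF pair_map_fst[OF \<theta> _ \<eta>P(1)[OF X]]]) (use P \<epsilon>(1)[OF X] in auto)
    then have "short_map (fst P) X (restrict (\<epsilon> X \<circ> \<theta>) (mspace (fst P)))"
      by (rule short_map_cong) simp
    then show ?thesis by simp
  qed
  have inj: "a = b" if "mspace X \<in> \<S>" "P \<in> objs ?P" "a \<in> arrs ?M (fst P) X" "b \<in> arrs ?M (fst P) X"
    "\<Phi> P X a = \<Phi> P X b" for a b X P
    using bij_betw_imp_inj_on[OF bij[OF that(2), of X]] that by (auto dest: inj_onD)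
  show ?thesis
  proof
    show "short_map (fst (fob \<eta> X)) X (\<epsilon> X)" if "mspace X \<in> \<S>" for X
      using \<epsilon>(1)[OF that] by simp
  next
    fix X Y f F y
    assume X: "mspace X \<in> \<S>" and Y: "mspace Y \<in> \<S>" and f: "f \<in> arrs (Met \<S>) X Y" and F: "F \<in> far \<eta> X Y f"
      and y: "y \<in> mspace (fst (fob \<eta> X))"
    obtain F' where F': "pair_map (fob \<eta> X) (fob \<eta> Y) F'"
      "far \<eta> X Y f = pair_class (fob \<eta> X) (fob \<eta> Y) {F'}"
      using is_functor.far_in[OF \<eta> _ _ f] X Y by auto
    note mX = \<eta>P(1)[OF X] and mY = \<eta>P(1)[OF Y]
    have \<epsilon>f: "compose (mspace (fst (fob \<eta> X))) f (\<epsilon> X) \<in> arrs ?M (fst (fob \<eta> X)) Y"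
      using short_map_cong[OF short_map_compose, of "fst (fob \<eta> X)" X "\<epsilon> X" Y f] \<epsilon>(1)[OF X] f
      by (simp add: compose_def)
    \<comment> \<open>Here naturality is used in the other variable: along \<open>f\<close>, with
      the identity of \<open>\<eta> X\<close> as the map of pairs. Comparison with
      \<open>\<epsilon> Y \<circ> F'\<close> gives naturality of the counit by injectivity.\<close>
    have "cmp ?M (fst (fob \<eta> X)) X Y f (cmp ?M (fst (fob \<eta> X)) (fst (fob \<eta> X)) X (\<epsilon> X)
        (far forget (fob \<eta> X) (fob \<eta> X) (pair_class (fob \<eta> X) (fob \<eta> X) {id})))
        = compose (mspace (fst (fob \<eta> X))) f (\<epsilon> X)"
      by (auto simp: far_forget[OF pair_map_id mX mX] compose_def)
    then have "\<Phi> (fob \<eta> X) Y (compose (mspace (fst (fob \<eta> X))) f (\<epsilon> X)) = pair_class (fob \<eta> X) (fob \<eta> Y) {F'}"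
      using nat[OF \<eta>P(2)[OF X] \<eta>P(2)[OF X] _ _ idP \<epsilon>(1)[OF X] f] X Y F' mX mY
      by (simp add: \<epsilon>(2) PMet_cmp pair_map_id)
    also have "\<dots> = \<Phi> (fob \<eta> X) Y (restrict (\<epsilon> Y \<circ> F') (mspace (fst (fob \<eta> X))))"
      using \<Phi>\<epsilon>[OF Y \<eta>P(2)[OF X] F'(1)] by simp
    finally have "compose (mspace (fst (fob \<eta> X))) f (\<epsilon> X) = restrict (\<epsilon> Y \<circ> F') (mspace (fst (fob \<eta> X)))"
      by (intro inj[OF Y \<eta>P(2)[OF X] \<epsilon>f rest[OF Y \<eta>P(2)[OF X] F'(1)]])
    from fun_cong[OF this, of y] y have "f (\<epsilon> X y) = \<epsilon> Y (F' y)"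
      by (simp add: compose_def)
    moreover have "F y = F' y"
      using F pair_homotopic_agree[OF _ y, of "fob \<eta> Y" F' F] unfolding F'(2) mem_pair_class by simp
    ultimately show "\<epsilon> Y (F y) = f (\<epsilon> X y)" by simp
  next
    fix X P j assume X: "mspace X \<in> \<S>" and P: "P \<in> objs ?P" and j: "short_map (fst P) X j"
    let ?j = "restrict j (mspace (fst P))"
    have j': "?j \<in> arrs ?M (fst P) X"
      using short_map_cong[OF j, of ?j] by simp
    then have "\<Phi> P X ?j \<in> arrs ?P P (fob \<eta> X)"
      using bij_betwE[OF bij[OF P, of X]] X by simp
    then obtain \<theta> where \<theta>: "pair_map P (fob \<eta> X) \<theta>" "\<Phi> P X ?j = pair_class P (fob \<eta> X) {\<theta>}"
      by auto
    then have "?j = restrict (\<epsilon> X \<circ> \<theta>) (mspace (fst P))"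
      by (intro inj[OF X P j' rest[OF X P \<theta>(1)]]) (simp add: \<Phi>\<epsilon>[OF X P \<theta>(1)])
    then have "\<epsilon> X (\<theta> x) = j x" if "x \<in> mspace (fst P)" for x
      using that by (metis comp_apply restrict_apply')
    with \<theta>(1) show "\<exists>\<theta>. pair_map P (fob \<eta> X) \<theta> \<and> (\<forall>x\<in>mspace (fst P). \<epsilon> X (\<theta> x) = j x)" by blast
  next
    fix X P f g assume X: "mspace X \<in> \<S>" and P: "P \<in> objs ?P"
      and f: "pair_map P (fob \<eta> X) f" and g: "pair_map P (fob \<eta> X) g"
      and fg: "\<And>x. x \<in> mspace (fst P) \<Longrightarrow> \<epsilon> X (f x) = \<epsilon> X (g x)"
    have "restrict (\<epsilon> X \<circ> f) (mspace (fst P)) = restrict (\<epsilon> X \<circ> g) (mspace (fst P))"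
      using fg by (auto intro: restrict_ext)
    then have "pair_class P (fob \<eta> X) {f} = pair_class P (fob \<eta> X) {g}"
      using \<Phi>\<epsilon>[OF X P f] \<Phi>\<epsilon>[OF X P g] by simp
    then show "pair_homotopic P (fob \<eta> X) f g"
      using P pair_class_eq_iff[OF f g _ \<eta>P(1)[OF X]] by simp
  qed
qed

section \<open>The functor of neighbourhoods\<close>

lemma B_star_simps [simp]:
  "stage (fob B_star P) r = nbhd_space r P"
  "step (fob B_star P) r s = id"
  by (simp_all add: B_star_def)

text \<open>Every stage of the homotopy is a map of pairs, since it equals the fixed map on the
  subspace; hence the whole homotopy restricts to neighbourhoods.\<close>

lemma pair_homotopic_nbhd:
  assumes h: "pair_homotopic P Q f g" and P: "metric_pair P"
  shows "homotopic (nbhd_space r P) (nbhd_space r Q) f g"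
proof -
  obtain \<phi> h where \<phi>: "short_map (fst P) (fst Q) \<phi>"
    and c: "continuous_map (prod_topology (top_of_set {0..1::real}) (mtopology_of (snd P))) (mtopology_of (snd Q)) h"
    and h0: "\<forall>x. h (0, x) = f x" and h1: "\<forall>x. h (1, x) = g x"
    and ht: "\<forall>t\<in>{0..1}. short_map (snd P) (snd Q) (\<lambda>x. h (t, x)) \<and> (\<forall>x\<in>mspace (fst P). h (t, x) = \<phi> x)"
    using h unfolding pair_homotopic_def homotopic_with_def by auto
  have "pair_map P Q (\<lambda>x. h (t,x))" if "t \<in> {0..1}" for t
    using ht that \<phi> by (auto simp: pair_map_def short_map_def)
  then have im: "h (t, x) \<in> nbhd r Q" if "t \<in> {0..1}" "x \<in> nbhd r P" for t x
    using pair_map_nbhd[OF _ P] that by blast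
  have "continuous_map (subtopology (prod_topology (top_of_set {0..1::real}) (mtopology_of (snd P)))
      (topspace (top_of_set {0..1::real}) \<times> nbhd r P))
      (mtopology_of (snd Q)) h"
    by (rule continuous_map_from_subtopology[OF c])
  then have "continuous_map (prod_topology (top_of_set {0..1::real}) (nbhd_space r P)) (mtopology_of (snd Q)) h"
    unfolding nbhd_space_def prod_topology_subtopology(2) .
  then have "continuous_map (prod_topology (top_of_set {0..1::real}) (nbhd_space r P)) (nbhd_space r Q) h"
    using im by (subst nbhd_space_def) (auto simp: continuous_map_in_subtopology)
  then show ?thesis
    unfolding homotopic_with_def using h0 h1 by blast
qed

lemma far_B_star:
  assumes "pair_map P Q f" "metric_pair P" "metric_pair Q"
  shows "far B_star P Q (pair_class P Q {f}) = family_class {0<..} (fob B_star P) (fob B_star Q) (\<lambda>_. f)"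
  unfolding family_class_def B_star_def
  by (simp, intro restrict_ext homotopy_class_union)
    (use assms pair_homotopic_cong[OF assms] in \<open>auto simp: mem_pair_class intro: pair_homotopic_nbhd\<close>)

lemma family_hom_B_star:
  assumes "pair_map P Q f" "metric_pair P"
  shows "family_hom {0<..} (fob B_star P) (fob B_star Q) (\<lambda>_. f)"
  using continuous_map_compose[OF continuous_map_nbhd_space_id continuous_map_nbhd_space[OF assms]]
    continuous_map_nbhd_space[OF assms]
  by (simp add: family_hom_def)

lemma is_functor_B_star: "is_functor (PMet \<S> \<L>) (hTop {0<..}) B_star"
proof
  have pers: "persistence_family {0<..} (fob B_star P)" for P :: "'a metric \<times> 'a metric"
    by (auto simp: persistence_family_def continuous_map_nbhd_space_id)
  then show "fob B_star P \<in> objs (hTop {0<..})" for P :: "'a metric \<times> 'a metric"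
    by simp
  show "far B_star P Q \<alpha> \<in> arrs (hTop {0<..}) (fob B_star P) (fob B_star Q)"
    if "P \<in> objs (PMet \<S> \<L>)" "Q \<in> objs (PMet \<S> \<L>)" "\<alpha> \<in> arrs (PMet \<S> \<L>) P Q" for P Q \<alpha>
    using that pers[of P] pers[of Q] by (auto simp: far_B_star intro!: family_class_in family_hom_B_star)
  show "far B_star P P (idt (PMet \<S> \<L>) P) = idt (hTop {0<..}) (fob B_star P)"
    if "P \<in> objs (PMet \<S> \<L>)" for P
    using that by (simp add: far_B_star pair_map_id hTop_idt)
  show "far B_star P R (cmp (PMet \<S> \<L>) P Q R \<beta> \<alpha>) =
      cmp (hTop {0<..}) (fob B_star P) (fob B_star Q) (fob B_star R) (far B_star Q R \<beta>) (far B_star P Q \<alpha>)"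
    if "P \<in> objs (PMet \<S> \<L>)" "Q \<in> objs (PMet \<S> \<L>)" "R \<in> objs (PMet \<S> \<L>)"
      "\<alpha> \<in> arrs (PMet \<S> \<L>) P Q" "\<beta> \<in> arrs (PMet \<S> \<L>) Q R" for P Q R \<alpha> \<beta>
    using that by (auto simp: PMet_cmp far_B_star pair_map_compose hTop_cmp family_hom_B_star)
qed

section \<open>Bounded functions on a set\<close>

text \<open>Functions on \<open>S\<close> are extended by zero to the whole type, which is given the discrete topology
  in order to have the normed space of bounded continuous functions at hand.\<close>

definition bfun :: "'u set \<Rightarrow> ('u \<Rightarrow> real) \<Rightarrow> 'u discrete \<Rightarrow>\<^sub>C real" where
  "bfun S F = Bcontfun (\<lambda>y. if of_discrete y \<in> S then F (of_discrete y) else 0)"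

definition bfuns :: "'u set \<Rightarrow> ('u discrete \<Rightarrow>\<^sub>C real) set" where
  "bfuns S = {\<phi>. \<forall>y. y \<notin> S \<longrightarrow> apply_bcontfun \<phi> (discrete y) = 0}"

lemma bfun_apply:
  assumes "\<And>y. y \<in> S \<Longrightarrow> \<bar>F y\<bar> \<le> b"
  shows "apply_bcontfun (bfun S F) (discrete y) = (if y \<in> S then F y else 0)"
proof -
  let ?G = "\<lambda>y. if of_discrete y \<in> S then F (of_discrete y) else 0"
  \<comment> \<open>If \<open>S\<close> is empty, \<open>b\<close> may be negative.\<close>
  have "\<bar>?G y\<bar> \<le> max b 0" for y
    using assms[of "of_discrete y"] by auto
  then have "bounded (range ?G)"
    by (intro boundedI[of _ "max b 0"]) (simp only: real_norm_def, elim imageE, simp only:)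
  moreover have "continuous_on UNIV ?G"
    by (simp add: continuous_on_open_vimage open_discrete)
  ultimately have "?G \<in> bcontfun"
    by (simp add: bcontfun_def)
  then show ?thesis
    by (simp add: bfun_def Bcontfun_inverse discrete_inverse)
qed

lemma bfun_in_bfuns:
  assumes "\<And>y. y \<in> S \<Longrightarrow> \<bar>F y\<bar> \<le> b" shows "bfun S F \<in> bfuns S"
  using bfun_apply[of S F b, OF assms] by (simp add: bfuns_def)

lemma dist_bfuns_le:
  assumes "\<phi> \<in> bfuns S" "\<psi> \<in> bfuns S" "0 \<le> c"
    and "\<And>y. y \<in> S \<Longrightarrow> \<bar>apply_bcontfun \<phi> (discrete y) - apply_bcontfun \<psi> (discrete y)\<bar> \<le> c"
  shows "dist \<phi> \<psi> \<le> c"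
proof (rule dist_bound)
  fix z :: "'a discrete"
  obtain y where "z = discrete y" by (metis of_discrete_inverse)
  then show "dist (apply_bcontfun \<phi> z) (apply_bcontfun \<psi> z) \<le> c"
    using assms by (cases "y \<in> S") (auto simp: dist_real_def bfuns_def)
qed

lemma bfuns_convex:
  assumes "\<phi> \<in> bfuns S" "\<psi> \<in> bfuns S" shows "(1 - t) *\<^sub>R \<phi> + t *\<^sub>R \<psi> \<in> bfuns S"
  using assms by (simp add: bfuns_def)

text \<open>Subtracting the distance from a base point makes the function bounded even for unbounded
  \<open>X\<close>, and does not alter differences.\<close>

definition kuratowski :: "'u metric \<Rightarrow> 'u \<Rightarrow> 'u \<Rightarrow> 'u discrete \<Rightarrow>\<^sub>C real" where
  "kuratowski X x0 x = bfun (mspace X) (\<lambda>y. mdist X x y - mdist X x0 y)"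

lemma mdist_diff_le:
  assumes "x \<in> mspace X" "x' \<in> mspace X" "y \<in> mspace X"
  shows "\<bar>mdist X x y - mdist X x' y\<bar> \<le> mdist X x x'"
  using mdist_triangle[OF assms] mdist_triangle[OF assms(2,1,3)]
  by (simp add: mdist_commute abs_le_iff)

lemma kuratowski_apply:
  assumes "x \<in> mspace X" "x0 \<in> mspace X"
  shows "apply_bcontfun (kuratowski X x0 x) (discrete y) =
    (if y \<in> mspace X then mdist X x y - mdist X x0 y else 0)"
  unfolding kuratowski_def by (rule bfun_apply) (rule mdist_diff_le[OF assms])

lemma kuratowski_in:
  assumes "x \<in> mspace X" "x0 \<in> mspace X" shows "kuratowski X x0 x \<in> bfuns (mspace X)"
  unfolding kuratowski_def by (rule bfun_in_bfuns) (rule mdist_diff_le[OF assms])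

lemma dist_kuratowski:
  assumes x0: "x0 \<in> mspace X" and x: "x \<in> mspace X" "x' \<in> mspace X"
  shows "dist (kuratowski X x0 x) (kuratowski X x0 x') = mdist X x x'"
proof (rule antisym)
  show "dist (kuratowski X x0 x) (kuratowski X x0 x') \<le> mdist X x x'"
    by (rule dist_bfuns_le[OF kuratowski_in kuratowski_in])
      (use assms mdist_diff_le[OF x] in \<open>auto simp: kuratowski_apply\<close>)
  \<comment> \<open>The supremum is attained at the point \<open>x'\<close>.\<close>
  have "dist (apply_bcontfun (kuratowski X x0 x) (discrete x')) (apply_bcontfun (kuratowski X x0 x') (discrete x'))
     = mdist X x x'"
    using assms by (simp add: kuratowski_apply dist_real_def)
  then show "mdist X x x' \<le> dist (kuratowski X x0 x) (kuratowski X x0 x')"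
    by (metis dist_bounded)
qed

text \<open>McShane's extension, taken coordinatewise.\<close>

lemma short_extension:
  fixes h :: "'e \<Rightarrow> 'u discrete \<Rightarrow>\<^sub>C real"
  assumes A: "A \<subseteq> mspace E" and h: "\<And>x. x \<in> A \<Longrightarrow> h x \<in> bfuns S"
    and short: "\<And>x y. x \<in> A \<Longrightarrow> y \<in> A \<Longrightarrow> dist (h x) (h y) \<le> mdist E x y"
  obtains H where "\<And>z. z \<in> mspace E \<Longrightarrow> H z \<in> bfuns S" "\<And>x. x \<in> A \<Longrightarrow> H x = h x"
    "\<And>y z. y \<in> mspace E \<Longrightarrow> z \<in> mspace E \<Longrightarrow> dist (H y) (H z) \<le> mdist E y z"
proof (cases "A = {}")
  case True
  \<comment> \<open>The general formula is an infimum over \<open>A\<close>, so an empty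
    \<open>A\<close> is treated separately.\<close>
  have "0 \<in> bfuns S" by (simp add: bfuns_def)
  then show ?thesis using that[of "\<lambda>_. 0"] True by simp
next
  case False
  then obtain a where a: "a \<in> A" by blast
  define c where "c x y = apply_bcontfun (h x) (discrete y)" for x y
  define F where "F z y = (INF x\<in>A. c x y + mdist E x z)" for z y
  have c: "\<bar>c x y - c x' y\<bar> \<le> mdist E x x'" if "x \<in> A" "x' \<in> A" for x x' y
    using short[OF that] dist_bounded[of "h x" "discrete y" "h x'"] by (simp add: c_def dist_real_def)
  \<comment> \<open>This one inequality bounds the infimum from below, and also shows that the
    extension has the given value at the points of \<open>A\<close>.\<close>
  have lower: "c x' y - mdist E x' z \<le> c x y + mdist E x z" if "x \<in> A" "x' \<in> A" "z \<in> mspace E" for x x' y z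
    using c[OF that(1,2), of y] mdist_triangle[of x' E z x] A that by (auto simp: mdist_commute subset_iff abs_le_iff)
  have bdd: "bdd_below ((\<lambda>x. c x y + mdist E x z) ` A)" if "z \<in> mspace E" for y z
    using lower[OF _ a that, of _ y] by (intro bdd_belowI2)
  have Fle: "F z y \<le> c x y + mdist E x z" if "x \<in> A" "z \<in> mspace E" for x y z
    unfolding F_def by (rule cINF_lower[OF bdd[OF that(2)] that(1)])
  have Fge: "c x y - mdist E x z \<le> F z y" if "x \<in> A" "z \<in> mspace E" for x y z
    unfolding F_def by (rule cINF_greatest) (use False lower that in auto)
  have Flip: "F z y \<le> F z' y + mdist E z z'" if "z \<in> mspace E" "z' \<in> mspace E" for z z' y
  proof -
    have "F z y - mdist E z z' \<le> F z' y"
      unfolding F_def[of z']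
    proof (rule cINF_greatest)
      fix x assume x: "x \<in> A"
      then show "F z y - mdist E z z' \<le> c x y + mdist E x z'"
        using Fle[OF x that(1), of y] mdist_triangle[of x E z' z] A that by (auto simp: mdist_commute)
    qed (use False in auto)
    then show ?thesis by simp
  qed
  \<comment> \<open>The bound is independent of \<open>y\<close>, so for each \<open>z\<close> a
    bounded function results.\<close>
  have bd: "\<bar>F z y\<bar> \<le> norm (h a) + mdist E a z" if "z \<in> mspace E" for z y
  proof -
    have "\<bar>c a y\<bar> \<le> norm (h a)"
      using norm_bounded[of "h a" "discrete y"] by (simp add: c_def)
    then show ?thesis using Fle[OF a that, of y] Fge[OF a that, of y] by linarith
  qed
  define H where "H z = bfun S (F z)" for z
  have Happ: "apply_bcontfun (H z) (discrete y) = (if y \<in> S then F z y else 0)" if "z \<in> mspace E" for z y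
    unfolding H_def by (rule bfun_apply[OF bd[OF that]])
  have Hin: "H z \<in> bfuns S" if "z \<in> mspace E" for z
    unfolding H_def by (rule bfun_in_bfuns[OF bd[OF that]])
  show ?thesis
  proof
    show "H z \<in> bfuns S" if "z \<in> mspace E" for z using Hin[OF that] .
    show "H x = h x" if x: "x \<in> A" for x
    proof (rule bcontfun_eqI)
      fix z :: "'u discrete"
      obtain y where y: "z = discrete y" by (metis of_discrete_inverse)
      have xE: "x \<in> mspace E" using x A by blast
      have "F x y = c x y"
        using Fle[OF x xE, of y] Fge[OF x xE, of y] xE by simp
      then show "apply_bcontfun (H x) z = apply_bcontfun (h x) z"
        using h[OF x] Happ[OF xE] y by (auto simp: c_def bfuns_def)
    qed
    show "dist (H y) (H z) \<le> mdist E y z" if "y \<in> mspace E" "z \<in> mspace E" for y z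
    proof (rule dist_bfuns_le[OF Hin[OF that(1)] Hin[OF that(2)] mdist_nonneg])
      fix u assume "u \<in> S"
      then show "\<bar>apply_bcontfun (H y) (discrete u) - apply_bcontfun (H z) (discrete u)\<bar> \<le> mdist E y z"
        using Flip[OF that, of u] Flip[OF that(2,1), of u] that by (simp add: Happ mdist_commute abs_le_iff)
    qed
  qed
qed

section \<open>Centres of simplices\<close>

text \<open>On the part of a simplex where the vertex \<open>x\<close> has a barycentric coordinate that is not small
  compared to the others, \<open>centre\<close> will take values in the ball of radius \<open>r\<close> about \<open>x\<close>.  The sum of
  squares serves as a substitute for the maximum of the coordinates, and \<open>weight\<close> cuts off the small
  ones.  For a simplex all of whose weights are 1, the centre is the function
  \<open>max\<^sub>x d(x,\<cdot>) - diam/2\<close>; a vertex of weight 0 does not contribute to the maximum, which makes the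
  definition compatible with faces.\<close>

definition sum_squares :: "('u \<Rightarrow> real) \<Rightarrow> real" where
  "sum_squares a = (\<Sum>x | a x \<noteq> 0. (a x)\<^sup>2)"

definition weight :: "('u \<Rightarrow> real) \<Rightarrow> 'u \<Rightarrow> real" where
  "weight a x = min 1 (4 * a x / sum_squares a)"

definition weighted_diam :: "'u metric \<Rightarrow> 'u set \<Rightarrow> ('u \<Rightarrow> real) \<Rightarrow> real" where
  "weighted_diam X \<sigma> a = (MAX p\<in>\<sigma> \<times> \<sigma>. mdist X (fst p) (snd p) * weight a (fst p) * weight a (snd p))"

definition centre_fun :: "'u metric \<Rightarrow> real \<Rightarrow> 'u \<Rightarrow> 'u set \<Rightarrow> ('u \<Rightarrow> real) \<Rightarrow> 'u \<Rightarrow> real" where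
  "centre_fun X r x0 \<sigma> a y = (MAX x\<in>\<sigma>. mdist X x y - mdist X x0 y - 2 * r * (1 - weight a x))
     - weighted_diam X \<sigma> a / 2"

definition centre :: "'u metric \<Rightarrow> real \<Rightarrow> 'u \<Rightarrow> ('u \<Rightarrow> real) \<Rightarrow> 'u discrete \<Rightarrow>\<^sub>C real" where
  "centre X r x0 a = bfun (mspace X) (centre_fun X r x0 {x. a x \<noteq> 0} a)"

text \<open>Vertices with coordinate at most half of the sum of squares are dropped; the other
  coordinates are shifted down and normalized. All survivors have weight 1, and the gap between 1/4
  and 1/2 leaves room for passing to nearby points.\<close>

definition sharpen :: "('u \<Rightarrow> real) \<Rightarrow> 'u \<Rightarrow> real" where
  "sharpen a x = max 0 (a x - sum_squares a / 2) / (\<Sum>x | a x \<noteq> 0. max 0 (a x - sum_squares a / 2))"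

lemma abs_Max_diff_le:
  fixes f g :: "'a \<Rightarrow> real"
  assumes "finite A" "A \<noteq> {}"
  shows "\<bar>Max (f ` A) - Max (g ` A)\<bar> \<le> (\<Sum>x\<in>A. \<bar>f x - g x\<bar>)"
proof -
  have *: "Max (f ` A) \<le> Max (g ` A) + (\<Sum>x\<in>A. \<bar>f x - g x\<bar>)" for f g :: "'a \<Rightarrow> real"
  proof (rule Max.boundedI)
    fix y assume "y \<in> f ` A"
    then obtain x where x: "x \<in> A" "y = f x" by blast
    have "\<bar>f x - g x\<bar> \<le> (\<Sum>x\<in>A. \<bar>f x - g x\<bar>)"
      using member_le_sum[of x A "\<lambda>x. \<bar>f x - g x\<bar>"] x assms by simp
    moreover have "g x \<le> Max (g ` A)" using x assms by simp
    ultimately show "y \<le> Max (g ` A) + (\<Sum>x\<in>A. \<bar>f x - g x\<bar>)" using x by linarith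
  qed (use assms in auto)
  show ?thesis
    using *[of f g] *[of g f] by (simp add: abs_le_iff abs_minus_commute)
qed

section \<open>Coordinates, weights and centres over a fixed simplex\<close>

context
  fixes a :: "'u \<Rightarrow> real" and \<sigma> :: "'u set"
  assumes fin: "finite \<sigma>" and a: "a \<in> closed_simplex \<sigma>"
begin

lemma support: "{x. a x \<noteq> 0} \<subseteq> \<sigma>" "finite {x. a x \<noteq> 0}" "0 \<le> a x" "{x. a x \<noteq> 0} \<noteq> {}"
proof -
  show *: "{x. a x \<noteq> 0} \<subseteq> \<sigma>" and "0 \<le> a x" using a by (auto simp: closed_simplex_def)
  then show "finite {x. a x \<noteq> 0}" using fin finite_subset by blast
  show "{x. a x \<noteq> 0} \<noteq> {}"
  proof
    assume "{x. a x \<noteq> 0} = {}"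
    then have "sum a \<sigma> = 0" by (intro sum.neutral) auto
    then show False using a by (simp add: closed_simplex_def)
  qed
qed

lemma sum_support: "(\<And>x. a x = 0 \<Longrightarrow> F x = 0) \<Longrightarrow> (\<Sum>x | a x \<noteq> 0. F x) = (\<Sum>x\<in>\<sigma>. F x :: real)"
  by (rule sum.mono_neutral_left) (use fin support(1) in auto)

lemma sum_squares_eq: "sum_squares a = (\<Sum>x\<in>\<sigma>. (a x)\<^sup>2)"
  unfolding sum_squares_def by (rule sum_support) simp

lemma sum_squares_pos: "0 < sum_squares a"
  unfolding sum_squares_def using support by (intro sum_pos) auto

text \<open>As the coordinates sum to 1, the sum of squares is their mean with the coordinates
  themselves as weights, and cannot exceed all of them.\<close>

lemma vertex_ge_sum_squares: "\<exists>x\<in>\<sigma>. sum_squares a \<le> a x"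
proof (rule ccontr)
  assume "\<not> ?thesis"
  then have *: "a x < sum_squares a" if "x \<in> \<sigma>" for x using that by force
  have "(\<Sum>x | a x \<noteq> 0. (a x)\<^sup>2) < (\<Sum>x | a x \<noteq> 0. a x * sum_squares a)"
  proof (rule sum_strict_mono)
    fix x assume "x \<in> {x. a x \<noteq> 0}"
    then show "(a x)\<^sup>2 < a x * sum_squares a"
      using *[of x] support(1) support(3)[of x] by (auto simp: power2_eq_square less_le)
  qed (use support in auto)
  also have "\<dots> = (\<Sum>x\<in>\<sigma>. a x * sum_squares a)" by (rule sum_support) simp
  also have "\<dots> = sum_squares a"
    using a by (simp add: closed_simplex_def flip: sum_distrib_right)
  finally show False by (simp add: sum_squares_def)
qed

lemma weight_bounds: "0 \<le> weight a x" "weight a x \<le> 1"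
  using support(3) sum_squares_pos by (auto simp: weight_def)

lemma weight_eq_1: "sum_squares a / 4 \<le> a x \<Longrightarrow> weight a x = 1"
  using sum_squares_pos by (simp add: weight_def min_def field_simps)

lemma weight_eq_0: "a x = 0 \<Longrightarrow> weight a x = 0"
  by (simp add: weight_def)

lemma sharpen_sum_pos: "0 < (\<Sum>x\<in>\<sigma>. max 0 (a x - sum_squares a / 2))"
proof -
  obtain x where x: "x \<in> \<sigma>" "sum_squares a \<le> a x" using vertex_ge_sum_squares by blast
  then have "0 < max 0 (a x - sum_squares a / 2)" using sum_squares_pos by auto
  then show ?thesis using fin x(1) by (intro sum_pos2[of _ x]) auto
qed

lemma sharpen_eq: "sharpen a x =
    max 0 (a x - sum_squares a / 2) / (\<Sum>x\<in>\<sigma>. max 0 (a x - sum_squares a / 2))"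
proof -
  have "(\<Sum>x | a x \<noteq> 0. max 0 (a x - sum_squares a / 2)) = (\<Sum>x\<in>\<sigma>. max 0 (a x - sum_squares a / 2))"
    by (rule sum_support) (use sum_squares_pos in auto)
  then show ?thesis by (simp add: sharpen_def)
qed

lemma sharpen_in:
  assumes "\<tau> \<subseteq> \<sigma>" "\<And>x. sum_squares a / 2 < a x \<Longrightarrow> x \<in> \<tau>"
  shows "sharpen a \<in> closed_simplex \<tau>"
proof -
  have nn: "0 \<le> sharpen a x" for x
    using sharpen_sum_pos by (simp add: sharpen_eq)
  have z: "sharpen a x = 0" if "x \<notin> \<tau>" for x
  proof -
    have "max 0 (a x - sum_squares a / 2) = 0"
      using assms(2)[of x] that by linarith
    then show ?thesis by (simp add: sharpen_eq)
  qed
  have "(\<Sum>x\<in>\<sigma>. sharpen a x) = 1"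
    using sharpen_sum_pos by (simp add: sharpen_eq flip: sum_divide_distrib)
  moreover have "(\<Sum>x\<in>\<tau>. sharpen a x) = (\<Sum>x\<in>\<sigma>. sharpen a x)"
    by (rule sum.mono_neutral_left) (use fin assms z in auto)
  ultimately show ?thesis using nn z by (auto simp: closed_simplex_def)
qed

context
  fixes X :: "'u metric" and r :: real
  assumes VR: "\<sigma> \<in> VR (2 * r) X"
begin

lemma dist_lt: "x \<in> \<sigma> \<Longrightarrow> x' \<in> \<sigma> \<Longrightarrow> mdist X x x' < 2 * r"
  and in_space: "x \<in> \<sigma> \<Longrightarrow> x \<in> mspace X"
  using VR by (auto simp: VR_iff)

lemma weighted_diam_ge:
  assumes "x \<in> \<sigma>" "x' \<in> \<sigma>" shows "mdist X x x' * weight a x * weight a x' \<le> weighted_diam X \<sigma> a"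
  unfolding weighted_diam_def
  by (rule Max_ge) (use fin assms in \<open>auto intro!: image_eqI[of _ _ "(x,x')"]\<close>)

lemma weighted_diam_le:
  assumes "\<And>x x'. x \<in> \<sigma> \<Longrightarrow> x' \<in> \<sigma> \<Longrightarrow> mdist X x x' * weight a x * weight a x' \<le> c"
  shows "weighted_diam X \<sigma> a \<le> c"
  unfolding weighted_diam_def
  by (rule Max.boundedI) (use fin VR assms in \<open>auto simp: VR_iff\<close>)

lemma weighted_diam_nonneg: "0 \<le> weighted_diam X \<sigma> a"
proof -
  obtain x where x: "x \<in> \<sigma>" using VR by (auto simp: VR_iff)
  from weighted_diam_ge[OF x x] in_space[OF x] show ?thesis by simp
qed

lemma weighted_diam_less: "weighted_diam X \<sigma> a < 2 * r"
  unfolding weighted_diam_def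
proof (subst Max_less_iff)
  have "mdist X x x' * weight a x * weight a x' < 2 * r" if "x \<in> \<sigma>" "x' \<in> \<sigma>" for x x'
  proof -
    have "mdist X x x' * weight a x * weight a x' \<le> mdist X x x' * 1 * 1"
      by (intro mult_mono) (use weight_bounds in auto)
    then show ?thesis using dist_lt[OF that] by simp
  qed
  then show "\<forall>d\<in>(\<lambda>p. mdist X (fst p) (snd p) * weight a (fst p) * weight a (snd p)) ` (\<sigma> \<times> \<sigma>). d < 2 * r"
    by auto
qed (use fin VR in \<open>auto simp: VR_iff\<close>)

text \<open>The term of \<open>x\<close> in the maximum carries no penalty. For any vertex
  \<open>x'\<close>, split the distance to \<open>x\<close> into parts with factors
  \<open>1 - weight a x'\<close> and \<open>weight a x'\<close>: the first is absorbed by the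
  penalty \<open>2 * r * (1 - weight a x')\<close>, the second is at most
  \<open>weighted_diam\<close>. So the maximum exceeds the term of \<open>x\<close> by at most
  \<open>weighted_diam\<close>, and subtracting half of that makes the error symmetric.\<close>

lemma centre_fun_close:
  assumes x: "x \<in> \<sigma>" "weight a x = 1" and y: "y \<in> mspace X"
  shows "\<bar>centre_fun X r x0 \<sigma> a y - (mdist X x y - mdist X x0 y)\<bar> \<le> weighted_diam X \<sigma> a / 2"
proof -
  let ?t = "\<lambda>x. mdist X x y - mdist X x0 y - 2 * r * (1 - weight a x)"
  have "?t x \<le> Max (?t ` \<sigma>)" by (rule Max_ge[OF finite_imageI[OF fin] imageI[OF x(1), of ?t]])
  moreover have "Max (?t ` \<sigma>) \<le> mdist X x y - mdist X x0 y + weighted_diam X \<sigma> a"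
  proof (rule Max.boundedI)
    fix b assume "b \<in> ?t ` \<sigma>"
    then obtain x' where x': "x' \<in> \<sigma>" "b = ?t x'" by blast
    have "mdist X x' y - mdist X x y \<le> mdist X x' x"
      using mdist_diff_le[OF in_space[OF x'(1)] in_space[OF x(1)] y] by simp
    moreover have "mdist X x' x * (1 - weight a x') \<le> 2 * r * (1 - weight a x')"
      using dist_lt[OF x'(1) x(1)] weight_bounds(2)[of x'] by (intro mult_right_mono) auto
    moreover have "mdist X x' x * weight a x' \<le> weighted_diam X \<sigma> a"
      using weighted_diam_ge[OF x'(1) x(1)] x(2) by simp
    ultimately show "b \<le> mdist X x y - mdist X x0 y + weighted_diam X \<sigma> a"
      using x'(2) by (simp add: algebra_simps)
  qed (use fin x in auto)
  ultimately show ?thesis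
    using x(2) unfolding centre_fun_def abs_le_iff by (simp add: field_simps)
qed

lemma centre_fun_bounded:
  assumes "x0 \<in> mspace X"
  shows "\<exists>b. \<forall>y\<in>mspace X. \<bar>centre_fun X r x0 \<sigma> a y\<bar> \<le> b"
proof -
  obtain x where x: "x \<in> \<sigma>" "sum_squares a \<le> a x" using vertex_ge_sum_squares by blast
  then have w: "weight a x = 1" using sum_squares_pos by (intro weight_eq_1) auto
  have "\<bar>centre_fun X r x0 \<sigma> a y\<bar> \<le> weighted_diam X \<sigma> a / 2 + mdist X x x0" if "y \<in> mspace X" for y
    using centre_fun_close[OF x(1) w that, of x0] mdist_diff_le[OF in_space[OF x(1)] assms that] by linarith
  then show ?thesis by blast
qed

end

end

text \<open>Continuity has to be shown with a fixed \<open>\<sigma>\<close>, while the support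
  shrinks on faces. The additional vertices have weight 0: in the maximum their penalty
  \<open>2 * r\<close> puts them below a vertex of weight 1, and in \<open>weighted_diam\<close>
  they contribute 0.\<close>

lemma centre_fun_support:
  assumes \<sigma>: "\<sigma> \<in> VR (2 * r) X" and a: "a \<in> closed_simplex \<sigma>" and y: "y \<in> mspace X"
  shows "centre_fun X r x0 {x. a x \<noteq> 0} a y = centre_fun X r x0 \<sigma> a y"
proof -
  let ?S = "{x. a x \<noteq> 0}"
  have fin: "finite \<sigma>" using \<sigma> by (simp add: VR_iff)
  note supp = support[OF fin a]
  have aS: "a \<in> closed_simplex ?S"
  proof -
    have "sum a ?S = sum a \<sigma>"
      by (rule sum.mono_neutral_left) (use fin supp(1) in auto)
    then show ?thesis using a supp(3) by (auto simp: closed_simplex_def)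
  qed
  have S: "?S \<in> VR (2 * r) X"
    using \<sigma> supp unfolding VR_iff by blast
  let ?t = "\<lambda>x. mdist X x y - mdist X x0 y - 2 * r * (1 - weight a x)"
  obtain z where z: "z \<in> ?S" "sum_squares a \<le> a z"
    using vertex_ge_sum_squares[OF supp(2) aS] by blast
  have wz: "weight a z = 1"
    using z sum_squares_pos[OF fin a] by (intro weight_eq_1[OF fin a]) auto
  have "Max (?t ` ?S) = Max (?t ` \<sigma>)"
  proof (rule antisym)
    show "Max (?t ` ?S) \<le> Max (?t ` \<sigma>)"
      by (rule Max_mono) (use supp fin in auto)
    show "Max (?t ` \<sigma>) \<le> Max (?t ` ?S)"
    proof (rule Max.boundedI)
      fix b assume "b \<in> ?t ` \<sigma>"
      then obtain x where x: "x \<in> \<sigma>" "b = ?t x" by blast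
      show "b \<le> Max (?t ` ?S)"
      proof (cases "a x = 0")
        case False
        then show ?thesis using x supp by auto
      next
        case True
        have z\<sigma>: "z \<in> \<sigma>" using z supp(1) by blast
        have "mdist X x y - mdist X z y \<le> mdist X x z"
          using mdist_diff_le[OF in_space[OF fin a \<sigma> x(1)] in_space[OF fin a \<sigma> z\<sigma>] y] by simp
        then have "?t x \<le> ?t z"
          using dist_lt[OF fin a \<sigma> x(1) z\<sigma>] weight_eq_0[OF fin a True] wz by simp
        also have "\<dots> \<le> Max (?t ` ?S)" using z supp by simp
        finally show ?thesis using x by simp
      qed
    qed (use fin \<sigma> in \<open>auto simp: VR_iff\<close>)
  qed
  moreover have "weighted_diam X ?S a = weighted_diam X \<sigma> a"
  proof (rule antisym)
    show "weighted_diam X ?S a \<le> weighted_diam X \<sigma> a"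
      by (rule weighted_diam_le[OF supp(2) aS S]) (use supp(1) in \<open>auto intro!: weighted_diam_ge[OF fin a \<sigma>]\<close>)
    show "weighted_diam X \<sigma> a \<le> weighted_diam X ?S a"
    proof (rule weighted_diam_le[OF fin a \<sigma>])
      fix x x' assume "x \<in> \<sigma>" "x' \<in> \<sigma>"
      show "mdist X x x' * weight a x * weight a x' \<le> weighted_diam X ?S a"
      proof (cases "a x = 0 \<or> a x' = 0")
        case True
        then have "mdist X x x' * weight a x * weight a x' = 0"
          using weight_eq_0[OF fin a] by auto
        then show ?thesis using weighted_diam_nonneg[OF supp(2) aS S] by (simp only:)
      next
        case False
        then show ?thesis by (intro weighted_diam_ge[OF supp(2) aS S]) auto
      qed
    qed
  qed
  ultimately show ?thesis by (simp add: centre_fun_def)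
qed


section \<open>Continuity in the barycentric coordinates\<close>

lemma continuous_on_sum_squares:
  assumes "finite \<sigma>" shows "continuous_on (closed_simplex \<sigma>) sum_squares"
  by (rule continuous_on_eq[where f = "\<lambda>a. \<Sum>x\<in>\<sigma>. (a x)\<^sup>2"])
    (auto intro!: continuous_intros continuous_on_coordinate simp: sum_squares_eq[OF assms])

lemma continuous_on_weight:
  assumes "finite \<sigma>" shows "continuous_on (closed_simplex \<sigma>) (\<lambda>a. weight a x)"
  unfolding weight_def
  by (intro continuous_intros continuous_on_coordinate continuous_on_sum_squares assms)
    (use sum_squares_pos[OF assms] in force)

lemma continuous_on_sharpen:
  assumes "finite \<sigma>" shows "continuous_on (closed_simplex \<sigma>) (\<lambda>a. sharpen a x)"
proof (rule continuous_on_eq)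
  show "continuous_on (closed_simplex \<sigma>) (\<lambda>a. max 0 (a x - sum_squares a / 2) /
      (\<Sum>x\<in>\<sigma>. max 0 (a x - sum_squares a / 2)))"
    by (intro continuous_intros continuous_on_coordinate continuous_on_sum_squares assms)
      (use sharpen_sum_pos[OF assms] in force)+
qed (simp add: sharpen_eq[OF assms])

context
  fixes X :: "'u metric" and r :: real and x0 :: 'u
  assumes x0: "x0 \<in> mspace X"
begin

lemma centre_apply:
  assumes \<sigma>: "\<sigma> \<in> VR (2 * r) X" and a: "a \<in> closed_simplex \<sigma>"
  shows "apply_bcontfun (centre X r x0 a) (discrete y) = (if y \<in> mspace X then centre_fun X r x0 \<sigma> a y else 0)"
    and "centre X r x0 a \<in> bfuns (mspace X)"
proof -
  have fin: "finite \<sigma>" using \<sigma> by (simp add: VR_iff)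
  obtain b where b: "\<And>y. y \<in> mspace X \<Longrightarrow> \<bar>centre_fun X r x0 \<sigma> a y\<bar> \<le> b"
    using centre_fun_bounded[OF fin a \<sigma> x0] by blast
  then have b': "\<bar>centre_fun X r x0 {x. a x \<noteq> 0} a y\<bar> \<le> b" if "y \<in> mspace X" for y
    using that by (simp add: centre_fun_support[OF \<sigma> a])
  show "apply_bcontfun (centre X r x0 a) (discrete y) = (if y \<in> mspace X then centre_fun X r x0 \<sigma> a y else 0)"
    unfolding centre_def using bfun_apply[of "mspace X" "centre_fun X r x0 {x. a x \<noteq> 0} a" b y, OF b']
    by (simp add: centre_fun_support[OF \<sigma> a])
  show "centre X r x0 a \<in> bfuns (mspace X)"
    unfolding centre_def by (rule bfun_in_bfuns[OF b'])
qed

text \<open>A coordinate of at least a quarter of the sum of squares has weight 1, so the distance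
  is at most half of the weighted diameter, which is strictly less than \<open>r\<close>.\<close>

lemma dist_centre_kuratowski:
  assumes \<sigma>: "\<sigma> \<in> VR (2 * r) X" and a: "a \<in> closed_simplex \<sigma>"
    and x: "sum_squares a / 4 \<le> a x"
  shows "x \<in> \<sigma>" "dist (centre X r x0 a) (kuratowski X x0 x) < r"
proof -
  have fin: "finite \<sigma>" using \<sigma> by (simp add: VR_iff)
  show x\<sigma>: "x \<in> \<sigma>"
    using x sum_squares_pos[OF fin a] support(1)[OF fin a] by force
  then have xX: "x \<in> mspace X" using \<sigma> by (auto simp: VR_iff)
  have "dist (centre X r x0 a) (kuratowski X x0 x) \<le> weighted_diam X \<sigma> a / 2"
  proof (rule dist_bfuns_le[OF centre_apply(2)[OF \<sigma> a] kuratowski_in[OF xX x0]])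
    fix y assume y: "y \<in> mspace X"
    show "\<bar>apply_bcontfun (centre X r x0 a) (discrete y) - apply_bcontfun (kuratowski X x0 x) (discrete y)\<bar>
        \<le> weighted_diam X \<sigma> a / 2"
      using centre_fun_close[OF fin a \<sigma> x\<sigma> weight_eq_1[OF fin a x] y, of x0] y
      by (simp add: centre_apply(1)[OF \<sigma> a] kuratowski_apply[OF xX x0])
  qed (use weighted_diam_nonneg[OF fin a \<sigma>] in simp)
  then show "dist (centre X r x0 a) (kuratowski X x0 x) < r"
    using weighted_diam_less[OF fin a \<sigma>] by simp
qed

lemma continuous_on_centre:
  assumes \<sigma>: "\<sigma> \<in> VR (2 * r) X" shows "continuous_on (closed_simplex \<sigma>) (centre X r x0)"
  unfolding continuous_on_def
proof
  fix b assume b: "b \<in> closed_simplex \<sigma>"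
  have fin: "finite \<sigma>" "\<sigma> \<noteq> {}" using \<sigma> by (auto simp: VR_iff)
  \<comment> \<open>A bound for the distance of the centres that does not depend on the point
    \<open>y\<close> at which they are evaluated; the distance is a supremum over all
    \<open>y\<close>, so continuity for each \<open>y\<close> alone would not do.\<close>
  define c where "c a = (\<Sum>x\<in>\<sigma>. \<bar>2 * r * (weight a x - weight b x)\<bar>) +
     (\<Sum>p\<in>\<sigma> \<times> \<sigma>. \<bar>mdist X (fst p) (snd p) * weight a (fst p) * weight a (snd p) -
        mdist X (fst p) (snd p) * weight b (fst p) * weight b (snd p)\<bar>) / 2" for a
  have w: "((\<lambda>a. weight a x) \<longlongrightarrow> weight b x) (at b within closed_simplex \<sigma>)" for x
    using continuous_on_weight[OF fin(1), of x] b by (simp add: continuous_on_def)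
  have "(c \<longlongrightarrow> (\<Sum>x\<in>\<sigma>. \<bar>2 * r * (weight b x - weight b x)\<bar>) +
     (\<Sum>p\<in>\<sigma> \<times> \<sigma>. \<bar>mdist X (fst p) (snd p) * weight b (fst p) * weight b (snd p) -
        mdist X (fst p) (snd p) * weight b (fst p) * weight b (snd p)\<bar>) / 2) (at b within closed_simplex \<sigma>)"
    unfolding c_def by (intro tendsto_intros w) simp
  then have c0: "(c \<longlongrightarrow> 0) (at b within closed_simplex \<sigma>)" by simp
  have dist_c: "dist (centre X r x0 a) (centre X r x0 b) \<le> c a" if a: "a \<in> closed_simplex \<sigma>" for a
  proof (rule dist_bfuns_le[OF centre_apply(2)[OF \<sigma> a] centre_apply(2)[OF \<sigma> b]])
    show "0 \<le> c a"
      unfolding c_def by (intro add_nonneg_nonneg divide_nonneg_nonneg sum_nonneg) auto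
    fix y assume y: "y \<in> mspace X"
    let ?t = "\<lambda>a x. mdist X x y - mdist X x0 y - 2 * r * (1 - weight a x)"
    have "\<bar>Max (?t a ` \<sigma>) - Max (?t b ` \<sigma>)\<bar> \<le> (\<Sum>x\<in>\<sigma>. \<bar>?t a x - ?t b x\<bar>)"
      by (rule abs_Max_diff_le[OF fin])
    also have "\<dots> = (\<Sum>x\<in>\<sigma>. \<bar>2 * r * (weight a x - weight b x)\<bar>)"
      by (intro sum.cong refl arg_cong[where f = abs]) (simp add: algebra_simps)
    finally have 1: "\<bar>Max (?t a ` \<sigma>) - Max (?t b ` \<sigma>)\<bar> \<le> (\<Sum>x\<in>\<sigma>. \<bar>2 * r * (weight a x - weight b x)\<bar>)" .
    have 2: "\<bar>weighted_diam X \<sigma> a - weighted_diam X \<sigma> b\<bar> \<le>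
      (\<Sum>p\<in>\<sigma> \<times> \<sigma>. \<bar>mdist X (fst p) (snd p) * weight a (fst p) * weight a (snd p) -
        mdist X (fst p) (snd p) * weight b (fst p) * weight b (snd p)\<bar>)"
      unfolding weighted_diam_def by (rule abs_Max_diff_le) (use fin in auto)
    have "\<bar>centre_fun X r x0 \<sigma> a y - centre_fun X r x0 \<sigma> b y\<bar> \<le> c a"
      using 1 2 unfolding centre_fun_def c_def by linarith
    then show "\<bar>apply_bcontfun (centre X r x0 a) (discrete y) - apply_bcontfun (centre X r x0 b) (discrete y)\<bar> \<le> c a"
      using y by (simp add: centre_apply(1)[OF \<sigma> a] centre_apply(1)[OF \<sigma> b])
  qed
  show "(centre X r x0 \<longlongrightarrow> centre X r x0 b) (at b within closed_simplex \<sigma>)"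
  proof (subst tendsto_dist_iff, rule tendsto_sandwich[OF _ _ tendsto_const c0])
    show "\<forall>\<^sub>F a in at b within closed_simplex \<sigma>. dist (centre X r x0 a) (centre X r x0 b) \<le> c a"
      using dist_c by (auto simp: eventually_at_filter)
  qed simp
qed

end

text \<open>Both maps preserve every closed simplex, so straight segments join them.\<close>

lemma homotopic_sharpen_id: "homotopic (realization (VR r X)) (realization (VR r X)) sharpen id"
proof (rule carried_homotopic_realization)
  fix \<sigma> assume \<sigma>: "\<sigma> \<in> VR r X"
  then have fin: "finite \<sigma>" by (simp add: VR_iff)
  have "sharpen ` closed_simplex \<sigma> \<subseteq> closed_simplex \<sigma>"
  proof safe
    fix a :: "'a \<Rightarrow> real" assume a: "a \<in> closed_simplex \<sigma>"
    show "sharpen a \<in> closed_simplex \<sigma>"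
      by (rule sharpen_in[OF fin a order_refl]) (use support(1)[OF fin a] sum_squares_pos[OF fin a] in force)
  qed
  then show "carried (top_of_set (closed_simplex \<sigma>)) (VR r X) sharpen id"
    using \<sigma> unfolding carried_def by (intro ballI exI[of _ "closed_simplex \<sigma>"] exI[of _ \<sigma>]) simp
  show "continuous_on (closed_simplex \<sigma>) (\<lambda>a. sharpen a v)" for v
    by (rule continuous_on_sharpen[OF fin])
  show "continuous_on (closed_simplex \<sigma>) (\<lambda>a. id a v)" for v
    by (simp add: continuous_on_coordinate)
qed

lemma continuous_map_scaleR:
  fixes g :: "'a \<Rightarrow> 'b::real_normed_vector"
  shows "\<lbrakk>continuous_map X euclideanreal f; continuous_map X euclidean g\<rbrakk>
    \<Longrightarrow> continuous_map X euclidean (\<lambda>x. f x *\<^sub>R g x)"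
  by (simp add: continuous_map_atin tendsto_scaleR)

section \<open>Neighbourhoods in hyperconvex pairs\<close>

text \<open>Up to homotopy, the pair \<open>P\<close> is a retract of a pair \<open>(X, B)\<close>, where \<open>B\<close> is the space of bounded
  functions.\<close>

definition bfun_retract :: "'u metric \<times> 'u metric \<Rightarrow> 'u metric \<Rightarrow> ('u \<Rightarrow> 'u) \<Rightarrow> 'u \<Rightarrow>
    (('u discrete \<Rightarrow>\<^sub>C real) \<Rightarrow> 'u) \<Rightarrow> ('u \<Rightarrow> ('u discrete \<Rightarrow>\<^sub>C real)) \<Rightarrow> bool" where
  "bfun_retract P X s x0 \<Theta> \<Theta>' \<longleftrightarrow> marking P X s \<and> (mspace X \<noteq> {} \<longrightarrow> x0 \<in> mspace X) \<and>
     short_map (submetric euclidean_metric (bfuns (mspace X))) (snd P) \<Theta> \<and>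
     short_map (snd P) (submetric euclidean_metric (bfuns (mspace X))) \<Theta>' \<and>
     (\<forall>x\<in>mspace X. \<Theta> (kuratowski X x0 x) = s x \<and> \<Theta>' (s x) = kuratowski X x0 x) \<and>
     pair_homotopic P P (\<Theta> \<circ> \<Theta>') id"

text \<open>The inverse is \<open>\<Theta>\<close> applied to centres. One composite is compared
  with \<open>sharpen\<close>; for the other, the straight path from \<open>c (p z)\<close> to
  \<open>\<Theta>' z\<close> is pushed forward by \<open>\<Theta>\<close> and ends at
  \<open>\<Theta> \<circ> \<Theta>'\<close>.\<close>

lemma bfun_retract_equivalence:
  assumes R: "bfun_retract P X s x0 \<Theta> \<Theta>'" and p: "nerve_map P X s r p"
  shows "\<exists>n. continuous_map (realization (VR (2 * r) X)) (nbhd_space r P) n \<and>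
    homotopic (nbhd_space r P) (nbhd_space r P) (n \<circ> p) id \<and>
    homotopic (realization (VR (2 * r) X)) (realization (VR (2 * r) X)) (p \<circ> n) id"
proof (cases "mspace X = {}")
  \<comment> \<open>Without points there is no base point, and both spaces are empty.\<close>
  case True
  have m: "marking P X s" using R by (simp add: bfun_retract_def)
  have "topspace (realization (VR (2 * r) X)) = {}"
    using True by (auto simp: topspace_realization VR_iff)
  then have 1: "realization (VR (2 * r) X) = trivial_topology"
    by (simp only: null_topspace_iff_trivial)
  have "topspace (nbhd_space r P) = {}"
    using True by (simp only: topspace_nbhd_space nbhd_marking[OF m]) (simp add: close_points_def)
  then have 2: "nbhd_space r P = trivial_topology"
    by (simp only: null_topspace_iff_trivial)
  show ?thesis
    unfolding 1 2 homotopic_on_empty by simp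
next
  case False
  let ?L = "submetric euclidean_metric (bfuns (mspace X))" and ?K = "VR (2 * r) X"
  have m: "marking P X s" and x0: "x0 \<in> mspace X" and \<Theta>: "short_map ?L (snd P) \<Theta>"
    and \<Theta>': "short_map (snd P) ?L \<Theta>'"
    and \<Theta>k: "\<And>x. x \<in> mspace X \<Longrightarrow> \<Theta> (kuratowski X x0 x) = s x"
    and \<Theta>s: "\<And>x. x \<in> mspace X \<Longrightarrow> \<Theta>' (s x) = kuratowski X x0 x"
    and ret: "pair_homotopic P P (\<Theta> \<circ> \<Theta>') id"
    using R False by (auto simp: bfun_retract_def)
  have P: "metric_pair P" using m by (simp add: marking_def)
  have Ltop: "mtopology_of ?L = top_of_set (bfuns (mspace X))"
    by (simp add: mtopology_of_submetric)
  define c where "c = centre X r x0"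
  define n where "n = \<Theta> \<circ> c"

  have \<Theta>_close: "mdist (snd P) (\<Theta> \<phi>) (s x) < r"
    if "\<phi> \<in> bfuns (mspace X)" "x \<in> mspace X" "dist \<phi> (kuratowski X x0 x) < r" for \<phi> x
  proof -
    have "mdist (snd P) (\<Theta> \<phi>) (\<Theta> (kuratowski X x0 x)) \<le> dist \<phi> (kuratowski X x0 x)"
      using short_mapD(2)[OF \<Theta>, of \<phi> "kuratowski X x0 x"] that kuratowski_in[OF that(2) x0] by simp
    with that show ?thesis by (simp add: \<Theta>k)
  qed
  have \<Theta>_nbhd: "\<Theta> \<phi> \<in> nbhd r P"
    if "\<phi> \<in> bfuns (mspace X)" "x \<in> mspace X" "dist \<phi> (kuratowski X x0 x) < r" for \<phi> x
    using \<Theta>_close[OF that] short_mapD(1)[OF \<Theta>, of \<phi>] that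
    by (auto simp: nbhd_marking[OF m] close_points_def)
  have c_in: "c a \<in> bfuns (mspace X)" if "a \<in> topspace (realization ?K)" for a
    using that centre_apply(2)[OF x0] by (auto simp: c_def topspace_realization)
  have c_cont: "continuous_map (realization ?K) (mtopology_of ?L) c"
    using c_in continuous_on_centre[OF x0]
    by (auto simp: Ltop continuous_map_in_subtopology continuous_map_from_realization c_def topspace_realization)
  have n_close: "x \<in> \<sigma>" "x \<in> mspace X" "mdist (snd P) (n a) (s x) < r" "n a \<in> nbhd r P"
    if "\<sigma> \<in> ?K" "a \<in> closed_simplex \<sigma>" "sum_squares a / 4 \<le> a x" for a \<sigma> x
  proof -
    note dc = dist_centre_kuratowski[OF x0 that]
    show "x \<in> \<sigma>" using dc by simp
    then show x: "x \<in> mspace X" using that by (auto simp: VR_iff)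
    have "c a \<in> bfuns (mspace X)"
      using centre_apply(2)[OF x0 that(1,2)] by (simp add: c_def)
    with \<Theta>_close[of "c a" x] \<Theta>_nbhd[of "c a" x] dc x
    show "mdist (snd P) (n a) (s x) < r" "n a \<in> nbhd r P"
      by (auto simp: n_def c_def)
  qed
  have n_in: "n a \<in> nbhd r P" if aK: "a \<in> topspace (realization ?K)" for a
  proof -
    obtain \<sigma> where \<sigma>: "\<sigma> \<in> ?K" "finite \<sigma>" "a \<in> closed_simplex \<sigma>"
      using in_realization_VR[OF aK] by metis
    obtain x where "x \<in> \<sigma>" "sum_squares a \<le> a x"
      using vertex_ge_sum_squares[OF \<sigma>(2,3)] by blast
    then show ?thesis
      using n_close(4)[OF \<sigma>(1,3), of x] sum_squares_pos[OF \<sigma>(2,3)] by simp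
  qed
  have n_cont: "continuous_map (realization ?K) (nbhd_space r P) n"
    using continuous_map_compose[OF c_cont short_map_continuous[OF \<Theta>]] n_in
    by (auto simp: nbhd_space_def continuous_map_in_subtopology n_def)

  have "homotopic (realization ?K) (realization ?K) (p \<circ> n) sharpen"
  proof (rule carried_homotopic_realization)
    fix \<sigma> assume \<sigma>: "\<sigma> \<in> ?K"
    then have fin: "finite \<sigma>" and "\<sigma> \<noteq> {}" by (auto simp: VR_iff)
    let ?S = "top_of_set (closed_simplex \<sigma>)"
    have n\<sigma>: "continuous_map ?S (nbhd_space r P) n"
      using n_cont \<sigma> by (simp add: continuous_map_from_realization)
    have "centred ?S P X s r (id \<circ> n) (p \<circ> n)"
      by (rule centred_compose[OF nerve_map_centred[OF p] n\<sigma>])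
    moreover have "centred ?S P X s r (id \<circ> n) sharpen"
      unfolding centred_def
    proof
      fix b assume "b \<in> topspace ?S"
      then have b: "b \<in> closed_simplex \<sigma>" by simp
      \<comment> \<open>\<open>?\<tau>\<close> consists of vertices with weight 1 at
        \<open>b\<close>, which are close to \<open>n b\<close>. Every other vertex is below a
        quarter at \<open>b\<close> and below one half on all of \<open>?N\<close>, where
        \<open>sharpen\<close> therefore ignores it; finiteness of \<open>\<sigma>\<close> makes
        \<open>?N\<close> open.\<close>
      let ?\<tau> = "{x \<in> \<sigma>. sum_squares b / 4 \<le> b x}"
      let ?N = "(\<Inter>x\<in>\<sigma> - ?\<tau>. {a \<in> closed_simplex \<sigma>. a x - sum_squares a / 2 < 0}) \<inter> topspace ?S"
      have "openin ?S {a \<in> closed_simplex \<sigma>. a x - sum_squares a / 2 < 0}" for x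
      proof -
        have "continuous_on (closed_simplex \<sigma>) (\<lambda>a. a x - sum_squares a / 2)"
          by (intro continuous_intros continuous_on_coordinate continuous_on_sum_squares fin) simp
        then show ?thesis
          using continuous_openin_preimage_gen[of "closed_simplex \<sigma>" "\<lambda>a. a x - sum_squares a / 2" "{..<0}"]
          by (simp add: vimage_def Int_def)
      qed
      then have "openin ?S ?N"
        by (intro openin_INT finite_Diff fin)
      moreover have "b \<in> ?N"
        using b sum_squares_pos[OF fin b] by auto
      moreover have "?\<tau> \<noteq> {}"
        using vertex_ge_sum_squares[OF fin b] sum_squares_pos[OF fin b] by force
      moreover have "?\<tau> \<subseteq> close_points P X s r (n b)"
        using n_close[OF \<sigma> b] by (auto simp: close_points_def)
      moreover have "sharpen ` ?N \<subseteq> closed_simplex ?\<tau>"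
      proof safe
        fix a assume "a \<in> topspace ?S"
          then have a: "a \<in> closed_simplex \<sigma>" by simp
          assume aN: "a \<in> (\<Inter>x\<in>\<sigma> - ?\<tau>. {a \<in> closed_simplex \<sigma>. a x - sum_squares a / 2 < 0})"
        show "sharpen a \<in> closed_simplex ?\<tau>"
        proof (rule sharpen_in[OF fin a])
          fix x assume x: "sum_squares a / 2 < a x"
          then have "x \<in> \<sigma>"
            using support(1)[OF fin a] sum_squares_pos[OF fin a] by force
          with x aN show "x \<in> ?\<tau>" by force
        qed auto
      qed
      moreover have "n b \<in> mspace (snd P)"
        by (rule subsetD[OF nbhd_mspace n_in]) (use b \<sigma> in \<open>auto simp: topspace_realization\<close>)
      ultimately show "(id \<circ> n) b \<in> mspace (snd P) \<and> (\<exists>N \<sigma>'. openin ?S N \<and> b \<in> N \<and> \<sigma>' \<noteq> {} \<and> finite \<sigma>' \<and>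
          \<sigma>' \<subseteq> close_points P X s r ((id \<circ> n) b) \<and> sharpen ` N \<subseteq> closed_simplex \<sigma>')"
        using fin by (intro conjI exI[of _ ?N] exI[of _ ?\<tau>]) simp_all
    qed
    ultimately show "carried ?S ?K (p \<circ> n) sharpen"
      by (rule centred_carried[OF m])
    show "continuous_on (closed_simplex \<sigma>) (\<lambda>a. (p \<circ> n) a v)" for v
      using continuous_map_coordinate[OF continuous_map_compose[OF n\<sigma> continuous_map_nerve_map[OF m p]]]
      by simp
    show "continuous_on (closed_simplex \<sigma>) (\<lambda>a. sharpen a v)" for v
      by (rule continuous_on_sharpen[OF fin])
  qed
  then have pn: "homotopic (realization ?K) (realization ?K) (p \<circ> n) id"
    using homotopic_sharpen_id by (rule homotopic_with_trans)

  let ?B = "nbhd_space r P" and ?I = "top_of_set {0..1::real}"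
  have pB: "continuous_map ?B (realization ?K) p"
    by (rule continuous_map_nerve_map[OF m p])
  define h where "h = (\<lambda>(t, z). (1 - t) *\<^sub>R c (p z) + t *\<^sub>R \<Theta>' z)"
  \<comment> \<open>A vertex with large coordinate at \<open>p z\<close> serves both purposes: it
    belongs to a simplex of points close to \<open>z\<close>, and its weight is 1, so that the
    centre is close to it as well.\<close>
  have c_close: "\<exists>x\<in>mspace X. dist (c (p z)) (kuratowski X x0 x) < r \<and> dist (\<Theta>' z) (kuratowski X x0 x) < r"
    if z: "z \<in> nbhd r P" for z
  proof -
    obtain N \<sigma> where N: "openin (nbhd_space r P) N" "z \<in> N" "\<sigma> \<noteq> {}" "finite \<sigma>"
       "\<sigma> \<subseteq> close_points P X s r z" "p ` N \<subseteq> closed_simplex \<sigma>"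
      using nerve_mapE[OF p z] .
    have zP: "z \<in> mspace (snd P)" by (rule subsetD[OF nbhd_mspace z])
    have \<sigma>: "\<sigma> \<in> ?K" by (rule close_points_VR[OF m zP N(3-5)])
    have pz: "p z \<in> closed_simplex \<sigma>" using N by blast
    obtain x where "x \<in> \<sigma>" "sum_squares (p z) \<le> p z x"
      using vertex_ge_sum_squares[OF N(4) pz] by blast
    then have x: "x \<in> \<sigma>" "sum_squares (p z) / 4 \<le> p z x"
      using sum_squares_pos[OF N(4) pz] by auto
    have xX: "x \<in> mspace X" "mdist (snd P) z (s x) < r"
      using x N(5) by (auto simp: close_points_def)
    have "dist (\<Theta>' z) (\<Theta>' (s x)) \<le> mdist (snd P) z (s x)"
      using short_mapD(2)[OF \<Theta>' zP markingD(2)[OF m xX(1)]] by simp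
    then have "dist (\<Theta>' z) (kuratowski X x0 x) < r"
      using \<Theta>s[OF xX(1)] xX(2) by simp
    moreover have "dist (c (p z)) (kuratowski X x0 x) < r"
      using dist_centre_kuratowski(2)[OF x0 \<sigma> pz x(2)] by (simp add: c_def)
    ultimately show ?thesis using xX(1) by blast
  qed
  have \<Theta>'_in: "\<Theta>' z \<in> bfuns (mspace X)" if "z \<in> nbhd r P" for z
    using short_mapD(1)[OF \<Theta>' subsetD[OF nbhd_mspace that]] by simp
  have cp_in: "c (p z) \<in> bfuns (mspace X)" if "z \<in> nbhd r P" for z
    using c_in continuous_map_funspace[OF pB] that by auto
  have h_in: "h (t, z) \<in> bfuns (mspace X)" if "z \<in> nbhd r P" for t z
    using bfuns_convex[OF cp_in[OF that] \<Theta>'_in[OF that]] by (simp add: h_def)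
  have h_nbhd: "\<Theta> (h (t, z)) \<in> nbhd r P" if t: "t \<in> {0..1}" and z: "z \<in> nbhd r P" for t z
  proof -
    obtain x where x: "x \<in> mspace X" "dist (c (p z)) (kuratowski X x0 x) < r" "dist (\<Theta>' z) (kuratowski X x0 x) < r"
      using c_close[OF z] by blast
    \<comment> \<open>Both ends of the path lie in one ball about a point of \<open>X\<close>, and
      balls in a normed space are convex.\<close>
    have "h (t, z) \<in> ball (kuratowski X x0 x) r"
      unfolding h_def prod.case by (rule convexD_alt[OF convex_ball]) (use x t in \<open>auto simp: dist_commute\<close>)
    then show ?thesis
      by (intro \<Theta>_nbhd[OF h_in[OF z] x(1)]) (simp add: dist_commute)
  qed
  have "homotopic ?B ?B (n \<circ> p) (\<Theta> \<circ> \<Theta>')"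
    unfolding homotopic_with_def
  proof (intro exI[of _ "\<Theta> \<circ> h"] conjI allI ballI TrueI)
    have cI: "continuous_map (prod_topology ?I ?B) euclideanreal fst"
      using continuous_map_fst continuous_map_in_subtopology by blast
    have c1: "continuous_map ?B euclidean (c \<circ> p)"
      using continuous_map_compose[OF pB c_cont] by (simp add: Ltop continuous_map_in_subtopology)
    have c2: "continuous_map ?B euclidean \<Theta>'"
      using continuous_map_from_subtopology[OF short_map_continuous[OF \<Theta>'], of "nbhd r P"]
      by (simp add: Ltop continuous_map_in_subtopology nbhd_space_def)
    have "continuous_map (prod_topology ?I ?B) euclidean
        (\<lambda>y. (1 - fst y) *\<^sub>R (c \<circ> p) (snd y) + fst y *\<^sub>R \<Theta>' (snd y))"
      using continuous_map_compose[OF continuous_map_snd c1] continuous_map_compose[OF continuous_map_snd c2]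
      by (intro continuous_map_add continuous_map_scaleR continuous_map_diff cI) (auto simp: o_def)
    moreover have "(\<lambda>y. (1 - fst y) *\<^sub>R (c \<circ> p) (snd y) + fst y *\<^sub>R \<Theta>' (snd y)) = h"
      by (simp add: h_def fun_eq_iff)
    ultimately have "continuous_map (prod_topology ?I ?B) euclidean h"
      by simp
    then have "continuous_map (prod_topology ?I ?B) (mtopology_of ?L) h"
      using h_in by (auto simp: Ltop continuous_map_in_subtopology)
    from continuous_map_compose[OF this short_map_continuous[OF \<Theta>]]
    show "continuous_map (prod_topology ?I ?B) ?B (\<Theta> \<circ> h)"
      using h_nbhd by (subst (2) nbhd_space_def) (auto simp: continuous_map_in_subtopology)
  qed (simp_all add: h_def n_def)
  moreover have "homotopic ?B ?B (\<Theta> \<circ> \<Theta>') id"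
    by (rule pair_homotopic_nbhd[OF ret P])
  ultimately have "homotopic ?B ?B (n \<circ> p) id"
    by (rule homotopic_with_trans)
  with n_cont pn show ?thesis by blast
qed


section \<open>The pair of a metric space and its bounded functions\<close>

text \<open>Objects of \<open>PMet\<close> have their points in \<open>'u\<close> and their ambient
  sets in \<open>\<L>\<close>. The condition on real-valued functions in \<open>size_classes\<close>
  provides room for a copy of the bounded functions, with the metric transported along an injection
  \<open>i\<close>.\<close>

lemma bfun_pair_exists:
  fixes X :: "'u metric"
  assumes size: "size_classes \<S> \<L>" and X: "mspace X \<in> \<S>"
  obtains P i x0 where "P \<in> objs (PMet \<S> \<L>)" "mspace X \<noteq> {} \<Longrightarrow> x0 \<in> mspace X"
    "inj_on i (bfuns (mspace X))" "mspace (snd P) = i ` bfuns (mspace X)"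
    "\<And>\<phi> \<psi>. \<phi> \<in> bfuns (mspace X) \<Longrightarrow> \<psi> \<in> bfuns (mspace X) \<Longrightarrow> mdist (snd P) (i \<phi>) (i \<psi>) = dist \<phi> \<psi>"
    "marking P X (\<lambda>x. i (kuratowski X x0 x))"
proof -
  let ?S = "mspace X"
  define x0 where "x0 = (SOME x. x \<in> mspace X)"
  have x0: "x0 \<in> mspace X" if "mspace X \<noteq> {}"
    using that unfolding x0_def by (simp add: some_in_eq)
  obtain B where B: "B \<in> \<L>" "(?S \<rightarrow>\<^sub>E (UNIV :: real set)) \<lesssim> B"
    using size X unfolding size_classes_def by blast
  have "bfuns ?S \<lesssim> (?S \<rightarrow>\<^sub>E (UNIV :: real set))"
    unfolding lepoll_def
  proof (intro exI conjI)
    let ?f = "\<lambda>\<phi>. \<lambda>y\<in>?S. apply_bcontfun \<phi> (discrete y) :: real"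
    show "inj_on ?f (bfuns ?S)"
    proof (rule inj_onI, rule bcontfun_eqI)
      fix \<phi> \<psi> and z :: "'u discrete"
      assume \<phi>: "\<phi> \<in> bfuns ?S" "\<psi> \<in> bfuns ?S" "?f \<phi> = ?f \<psi>"
      obtain y where y: "z = discrete y" by (metis of_discrete_inverse)
      show "apply_bcontfun \<phi> z = apply_bcontfun \<psi> z"
        using \<phi>(1,2) fun_cong[OF \<phi>(3), of y] unfolding y bfuns_def by (cases "y \<in> ?S") auto
    qed
  qed auto
  then have "bfuns ?S \<lesssim> B" using B(2) by (rule lepoll_trans)
  then obtain i where i: "inj_on i (bfuns ?S)" "i ` bfuns ?S \<subseteq> B"
    by (auto simp: lepoll_def)
  define d where "d u v = dist (inv_into (bfuns ?S) i u) (inv_into (bfuns ?S) i v)" for u v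
  have inv: "inv_into (bfuns ?S) i (i \<phi>) = \<phi>" if "\<phi> \<in> bfuns ?S" for \<phi>
    using i(1) that by simp
  interpret E: Metric_space "i ` bfuns ?S" d
    by unfold_locales (auto simp: d_def dist_commute dist_triangle inv)
  define E where "E = metric (i ` bfuns ?S, d)"
  have mE: "mspace E = i ` bfuns ?S" "mdist E = d"
    by (simp_all add: E_def)
  let ?s = "\<lambda>x. i (kuratowski X x0 x)"
  have k: "kuratowski X x0 x \<in> bfuns ?S" if "x \<in> ?S" for x
    using kuratowski_in[OF that] x0 that by blast
  define P where "P = (submetric E (?s ` ?S), E)"
  have P: "mspace (snd P) = i ` bfuns ?S" "mspace (fst P) = ?s ` ?S" "mdist (snd P) = d" "mdist (fst P) = d"
    using k by (auto simp: P_def mE)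
  have mP: "metric_pair P"
    using k P by (auto simp: metric_pair_def)
  show ?thesis
  proof (rule that[of P x0 i])
    have "mspace (snd P) \<in> \<L>"
      using size B(1) i subset_imp_lepoll[OF i(2)] unfolding size_classes_def P(1) by blast
    moreover have "mspace (fst P) \<in> \<S>"
      using size X image_lepoll[of ?s ?S] unfolding size_classes_def P(2) by blast
    ultimately show "P \<in> objs (PMet \<S> \<L>)" using mP by simp
    show dist: "mdist (snd P) (i \<phi>) (i \<psi>) = dist \<phi> \<psi>" if "\<phi> \<in> bfuns ?S" "\<psi> \<in> bfuns ?S" for \<phi> \<psi>
      using that by (simp add: P d_def inv)
    show "marking P X ?s"
      unfolding marking_def
    proof (intro conjI ballI mP)
      fix x y assume xy: "x \<in> ?S" "y \<in> ?S"
      then have "x0 \<in> ?S" using x0 by blast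
      then show "mdist (snd P) (?s x) (?s y) = mdist X x y"
        using dist[OF k[OF xy(1)] k[OF xy(2)]] dist_kuratowski xy by simp
    qed (simp add: P(2))
  qed (use x0 i P in auto)
qed

text \<open>The pair with bounded functions as ambient space is mapped to \<open>\<eta> X\<close> by
  lifting the inverse of its embedding of \<open>X\<close>. For the way back, the counit followed by
  the Kuratowski embedding is extended to the ambient space of \<open>\<eta> X\<close>. The round
  trip on \<open>\<eta> X\<close> has the same composite with the counit as the identity, so the two
  are homotopic.\<close>

lemma metric_homotopy_pairing_retract:
  assumes size: "size_classes \<S> \<L>" and \<eta>: "metric_homotopy_pairing \<S> \<L> \<eta>"
  obtains s where
    "\<And>X. mspace X \<in> \<S> \<Longrightarrow> \<exists>x0 \<Theta> \<Theta>'. bfun_retract (fob \<eta> X) X (s X) x0 \<Theta> \<Theta>'"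
    "\<And>X Y f F x. \<lbrakk>mspace X \<in> \<S>; mspace Y \<in> \<S>; f \<in> arrs (Met \<S>) X Y; F \<in> far \<eta> X Y f; x \<in> mspace X\<rbrakk>
       \<Longrightarrow> F (s X x) = s Y (f x)"
proof -
  have \<eta>F: "is_functor (Met \<S>) (PMet \<S> \<L>) \<eta>"
    using \<eta> by (simp add: metric_homotopy_pairing_def right_adjoint_def)
  have \<eta>P: "metric_pair (fob \<eta> X)" "fob \<eta> X \<in> objs (PMet \<S> \<L>)" if "mspace X \<in> \<S>" for X
    using is_functor.fob_in[OF \<eta>F] that by auto
  obtain \<epsilon> where \<epsilon>: "\<And>X. mspace X \<in> \<S> \<Longrightarrow> short_map (fst (fob \<eta> X)) X (\<epsilon> X)"
    and nat: "\<And>X Y f F y. \<lbrakk>mspace X \<in> \<S>; mspace Y \<in> \<S>; f \<in> arrs (Met \<S>) X Y; F \<in> far \<eta> X Y f;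
       y \<in> mspace (fst (fob \<eta> X))\<rbrakk> \<Longrightarrow> \<epsilon> Y (F y) = f (\<epsilon> X y)"
    and lift: "\<And>X P j. \<lbrakk>mspace X \<in> \<S>; P \<in> objs (PMet \<S> \<L>); short_map (fst P) X j\<rbrakk> \<Longrightarrow>
       \<exists>\<theta>. pair_map P (fob \<eta> X) \<theta> \<and> (\<forall>x\<in>mspace (fst P). \<epsilon> X (\<theta> x) = j x)"
    and uniq: "\<And>X P f g. \<lbrakk>mspace X \<in> \<S>; P \<in> objs (PMet \<S> \<L>); pair_map P (fob \<eta> X) f; pair_map P (fob \<eta> X) g;
       \<And>x. x \<in> mspace (fst P) \<Longrightarrow> \<epsilon> X (f x) = \<epsilon> X (g x)\<rbrakk> \<Longrightarrow> pair_homotopic P (fob \<eta> X) f g"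
    using metric_homotopy_pairing_counit[OF \<eta>] by blast
  have main: "\<exists>s x0 \<Theta> \<Theta>'. bfun_retract (fob \<eta> X) X s x0 \<Theta> \<Theta>' \<and> (\<forall>x\<in>mspace X. \<epsilon> X (s x) = x)"
    if X: "mspace X \<in> \<S>" for X
  proof -
    let ?S = "mspace X" and ?Q = "fob \<eta> X" and ?L = "submetric euclidean_metric (bfuns (mspace X))"
    obtain P i x0 where P: "P \<in> objs (PMet \<S> \<L>)" and x0: "?S \<noteq> {} \<Longrightarrow> x0 \<in> ?S"
      and i: "inj_on i (bfuns ?S)" and Ps: "mspace (snd P) = i ` bfuns ?S"
      and di: "\<And>\<phi> \<psi>. \<phi> \<in> bfuns ?S \<Longrightarrow> \<psi> \<in> bfuns ?S \<Longrightarrow> mdist (snd P) (i \<phi>) (i \<psi>) = dist \<phi> \<psi>"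
      and mk: "marking P X (\<lambda>x. i (kuratowski X x0 x))"
      using bfun_pair_exists[OF size X] by metis
    define k where "k = kuratowski X x0"
    have k: "k x \<in> bfuns ?S" if "x \<in> ?S" for x
      using kuratowski_in[OF that] x0 that unfolding k_def by blast
    have Pf: "mspace (fst P) = (\<lambda>x. i (k x)) ` ?S"
      using mk by (simp add: marking_def k_def)
    have mP: "metric_pair P" using P by simp
    define i' where "i' = inv_into (bfuns ?S) i"
    have i'i: "i' (i \<phi>) = \<phi>" if "\<phi> \<in> bfuns ?S" for \<phi>
      using i that by (simp add: i'_def)
    have i': "i' u \<in> bfuns ?S" "i (i' u) = u" if "u \<in> mspace (snd P)" for u
      using that Ps i'i by auto
    have i_short: "short_map ?L (snd P) i"
      using Ps di by (auto simp: short_map_def)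
    have i'_short: "short_map (snd P) ?L i'"
      using i' di by (auto simp: short_map_def) (metis order_refl)
    have dk: "mdist (fst P) (i (k x)) (i (k y)) = mdist X x y" if "x \<in> ?S" "y \<in> ?S" for x y
    proof -
      have "mdist (fst P) (i (k x)) (i (k y)) = mdist (snd P) (i (k x)) (i (k y))"
        using mP Pf that unfolding metric_pair_def by blast
      also have "\<dots> = mdist X x y"
        using mk that by (simp add: marking_def k_def)
      finally show ?thesis .
    qed
    have ik_inj: "inj_on (\<lambda>x. i (k x)) ?S"
    proof (rule inj_onI)
      fix x y assume xy: "x \<in> ?S" "y \<in> ?S" "i (k x) = i (k y)"
      have "i (k y) \<in> mspace (fst P)" using Pf xy by blast
      then have "mdist (fst P) (i (k y)) (i (k y)) = 0" by simp
      then have "mdist X x y = 0" using dk[OF xy(1,2)] xy(3) by simp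
      then show "x = y" using xy by simp
    qed
    \<comment> \<open>Inverse of the isometry of \<open>X\<close> onto the subspace of
      \<open>P\<close>; its lift through the adjunction is \<open>\<theta>\<close>.\<close>
    define j where "j = inv_into ?S (\<lambda>x. i (k x))"
    have j: "j (i (k x)) = x" if "x \<in> ?S" for x
      unfolding j_def by (rule inv_into_f_f[OF ik_inj that])
    have j_short: "short_map (fst P) X j"
      unfolding short_map_def Pf by (auto simp: j dk)
    obtain \<theta> where \<theta>: "pair_map P ?Q \<theta>" "\<And>x. x \<in> mspace (fst P) \<Longrightarrow> \<epsilon> X (\<theta> x) = j x"
      using lift[OF X P j_short] by blast
    have \<theta>_short: "short_map (snd P) (snd ?Q) \<theta>" using \<theta>(1) by (simp add: pair_map_def)
    have \<epsilon>\<theta>: "\<epsilon> X (\<theta> (i (k x))) = x" if "x \<in> ?S" for x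
      using \<theta>(2)[of "i (k x)"] Pf j that by auto

    have \<epsilon>S: "\<epsilon> X y \<in> ?S" if "y \<in> mspace (fst ?Q)" for y
      using short_mapD(1)[OF \<epsilon>[OF X] that] .
    have mQ: "metric_pair ?Q" by (rule \<eta>P(1)[OF X])
    have Q_sub: "mspace (fst ?Q) \<subseteq> mspace (snd ?Q)"
      using mQ by (simp add: metric_pair_def)
    have Q_dist: "mdist (fst ?Q) y z = mdist (snd ?Q) y z" if "y \<in> mspace (fst ?Q)" "z \<in> mspace (fst ?Q)" for y z
      using mQ that by (simp add: metric_pair_def)
    obtain \<Theta>' where \<Theta>': "\<And>z. z \<in> mspace (snd ?Q) \<Longrightarrow> \<Theta>' z \<in> bfuns ?S"
      "\<And>y. y \<in> mspace (fst ?Q) \<Longrightarrow> \<Theta>' y = k (\<epsilon> X y)"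
      "\<And>y z. y \<in> mspace (snd ?Q) \<Longrightarrow> z \<in> mspace (snd ?Q) \<Longrightarrow> dist (\<Theta>' y) (\<Theta>' z) \<le> mdist (snd ?Q) y z"
    proof (rule short_extension[OF Q_sub, of "\<lambda>y. k (\<epsilon> X y)" ?S])
      show "k (\<epsilon> X y) \<in> bfuns ?S" if "y \<in> mspace (fst ?Q)" for y
        using k \<epsilon>S that by blast
      show "dist (k (\<epsilon> X y)) (k (\<epsilon> X z)) \<le> mdist (snd ?Q) y z"
        if "y \<in> mspace (fst ?Q)" "z \<in> mspace (fst ?Q)" for y z
      proof -
        have "dist (k (\<epsilon> X y)) (k (\<epsilon> X z)) = mdist X (\<epsilon> X y) (\<epsilon> X z)"
          unfolding k_def by (rule dist_kuratowski) (use \<epsilon>S that x0 in auto)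
        also have "\<dots> \<le> mdist (snd ?Q) y z"
          using short_mapD(2)[OF \<epsilon>[OF X] that] Q_dist[OF that] by simp
        finally show ?thesis .
      qed
    qed blast
    have \<Theta>'_short: "short_map (snd ?Q) ?L \<Theta>'"
      using \<Theta>' by (auto simp: short_map_def)
    have \<theta>': "pair_map ?Q P (i \<circ> \<Theta>')"
      unfolding pair_map_def
      using short_map_compose[OF \<Theta>'_short i_short] \<Theta>'(2) \<epsilon>S Pf by auto
    have hom: "pair_homotopic ?Q ?Q (\<theta> \<circ> (i \<circ> \<Theta>')) id"
    proof (rule uniq[OF X \<eta>P(2)[OF X] pair_map_compose[OF \<theta>' \<theta>(1)] pair_map_id])
      fix y assume "y \<in> mspace (fst ?Q)"
      then show "\<epsilon> X ((\<theta> \<circ> (i \<circ> \<Theta>')) y) = \<epsilon> X (id y)"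
        using \<Theta>'(2) \<epsilon>\<theta>[OF \<epsilon>S] by simp
    qed
    define s where "s x = \<theta> (i (k x))" for x
    have sQ: "s x \<in> mspace (fst ?Q)" if "x \<in> ?S" for x
      using \<theta>(1) Pf that unfolding s_def pair_map_def by blast
    \<comment> \<open>The homotopy is constant on the subspace, so its two ends agree there exactly;
      thus \<open>\<epsilon> X\<close> is a bijection with inverse \<open>s\<close>.\<close>
    have s\<epsilon>: "s (\<epsilon> X y) = y" if "y \<in> mspace (fst ?Q)" for y
      using pair_homotopic_agree[OF hom that] \<Theta>'(2)[OF that] by (simp add: s_def)
    have "marking ?Q X s"
      unfolding marking_def
    proof (intro conjI ballI mQ)
      show "s ` ?S = mspace (fst ?Q)"
        using sQ s\<epsilon> \<epsilon>S by (metis image_eqI image_subsetI subsetI subset_antisym)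
      fix x y assume xy: "x \<in> ?S" "y \<in> ?S"
      show "mdist (snd ?Q) (s x) (s y) = mdist X x y"
      \<comment> \<open>\<open>s\<close> is an isometry followed by the 1-Lipschitz map
        \<open>\<theta>\<close>, and the 1-Lipschitz map \<open>\<epsilon> X\<close> undoes
        it.\<close>
      proof (rule antisym)
        have "mdist (snd ?Q) (s x) (s y) \<le> mdist (snd P) (i (k x)) (i (k y))"
          unfolding s_def by (rule short_mapD(2)[OF \<theta>_short]) (use k xy Ps in auto)
        also have "\<dots> = mdist X x y"
          using mk xy by (simp add: marking_def k_def)
        finally show "mdist (snd ?Q) (s x) (s y) \<le> mdist X x y" .
        have "mdist X (\<epsilon> X (s x)) (\<epsilon> X (s y)) \<le> mdist (fst ?Q) (s x) (s y)"
          by (rule short_mapD(2)[OF \<epsilon>[OF X]]) (use sQ xy in auto)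
        then show "mdist X x y \<le> mdist (snd ?Q) (s x) (s y)"
          using \<epsilon>\<theta> xy Q_dist[OF sQ sQ] by (simp add: s_def)
      qed
    qed
    moreover have "short_map ?L (snd ?Q) (\<theta> \<circ> i)"
      by (rule short_map_compose[OF i_short \<theta>_short])
    moreover have "\<Theta>' (s x) = k x" if "x \<in> ?S" for x
      using \<Theta>'(2)[OF sQ[OF that]] \<epsilon>\<theta>[OF that] by (simp add: s_def)
    ultimately have "bfun_retract ?Q X s x0 (\<theta> \<circ> i) \<Theta>'"
      using x0 \<Theta>'_short hom unfolding bfun_retract_def by (simp add: s_def k_def comp_assoc)
    moreover have "\<forall>x\<in>?S. \<epsilon> X (s x) = x"
      using \<epsilon>\<theta> by (simp add: s_def)
    ultimately show ?thesis by blast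
  qed
  then obtain s where s: "\<And>X. mspace X \<in> \<S> \<Longrightarrow> \<exists>x0 \<Theta> \<Theta>'. bfun_retract (fob \<eta> X) X (s X) x0 \<Theta> \<Theta>'"
    "\<And>X x. mspace X \<in> \<S> \<Longrightarrow> x \<in> mspace X \<Longrightarrow> \<epsilon> X (s X x) = x"
    by metis
  show ?thesis
  proof
    show "\<exists>x0 \<Theta> \<Theta>'. bfun_retract (fob \<eta> X) X (s X) x0 \<Theta> \<Theta>'" if "mspace X \<in> \<S>" for X
      using s(1)[OF that] .
    fix X Y f F x assume X: "mspace X \<in> \<S>" and Y: "mspace Y \<in> \<S>" and f: "f \<in> arrs (Met \<S>) X Y"
      and F: "F \<in> far \<eta> X Y f" and x: "x \<in> mspace X"
    have mark: "marking (fob \<eta> Z) Z (s Z)" if "mspace Z \<in> \<S>" for Z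
      using s(1)[OF that] by (auto simp: bfun_retract_def)
    have sx: "s X x \<in> mspace (fst (fob \<eta> X))"
      by (rule markingD(1)[OF mark[OF X] x])
    have "far \<eta> X Y f \<in> arrs (PMet \<S> \<L>) (fob \<eta> X) (fob \<eta> Y)"
      using is_functor.far_in[OF \<eta>F _ _ f] X Y by simp
    then obtain F' where "far \<eta> X Y f = pair_class (fob \<eta> X) (fob \<eta> Y) {F'}" by auto
    then have "pair_map (fob \<eta> X) (fob \<eta> Y) F"
      using F pair_homotopic_pair_map[OF pair_homotopic_sym] by (simp add: mem_pair_class)
    then have "F (s X x) \<in> mspace (fst (fob \<eta> Y))"
      using sx by (auto simp: pair_map_def)
    \<comment> \<open>Naturality of \<open>s\<close> follows from that of the counit, as
      \<open>s Y\<close> is onto and \<open>\<epsilon> Y\<close> recovers \<open>y\<close>.\<close>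
    then obtain y where y: "y \<in> mspace Y" "F (s X x) = s Y y"
      using mark[OF Y] unfolding marking_def by (metis imageE)
    have "y = \<epsilon> Y (F (s X x))" using s(2)[OF Y y(1)] y(2) by simp
    also have "\<dots> = f x" using nat[OF X Y f F sx] s(2)[OF X x] by simp
    finally show "F (s X x) = s Y (f x)" using y(2) by simp
  qed
qed

theorem theorem5:
  fixes \<S> \<L> :: "'u set set"
    and \<eta> :: "('u metric, 'u \<Rightarrow> 'u, 'u metric \<times> 'u metric, ('u \<Rightarrow> 'u) set) func"
  assumes "size_classes \<S> \<L>"
    and "metric_homotopy_pairing \<S> \<L> \<eta>"
  shows "naturally_isomorphic (Met \<S>)
           (hTop {0<..} :: (('u + ('u \<Rightarrow> real)) family, _) cat)
           (relabel {0<..} Inl \<circ>\<^sub>F (B_star \<circ>\<^sub>F \<eta>))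
           (relabel {0<..} Inr \<circ>\<^sub>F VR_2star)"
proof -
  obtain s where s: "\<And>X. mspace X \<in> \<S> \<Longrightarrow> \<exists>x0 \<Theta> \<Theta>'. bfun_retract (fob \<eta> X) X (s X) x0 \<Theta> \<Theta>'"
    and nat: "\<And>X Y f F x. \<lbrakk>mspace X \<in> \<S>; mspace Y \<in> \<S>; f \<in> arrs (Met \<S>) X Y; F \<in> far \<eta> X Y f; x \<in> mspace X\<rbrakk>
       \<Longrightarrow> F (s X x) = s Y (f x)"
    using metric_homotopy_pairing_retract[OF assms] by blast
  have mark: "marking (fob \<eta> X) X (s X)" if "mspace X \<in> \<S>" for X
    using s[OF that] by (auto simp: bfun_retract_def)
  have \<eta>F: "is_functor (Met \<S>) (PMet \<S> \<L>) \<eta>"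
    using assms(2) by (simp add: metric_homotopy_pairing_def right_adjoint_def)
  \<comment> \<open>The maps are chosen for each space and radius independently; any such choices
    are compatible up to homotopy.\<close>
  obtain p where p: "\<And>X r. mspace X \<in> \<S> \<Longrightarrow> nerve_map (fob \<eta> X) X (s X) r (p X r)"
    using nerve_map_exists[OF mark] by metis
  show ?thesis
  \<comment> \<open>The tags \<open>Inl\<close> and \<open>Inr\<close> only serve to place points
    and coordinate functions in one type.\<close>
  proof (rule natural_iso_relabel[where m = p])
    show "is_functor (Met \<S>) (hTop {0<..}) (B_star \<circ>\<^sub>F \<eta>)"
      by (rule is_functor_fcomp[OF \<eta>F is_functor_B_star])
    show "is_functor (Met \<S>) (hTop {0<..}) VR_2star"
      by (rule is_functor_VR_2star)
  next
    fix X assume "X \<in> objs (Met \<S>)"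
    then have X: "mspace X \<in> \<S>" by simp
    show "family_hom {0<..} (fob (B_star \<circ>\<^sub>F \<eta>) X) (fob VR_2star X) (p X)"
      unfolding family_hom_def
      using continuous_map_nerve_map[OF mark[OF X] p[OF X]]
        nerve_map_step[OF mark[OF X] p[OF X] p[OF X]] by (simp add: fcomp_def)
    show "\<exists>n. continuous_map (stage (fob VR_2star X) r) (stage (fob (B_star \<circ>\<^sub>F \<eta>) X) r) n \<and>
        homotopic (stage (fob (B_star \<circ>\<^sub>F \<eta>) X) r) (stage (fob (B_star \<circ>\<^sub>F \<eta>) X) r) (n \<circ> p X r) id \<and>
        homotopic (stage (fob VR_2star X) r) (stage (fob VR_2star X) r) (p X r \<circ> n) id" for r
      using s[OF X] bfun_retract_equivalence[OF _ p[OF X]] by (auto simp: fcomp_def)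
  next
    fix X Y f and r :: real
    assume "X \<in> objs (Met \<S>)" "Y \<in> objs (Met \<S>)" and f: "f \<in> arrs (Met \<S>) X Y" and r: "r \<in> {0<..}"
    then have X: "mspace X \<in> \<S>" and Y: "mspace Y \<in> \<S>" by auto
    have mX: "metric_pair (fob \<eta> X)" and mY: "metric_pair (fob \<eta> Y)"
      using mark X Y by (auto simp: marking_def)
    have fs: "short_map X Y f" using f by simp
    have "far \<eta> X Y f \<in> arrs (PMet \<S> \<L>) (fob \<eta> X) (fob \<eta> Y)"
      using is_functor.far_in[OF \<eta>F _ _ f] X Y by simp
    then obtain F where F: "pair_map (fob \<eta> X) (fob \<eta> Y) F"
      "far \<eta> X Y f = pair_class (fob \<eta> X) (fob \<eta> Y) {F}" by auto
    have "F \<in> far \<eta> X Y f"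
      unfolding F(2) mem_pair_class by (rule pair_homotopic_cong[OF F(1) mX mY]) simp
    then have "homotopic (nbhd_space r (fob \<eta> X)) (realization (VR (2 * r) Y))
        (p Y r \<circ> F) (simplicial_extension f \<circ> p X r)"
      by (intro nerve_map_natural[OF mark[OF X] mark[OF Y] p[OF X] p[OF Y] F(1) fs] nat[OF X Y f])
    moreover have "F \<in> far (B_star \<circ>\<^sub>F \<eta>) X Y f r"
      using r continuous_map_nbhd_space[OF F(1) mX]
      by (simp add: fcomp_def F(2) far_B_star[OF F(1) mX mY] family_class_def mem_homotopy_class)
    moreover have "simplicial_extension f \<in> far VR_2star X Y f r"
      using r continuous_map_VR[OF fs] by (simp add: far_VR_2star family_class_def mem_homotopy_class)
    ultimately show "\<exists>a\<in>far (B_star \<circ>\<^sub>F \<eta>) X Y f r. \<exists>b\<in>far VR_2star X Y f r.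
        homotopic (stage (fob (B_star \<circ>\<^sub>F \<eta>) X) r) (stage (fob VR_2star Y) r) (p Y r \<circ> a) (b \<circ> p X r)"
      by (auto simp: fcomp_def)
  qed simp_all
qed

end
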